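(* Let $X_1$ be a random vector in $\mathbb R^d$ with $0\in\operatorname{int}\mathcal D_{\mathcal L}$, and let $f:[0,1]\to\mathbb R$ be a non-zero Lipschitz function. Then the sequence $\big(\frac1n\sum_{k=1}^n f(\frac kn)X_k\big)_{n\ge1}$ satisfies the LDP in $\mathbb R^d$ with speed $n$ and the tight rate function $I_f$ defined as the Legendre–Fenchel transform of the convex function $$E_f(\lambda):=\int_0^1K(\lambda f(t))dt,\qquad\lambda\in\mathbb R^d,$$ i.e. $I_f(x)=\sup_{\lambda\in\mathbb R^d}(\lambda\cdot x-E_f(\lambda))$. Moreover, if $\dim(\operatorname{supp}X_1)=d$, then $\nabla E_f$ is an injective function on its domain $\operatorname{int}D_f$, where $D_f:=\frac{\mathcal D_{\mathcal L}}{\max f_+}\cap\frac{-\mathcal D_{\mathcal L}}{\max f_-}$, and $$I_f(x)=\int_0^1 I\big(\nabla K((\nabla E_f)^{-1}(x)f(t))\big)dt,\qquad x\in\nabla E_f(\operatorname{int}D_f);$$ and for $d=1$ this equality extends to $$I_f(x)=M_+(x-\sup E_f')_++M_-(x-\inf E_f')_-+\int_0^1I\Big(K'\big(\overline{(E_f')^{-1}}(x)f(t)\big)\Big)dt,\qquad x\in\mathbb R,$$ where $M_\pm:=\min\big(\frac{I_\infty(1)}{\max f_\pm},\frac{I_\infty(-1)}{\max f_\mp}\big)$ and $K'(\pm I_\infty(\pm1)):=K'(\pm I_\infty(\pm1)\mp)$.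
   Context: $X_1,X_2,\dots$ are i.i.d. random vectors in $\mathbb R^d$. $\mathcal L(u):=\mathbb Ee^{u\cdot X_1}$, $\mathcal D_{\mathcal L}:=\{u:\mathcal L(u)<\infty\}$, $K:=\log\mathcal L$ (finite and smooth on $\operatorname{int}\mathcal D_{\mathcal L}$), $I(v):=\sup_u(u\cdot v-K(u))$, $I_\infty(v):=\sup\{u\cdot v:u\in\mathcal D_{\mathcal L}\}$. $\dim(\operatorname{supp}X_1)$ is the dimension of the affine hull of the support of the law of $X_1$. For real $x$: $x_+:=\max(x,0)$, $x_-:=(-x)_+$, and likewise for functions; $\max f_\pm$ denotes $\max_{t\in[0,1]}f_\pm(t)$. Conventions: $\frac10:=+\infty$ and $\frac C0:=\mathbb R^d$ for any $C\subset\mathbb R^d$ with $0\in\operatorname{int}C$. For $d=1$: $\sup E_f'$, $\inf E_f'$ denote the supremum/infimum of $E_f'$ over its domain $\operatorname{int}D_f$; for a real increasing function $g$ on an interval $(a,b)$ ($-\infty\le a<b\le\infty$), $\bar g$ is its extension to $\mathbb R$ by $\bar g(x):=g(b-)$ for $x\ge b$ and $\bar g(x):=g(a+)$ for $x\le a$ (applied to $g=(E_f')^{-1}$ on $(\inf E_f',\sup E_f')$); $K'(\pm I_\infty(\pm1)\mp)$ denotes the left limit of $K'$ at $I_\infty(1)$ and the right limit at $-I_\infty(-1)$. LDP with tight rate function $\mathcal J$ (lower semi-continuous, compact sub-level sets) and speed $n$: for every Borel $B$, $-\inf_{\operatorname{int}B}\mathcal J\le\liminf\frac1n\log\mathbb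 P(\cdot\in B)\le\limsup\frac1n\log\mathbb P(\cdot\in B)\le-\inf_{\operatorname{cl}B}\mathcal J$. *)

theory Defs
  imports "HOL-Probability.Probability"
begin

definition lapl :: "'a measure \<Rightarrow> ('a \<Rightarrow> 'v::euclidean_space) \<Rightarrow> 'v \<Rightarrow> ennreal" where
  "lapl M Y u = (\<integral>\<^sup>+ \<omega>. ennreal (exp (u \<bullet> Y \<omega>)) \<partial>M)"

definition domL :: "'a measure \<Rightarrow> ('a \<Rightarrow> 'v::euclidean_space) \<Rightarrow> 'v set" where
  "domL M Y = {u. lapl M Y u < \<infinity>}"

text \<open>K = log L (meaningful on domL)\<close>
definition cgf :: "'a measure \<Rightarrow> ('a \<Rightarrow> 'v::euclidean_space) \<Rightarrow> 'v \<Rightarrow> real" where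
  "cgf M Y u = ln (enn2real (lapl M Y u))"

definition cgf_ext :: "'a measure \<Rightarrow> ('a \<Rightarrow> 'v::euclidean_space) \<Rightarrow> 'v \<Rightarrow> ereal" where
  "cgf_ext M Y u = (if u \<in> domL M Y then ereal (cgf M Y u) else \<infinity>)"

text \<open>I(v) = sup_u (u.v - K(u)) (terms with u outside D_L are -infinity)\<close>
definition cramer :: "'a measure \<Rightarrow> ('a \<Rightarrow> 'v::euclidean_space) \<Rightarrow> 'v \<Rightarrow> ereal" where
  "cramer M Y v = (SUP u\<in>domL M Y. ereal (u \<bullet> v - cgf M Y u))"

definition Iinf :: "'a measure \<Rightarrow> ('a \<Rightarrow> 'v::euclidean_space) \<Rightarrow> 'v \<Rightarrow> ereal" where
  "Iinf M Y v = (SUP u\<in>domL M Y. ereal (u \<bullet> v))"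

text \<open>E_f(lambda) = int_0^1 K(lambda f(t)) dt  (split into positive and negative parts)\<close>
definition Ef :: "'a measure \<Rightarrow> ('a \<Rightarrow> 'v::euclidean_space) \<Rightarrow> (real \<Rightarrow> real) \<Rightarrow> 'v \<Rightarrow> ereal" where
  "Ef M Y f l =
     enn2ereal (\<integral>\<^sup>+ t\<in>{0..1}. e2ennreal (cgf_ext M Y (f t *\<^sub>R l)) \<partial>lborel)
   - enn2ereal (\<integral>\<^sup>+ t\<in>{0..1}. e2ennreal (- cgf_ext M Y (f t *\<^sub>R l)) \<partial>lborel)"

text \<open>real-valued version of E_f (used where E_f is finite)\<close>
definition Efr :: "'a measure \<Rightarrow> ('a \<Rightarrow> 'v::euclidean_space) \<Rightarrow> (real \<Rightarrow> real) \<Rightarrow> 'v \<Rightarrow> real" where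
  "Efr M Y f l = real_of_ereal (Ef M Y f l)"

definition If :: "'a measure \<Rightarrow> ('a \<Rightarrow> 'v::euclidean_space) \<Rightarrow> (real \<Rightarrow> real) \<Rightarrow> 'v \<Rightarrow> ereal" where
  "If M Y f x = (SUP l. ereal (l \<bullet> x) - Ef M Y f l)"

definition grad :: "('v::euclidean_space \<Rightarrow> real) \<Rightarrow> 'v \<Rightarrow> 'v" where
  "grad F x = (SOME g. (F has_derivative (\<lambda>h. g \<bullet> h)) (at x))"

definition fpmax :: "(real \<Rightarrow> real) \<Rightarrow> real" where
  "fpmax f = Sup ((\<lambda>t. max (f t) 0) ` {0..1})"
definition fmmax :: "(real \<Rightarrow> real) \<Rightarrow> real" where
  "fmmax f = Sup ((\<lambda>t. max (- f t) 0) ` {0..1})"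

definition divset :: "'v::real_vector set \<Rightarrow> real \<Rightarrow> 'v set" where
  "divset C a = (if a = 0 then UNIV else (\<lambda>x. (1 / a) *\<^sub>R x) ` C)"

definition Df :: "'a measure \<Rightarrow> ('a \<Rightarrow> 'v::euclidean_space) \<Rightarrow> (real \<Rightarrow> real) \<Rightarrow> 'v set" where
  "Df M Y f = divset (domL M Y) (fpmax f) \<inter> divset (uminus ` domL M Y) (fmmax f)"

definition law_support :: "'a measure \<Rightarrow> ('a \<Rightarrow> 'v::metric_space) \<Rightarrow> 'v set" where
  "law_support M Y = {x. \<forall>e>0. measure M {\<omega>\<in>space M. Y \<omega> \<in> ball x e} > 0}"

definition lnp :: "nat \<Rightarrow> real \<Rightarrow> ereal" where
  "lnp n p = (if p = 0 then -\<infinity> else ereal (ln p / real n))"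

definition ldp :: "'a measure \<Rightarrow> (nat \<Rightarrow> 'a \<Rightarrow> 'v::metric_space) \<Rightarrow> ('v \<Rightarrow> ereal) \<Rightarrow> bool" where
  "ldp M Z J \<longleftrightarrow>
     (\<forall>c::ereal. closed {x. J x \<le> c}) \<and>
     (\<forall>c::real. compact {x. J x \<le> ereal c}) \<and>
     (\<forall>B\<in>sets borel.
        - (INF x\<in>interior B. J x) \<le> liminf (\<lambda>n. lnp n (measure M {\<omega>\<in>space M. Z n \<omega> \<in> B})) \<and>
        limsup (\<lambda>n. lnp n (measure M {\<omega>\<in>space M. Z n \<omega> \<in> B})) \<le> - (INF x\<in>closure B. J x))"

definition wmean :: "(nat \<Rightarrow> 'a \<Rightarrow> 'v::real_vector) \<Rightarrow> (real \<Rightarrow> real) \<Rightarrow> nat \<Rightarrow> 'a \<Rightarrow> 'v" where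
  "wmean X f n \<omega> = (1 / real n) *\<^sub>R (\<Sum>k\<in>{1..n}. f (real k / real n) *\<^sub>R X k \<omega>)"

section \<open>One-dimensional objects (d = 1), via the unit basis vector b\<close>

definition ediv :: "ereal \<Rightarrow> real \<Rightarrow> ereal" where
  "ediv a c = (if c = 0 then \<infinity> else a / ereal c)"

definition dom1 :: "'a measure \<Rightarrow> ('a \<Rightarrow> 'v::euclidean_space) \<Rightarrow> 'v \<Rightarrow> real set" where
  "dom1 M Y b = {s. s *\<^sub>R b \<in> domL M Y}"

definition k1 :: "'a measure \<Rightarrow> ('a \<Rightarrow> 'v::euclidean_space) \<Rightarrow> 'v \<Rightarrow> real \<Rightarrow> real" where
  "k1 M Y b s = cgf M Y (s *\<^sub>R b)"

definition Kd1 :: "'a measure \<Rightarrow> ('a \<Rightarrow> 'v::euclidean_space) \<Rightarrow> 'v \<Rightarrow> ereal \<Rightarrow> ereal" where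
  "Kd1 M Y b s =
     (if s \<in> ereal ` interior (dom1 M Y b) then ereal (deriv (k1 M Y b) (real_of_ereal s))
      else if s = Iinf M Y b then Lim (at_left s) (\<lambda>y. ereal (deriv (k1 M Y b) (real_of_ereal y)))
      else if s = - Iinf M Y (- b) then Lim (at_right s) (\<lambda>y. ereal (deriv (k1 M Y b) (real_of_ereal y)))
      else 0)"

text \<open>I evaluated at an extended real (value +infinity at +-infinity; irrelevant null set)\<close>
definition Ie :: "'a measure \<Rightarrow> ('a \<Rightarrow> 'v::euclidean_space) \<Rightarrow> 'v \<Rightarrow> ereal \<Rightarrow> ereal" where
  "Ie M Y b y = (case y of ereal r \<Rightarrow> cramer M Y (r *\<^sub>R b) | _ \<Rightarrow> \<infinity>)"

definition E1r :: "'a measure \<Rightarrow> ('a \<Rightarrow> 'v::euclidean_space) \<Rightarrow> (real \<Rightarrow> real) \<Rightarrow> 'v \<Rightarrow> real \<Rightarrow> real" where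
  "E1r M Y f b s = Efr M Y f (s *\<^sub>R b)"

definition Df1 :: "'a measure \<Rightarrow> ('a \<Rightarrow> 'v::euclidean_space) \<Rightarrow> (real \<Rightarrow> real) \<Rightarrow> 'v \<Rightarrow> real set" where
  "Df1 M Y f b = {s. s *\<^sub>R b \<in> Df M Y f}"

definition supEd :: "'a measure \<Rightarrow> ('a \<Rightarrow> 'v::euclidean_space) \<Rightarrow> (real \<Rightarrow> real) \<Rightarrow> 'v \<Rightarrow> ereal" where
  "supEd M Y f b = (SUP s\<in>interior (Df1 M Y f b). ereal (deriv (E1r M Y f b) s))"
definition infEd :: "'a measure \<Rightarrow> ('a \<Rightarrow> 'v::euclidean_space) \<Rightarrow> (real \<Rightarrow> real) \<Rightarrow> 'v \<Rightarrow> ereal" where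
  "infEd M Y f b = (INF s\<in>interior (Df1 M Y f b). ereal (deriv (E1r M Y f b) s))"

definition ginv :: "'a measure \<Rightarrow> ('a \<Rightarrow> 'v::euclidean_space) \<Rightarrow> (real \<Rightarrow> real) \<Rightarrow> 'v \<Rightarrow> real \<Rightarrow> real" where
  "ginv M Y f b = inv_into (interior (Df1 M Y f b)) (deriv (E1r M Y f b))"

definition gbar :: "'a measure \<Rightarrow> ('a \<Rightarrow> 'v::euclidean_space) \<Rightarrow> (real \<Rightarrow> real) \<Rightarrow> 'v \<Rightarrow> real \<Rightarrow> ereal" where
  "gbar M Y f b x =
     (let G = (\<lambda>y::ereal. ereal (ginv M Y f b (real_of_ereal y))) in
      if ereal x \<ge> supEd M Y f b then Lim (at_left (supEd M Y f b)) G
      else if ereal x \<le> infEd M Y f b then Lim (at_right (infEd M Y f b)) G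
      else G (ereal x))"

definition Mplus :: "'a measure \<Rightarrow> ('a \<Rightarrow> 'v::euclidean_space) \<Rightarrow> (real \<Rightarrow> real) \<Rightarrow> 'v \<Rightarrow> ereal" where
  "Mplus M Y f b = min (ediv (Iinf M Y b) (fpmax f)) (ediv (Iinf M Y (- b)) (fmmax f))"
definition Mminus :: "'a measure \<Rightarrow> ('a \<Rightarrow> 'v::euclidean_space) \<Rightarrow> (real \<Rightarrow> real) \<Rightarrow> 'v \<Rightarrow> ereal" where
  "Mminus M Y f b = min (ediv (Iinf M Y b) (fmmax f)) (ediv (Iinf M Y (- b)) (fpmax f))"

end

theory Submission
  imports Defs
begin

text \<open>
  By independence, the logarithmic exponential moments of the weighted mean are Riemann sums
  of \<open>t \<mapsto> K (f t *\<^sub>R l)\<close>, hence converge to \<open>E\<^sub>f l\<close> as soon as all points \<open>f t *\<^sub>R l\<close> are interior to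
  the domain of \<open>K\<close>. These \<open>l\<close> already determine \<open>I\<^sub>f\<close>, because \<open>E\<^sub>f (r *\<^sub>R l) \<le> r * E\<^sub>f l\<close> for \<open>r < 1\<close>, and
  Chernoff's inequality on finitely many half-spaces gives the upper bound. Since \<open>E\<^sub>f\<close> need not be steep,
  the lower bound is obtained on the event that all \<open>X\<^sub>k\<close> lie in a ball: there the limit of the exponential
  moments is finite and differentiable everywhere, and it increases to \<open>E\<^sub>f\<close> with the radius.

  If \<open>X\<^sub>1\<close> has full support, \<open>E\<^sub>f\<close> is strictly convex, and at a gradient both \<open>I\<close> and \<open>I\<^sub>f\<close> are given by
  Young's equality, which integrates over \<open>t\<close>. In dimension one, for \<open>x\<close> beyond the range of \<open>E\<^sub>f'\<close> the supremum
  defining \<open>I\<^sub>f x\<close> is a monotone limit at the end of the domain; it splits into a linear part and a monotone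
  limit of the integrals from the interior. Replacing \<open>f\<close> by \<open>-f\<close> exchanges the two ends.
\<close>

section \<open>Exponential moments\<close>

text \<open>The calculus of exponential moments is set up for finite nonzero measures, so that
  \<open>M\<close> and its restriction to the event that \<open>Y\<close> lies in a ball are
  instances of one theory. Conditioning and normalising constants never occur, and discarding mass
  can only lower the probabilities in the lower bound. The normalisation \<open>K 0 = 0\<close> is
  assumed separately where the rate function is evaluated.

  One inequality carries most of the convex analysis: \<open>K\<close> lies above its tangents at
  interior points. It provides an integrable minorant, without which the difference of integrals in
  \<open>Ef\<close> could be infinity minus infinity. Integrated over \<open>t\<close>, it gives the
  subgradient inequality for \<open>E_f\<close>, its differentiability and Young's equality, and its
  equality case gives strict convexity. Second derivatives are nowhere used.

  The awkward points are those on the boundary of the domain, where \<open>E_f\<close> can be finite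
  without being differentiable. They are reached only as limits along rays or along monotone
  sequences from the interior.\<close>

text \<open>Everything comes from \<open>exp x \<ge> 1 + x\<close>, used at \<open>s\<close> and at
  \<open>-s\<close>. The bound is global in \<open>s\<close>, so it yields an explicit quadratic
  remainder when exponential moments are differentiated.\<close>

lemma exp_second_order_bound:
  fixes s :: real
  shows "\<bar>exp s - 1 - s\<bar> \<le> s\<^sup>2 * exp \<bar>s\<bar>"
proof -
  have lower: "0 \<le> exp s - 1 - s"
    using exp_ge_add_one_self[of s] by linarith
  have "(1 - s) * exp s \<le> exp (-s) * exp s"
    using exp_ge_add_one_self[of "-s"] by (intro mult_right_mono) auto
  then have A: "exp s - 1 - s \<le> s * (exp s - 1)"
    by (simp add: exp_minus algebra_simps)
  have B: "s * (exp s - 1) \<le> s\<^sup>2 * exp \<bar>s\<bar>"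
  proof (cases "s \<ge> 0")
    case True
    have "(1 - s) * exp s \<le> 1"
      using \<open>(1 - s) * exp s \<le> exp (-s) * exp s\<close> by (simp add: exp_minus)
    then have "s * (exp s - 1) \<le> s * (s * exp s)"
      using True by (intro mult_left_mono) (auto simp: algebra_simps)
    then show ?thesis using True by (simp add: power2_eq_square mult.assoc)
  next
    case False
    have "1 - exp s \<le> - s" using exp_ge_add_one_self[of s] by linarith
    then have "(-s) * (1 - exp s) \<le> (-s) * (-s)"
      using False by (intro mult_left_mono) auto
    also have "\<dots> \<le> (-s) * (-s) * exp \<bar>s\<bar>"
      using mult_left_mono[of 1 "exp \<bar>s\<bar>" "(-s)*(-s)"] by (simp add: zero_le_mult_iff)
    finally show ?thesis by (simp add: power2_eq_square algebra_simps)
  qed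
  show ?thesis using lower A B by linarith
qed

text \<open>Each of the three factors of degree one is absorbed by its own third
  \<open>exp (d * r / 3)\<close> of the exponential, whence the constant
  \<open>3 / d\<close>.\<close>

lemma cubic_le_exp:
  fixes d r :: real
  assumes "d > 0" "r \<ge> 0"
  shows "(1 + r) * r\<^sup>2 \<le> (1 + 3 / d) * (3 / d)\<^sup>2 * exp (d * r)"
proof -
  let ?e = "exp (d * r / 3)"
  have e: "d * r / 3 \<le> ?e" "1 \<le> ?e"
    using exp_ge_add_one_self[of "d * r / 3"] assms by (linarith, simp)
  have r: "r \<le> 3 / d * ?e" using e(1) assms by (simp add: field_simps)
  have "1 + r \<le> (1 + 3 / d) * ?e" unfolding distrib_right using r e(2) by linarith
  moreover have "r\<^sup>2 \<le> (3 / d * ?e)\<^sup>2" using r assms by (intro power_mono) auto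
  ultimately have "(1 + r) * r\<^sup>2 \<le> ((1 + 3 / d) * ?e) * (3 / d * ?e)\<^sup>2"
    using assms by (intro mult_mono) auto
  also have "\<dots> = (1 + 3 / d) * (3 / d)\<^sup>2 * ?e ^ 3"
    by (simp add: power2_eq_square power3_eq_cube)
  also have "?e ^ 3 = exp (d * r)" by (simp flip: exp_of_nat_mult)
  finally show ?thesis .
qed

text \<open>Some coordinate carries at least the fraction \<open>1 / DIM('v)\<close> of the norm.
  This reduces exponential moments of \<open>norm Y\<close> to finiteness of the transform at
  finitely many points.\<close>

lemma exp_norm_le_sum:
  fixes y :: "'v::euclidean_space"
  assumes "d \<ge> 0"
  shows "exp (d * norm y) \<le>
    (\<Sum>i\<in>Basis. exp ((real DIM('v) * d) *\<^sub>R i \<bullet> y) + exp ((- (real DIM('v) * d)) *\<^sub>R i \<bullet> y))"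
proof -
  let ?D = "real DIM('v)"
  obtain i where i: "i \<in> Basis" "norm y \<le> ?D * \<bar>y \<bullet> i\<bar>"
  proof (rule ccontr)
    assume "\<not> thesis"
    then have "\<And>i. i \<in> Basis \<Longrightarrow> \<bar>y \<bullet> i\<bar> < norm y / ?D"
      using that by (fastforce simp: field_simps not_le)
    then have "(\<Sum>i\<in>Basis. \<bar>y \<bullet> i\<bar>) < (\<Sum>i\<in>(Basis::'v set). norm y / ?D)"
      by (intro sum_strict_mono) auto
    then show False using norm_le_l1[of y] by simp
  qed
  have "exp (d * norm y) \<le> exp (\<bar>(?D * d) * (i \<bullet> y)\<bar>)"
    using mult_left_mono[OF i(2) assms] assms by (simp add: abs_mult inner_commute mult_ac)
  also have "\<dots> \<le> exp ((?D * d) *\<^sub>R i \<bullet> y) + exp ((- (?D * d)) *\<^sub>R i \<bullet> y)"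
    by (cases "(?D * d) * (i \<bullet> y) \<ge> 0") auto
  also have "\<dots> \<le> (\<Sum>i\<in>Basis. exp ((?D * d) *\<^sub>R i \<bullet> y) + exp ((- (?D * d)) *\<^sub>R i \<bullet> y))"
    using i(1) by (intro member_le_sum) (auto intro: add_nonneg_nonneg)
  finally show ?thesis .
qed

locale exp_moments = finite_measure M for M :: "'a measure" +
  fixes Y :: "'a \<Rightarrow> 'v::euclidean_space"
  assumes Y_meas[measurable]: "Y \<in> borel_measurable M"
    and nontriv: "emeasure M (space M) \<noteq> 0"
    and zero_int: "0 \<in> interior (domL M Y)"
begin

abbreviation "D \<equiv> domL M Y"
abbreviation "K \<equiv> cgf M Y"
abbreviation "L u \<equiv> \<integral>\<omega>. exp (u \<bullet> Y \<omega>) \<partial>M"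

text \<open>The mean of \<open>Y\<close> under the probability law with density proportional to
  \<open>exp (u \<bullet> Y)\<close>; it is the gradient of \<open>K\<close> at interior
  points.\<close>

definition tmean :: "'v \<Rightarrow> 'v" where
  "tmean u = (1 / L u) *\<^sub>R (\<integral>\<omega>. exp (u \<bullet> Y \<omega>) *\<^sub>R Y \<omega> \<partial>M)"

lemma exp_integrable: "u \<in> D \<longleftrightarrow> integrable M (\<lambda>\<omega>. exp (u \<bullet> Y \<omega>))"
  by (auto simp: domL_def lapl_def integrable_iff_bounded)

lemma lapl_eq: "u \<in> D \<Longrightarrow> lapl M Y u = ennreal (L u)"
  unfolding lapl_def exp_integrable by (intro nn_integral_eq_integral) auto

lemma lapl_pos: "lapl M Y u \<noteq> 0"
proof
  assume "lapl M Y u = 0"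
  then have "AE \<omega> in M. ennreal (exp (u \<bullet> Y \<omega>)) = 0"
    unfolding lapl_def by (subst (asm) nn_integral_0_iff_AE) auto
  then have "AE \<omega> in M. False" by simp
  then show False using nontriv by (simp add: AE_iff_null null_sets_def)
qed

lemma L_pos: "u \<in> D \<Longrightarrow> L u > 0"
  using lapl_eq[of u] lapl_pos[of u] by (cases "L u \<le> 0") (auto simp: ennreal_neg)

lemma K_eq: "u \<in> D \<Longrightarrow> K u = ln (L u)"
  using L_pos[of u] by (simp add: cgf_def lapl_eq)

lemma convex_D: "convex D"
proof (rule convexI)
  fix u v :: 'v and a b :: real
  assume uv: "u \<in> D" "v \<in> D" and ab: "0 \<le> a" "0 \<le> b" "a + b = 1"
  have "integrable M (\<lambda>\<omega>. a * exp (u \<bullet> Y \<omega>) + b * exp (v \<bullet> Y \<omega>))"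
    using uv by (auto simp: exp_integrable)
  then have "integrable M (\<lambda>\<omega>. exp ((a *\<^sub>R u + b *\<^sub>R v) \<bullet> Y \<omega>))"
  proof (rule Bochner_Integration.integrable_bound)
    show "AE \<omega> in M. norm (exp ((a *\<^sub>R u + b *\<^sub>R v) \<bullet> Y \<omega>)) \<le> norm (a * exp (u \<bullet> Y \<omega>) + b * exp (v \<bullet> Y \<omega>))"
    proof (rule AE_I2)
      fix \<omega>
      have "exp (a * (u \<bullet> Y \<omega>) + b * (v \<bullet> Y \<omega>)) \<le> a * exp (u \<bullet> Y \<omega>) + b * exp (v \<bullet> Y \<omega>)"
        using ab convex_onD[OF exp_convex, of b "u \<bullet> Y \<omega>" "v \<bullet> Y \<omega>"]
        by (simp add: eq_diff_eq[symmetric])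
      then show "norm (exp ((a *\<^sub>R u + b *\<^sub>R v) \<bullet> Y \<omega>)) \<le> norm (a * exp (u \<bullet> Y \<omega>) + b * exp (v \<bullet> Y \<omega>))"
        by (simp add: inner_add_left)
    qed
  qed simp
  then show "a *\<^sub>R u + b *\<^sub>R v \<in> D" by (simp add: exp_integrable)
qed

lemma zero_in_D: "0 \<in> D"
  using zero_int interior_subset by blast

lemma exp_norm_integrable:
  assumes "u \<in> interior D"
  obtains d where "d > 0" "integrable M (\<lambda>\<omega>. exp (u \<bullet> Y \<omega> + d * norm (Y \<omega>)))"
proof -
  obtain e where e: "e > 0" "cball u e \<subseteq> D" using assms by (auto simp: mem_interior_cball)
  \<comment> \<open>With this \<open>d\<close> the exponents in \<open>exp_norm_le_sum\<close> are
    exactly \<open>e *\<^sub>R i\<close> and \<open>(-e) *\<^sub>R i\<close>, and the shifted points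
    stay in the closed ball inside \<open>D\<close>.\<close>
  define d where "d = e / real DIM('v)"
  have d: "d > 0" "real DIM('v) * d = e" using e by (auto simp: d_def)
  have "integrable M (\<lambda>\<omega>. \<Sum>i\<in>Basis. exp ((u + e *\<^sub>R i) \<bullet> Y \<omega>) + exp ((u + (-e) *\<^sub>R i) \<bullet> Y \<omega>))"
    using e by (intro Bochner_Integration.integrable_sum Bochner_Integration.integrable_add)
      (auto simp: exp_integrable[symmetric] dist_norm intro!: subsetD[OF e(2)])
  then have "integrable M (\<lambda>\<omega>. exp (u \<bullet> Y \<omega> + d * norm (Y \<omega>)))"
  proof (rule Bochner_Integration.integrable_bound)
    show "AE \<omega> in M. norm (exp (u \<bullet> Y \<omega> + d * norm (Y \<omega>))) \<le>
        norm (\<Sum>i\<in>Basis. exp ((u + e *\<^sub>R i) \<bullet> Y \<omega>) + exp ((u + (-e) *\<^sub>R i) \<bullet> Y \<omega>))"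
    proof (rule AE_I2)
      fix \<omega>
      have "exp (u \<bullet> Y \<omega> + d * norm (Y \<omega>)) \<le> exp (u \<bullet> Y \<omega>) *
          (\<Sum>i\<in>Basis. exp (e *\<^sub>R i \<bullet> Y \<omega>) + exp ((-e) *\<^sub>R i \<bullet> Y \<omega>))"
        using exp_norm_le_sum[of d "Y \<omega>"] d by (simp add: exp_add)
      also have "\<dots> = (\<Sum>i\<in>Basis. exp ((u + e *\<^sub>R i) \<bullet> Y \<omega>) + exp ((u + (-e) *\<^sub>R i) \<bullet> Y \<omega>))"
        by (simp add: sum_distrib_left inner_add_left exp_add distrib_left exp_diff exp_minus inner_diff_left divide_inverse)
      finally show "norm (exp (u \<bullet> Y \<omega> + d * norm (Y \<omega>))) \<le>
        norm (\<Sum>i\<in>Basis. exp ((u + e *\<^sub>R i) \<bullet> Y \<omega>) + exp ((u + (-e) *\<^sub>R i) \<bullet> Y \<omega>))"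
        by simp
    qed
  qed simp
  then show thesis using that d by blast
qed

text \<open>The weight \<open>p\<close> allows one proof to serve twice: \<open>p = 1\<close> gives
  the derivative of the transform, and \<open>p = Y \<bullet> i\<close> the continuity of its
  gradient. The remainder at \<open>u + h\<close> is at most a constant times the square of
  \<open>norm h\<close>, by integrating \<open>exp_second_order_bound\<close>.\<close>

lemma tilted_integral_differentiable:
  fixes p :: "'a \<Rightarrow> real"
  assumes u: "u \<in> interior D" and [measurable]: "p \<in> borel_measurable M"
    and p: "\<And>\<omega>. \<bar>p \<omega>\<bar> \<le> 1 + norm (Y \<omega>)"
  shows "integrable M (\<lambda>\<omega>. p \<omega> * exp (u \<bullet> Y \<omega>))"
    and "integrable M (\<lambda>\<omega>. (p \<omega> * exp (u \<bullet> Y \<omega>)) *\<^sub>R Y \<omega>)"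
    and "((\<lambda>u. \<integral>\<omega>. p \<omega> * exp (u \<bullet> Y \<omega>) \<partial>M) has_derivative
      (\<lambda>h. (\<integral>\<omega>. (p \<omega> * exp (u \<bullet> Y \<omega>)) *\<^sub>R Y \<omega> \<partial>M) \<bullet> h)) (at u)"
proof -
  let ?r = "\<lambda>\<omega>. norm (Y \<omega>)"
  let ?W = "\<lambda>d \<omega>. exp (u \<bullet> Y \<omega> + d * ?r \<omega>)"
  \<comment> \<open>Half of the exponential moment available at \<open>u\<close> is kept as
    \<open>?W\<close>; the other half pays for the polynomial weights, of degree at most
    three.\<close>
  have "\<exists>d>0. integrable M (\<lambda>\<omega>. (1 + ?r \<omega>) * ?W d \<omega>)
      \<and> integrable M (\<lambda>\<omega>. ((1 + ?r \<omega>) * (?r \<omega>)\<^sup>2) * ?W d \<omega>)"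
  proof -
    obtain d where d: "d > 0" "integrable M (\<lambda>\<omega>. ?W d \<omega>)"
      using exp_norm_integrable[OF u] by blast
    define C where "C = (1 + 3 / (d/2)) * (3 / (d/2))\<^sup>2"
    have b1: "(1 + ?r \<omega>) * (?r \<omega>)\<^sup>2 * ?W (d/2) \<omega>
       \<le> C * ?W d \<omega>" for \<omega>
    proof -
      have "(1 + ?r \<omega>) * (?r \<omega>)\<^sup>2 * ?W (d/2) \<omega>
         \<le> (C * exp (d / 2 * ?r \<omega>)) * ?W (d/2) \<omega>"
        using d(1) unfolding C_def by (intro mult_right_mono cubic_le_exp) auto
      also have "\<dots> = C * ?W d \<omega>"
        by (simp add: exp_add[symmetric] mult.assoc)
      finally show ?thesis .
    qed
    have b2: "(1 + ?r \<omega>) * ?W (d/2) \<omega>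
       \<le> (1 + 2 / d) * ?W d \<omega>" for \<omega>
    proof -
      have e: "d/2 * ?r \<omega> \<le> exp (d/2 * ?r \<omega>)" "1 \<le> exp (d/2 * ?r \<omega>)"
        using exp_ge_add_one_self[of "d/2 * ?r \<omega>"] d(1) by (linarith, simp)
      have "?r \<omega> \<le> 2 / d * exp (d/2 * ?r \<omega>)" using e(1) d(1) by (simp add: field_simps)
      then have "1 + ?r \<omega> \<le> (1 + 2 / d) * exp (d / 2 * ?r \<omega>)" unfolding distrib_right using e(2) by linarith
      then have "(1 + ?r \<omega>) * ?W (d/2) \<omega>
         \<le> ((1 + 2 / d) * exp (d / 2 * ?r \<omega>)) * ?W (d/2) \<omega>"
        by (intro mult_right_mono) auto
      also have "\<dots> = (1 + 2 / d) * ?W d \<omega>"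
        by (simp add: exp_add[symmetric] mult.assoc)
      finally show ?thesis .
    qed
    have "integrable M (\<lambda>\<omega>. (1 + ?r \<omega>) * ?W (d/2) \<omega>)"
      by (rule Bochner_Integration.integrable_bound[OF integrable_mult_right[OF d(2), of "1 + 2 / d"]])
        (use b2 d(1) in auto)
    moreover have "integrable M (\<lambda>\<omega>. ((1 + ?r \<omega>) * (?r \<omega>)\<^sup>2) * ?W (d/2) \<omega>)"
      by (rule Bochner_Integration.integrable_bound[OF integrable_mult_right[OF d(2), of C]])
        (use b1 d(1) in \<open>auto simp: C_def\<close>)
    ultimately show ?thesis using d(1) by (intro exI[of _ "d/2"]) auto
  qed
  then obtain d where d: "d > 0"
      "integrable M (\<lambda>\<omega>. (1 + ?r \<omega>) * ?W d \<omega>)"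
      "integrable M (\<lambda>\<omega>. ((1 + ?r \<omega>) * (?r \<omega>)\<^sup>2) * ?W d \<omega>)"
    by blast
  have near: "integrable M (\<lambda>\<omega>. p \<omega> * exp ((u + h) \<bullet> Y \<omega>))" if "norm h \<le> d" for h
  proof (rule Bochner_Integration.integrable_bound[OF d(2)])
    show "AE \<omega> in M. norm (p \<omega> * exp ((u + h) \<bullet> Y \<omega>)) \<le> norm ((1 + ?r \<omega>) * ?W d \<omega>)"
    proof (rule AE_I2)
      fix \<omega>
      have "h \<bullet> Y \<omega> \<le> norm h * ?r \<omega>" by (rule norm_cauchy_schwarz)
      also have "\<dots> \<le> d * ?r \<omega>" using that by (intro mult_right_mono) auto
      finally show "norm (p \<omega> * exp ((u + h) \<bullet> Y \<omega>)) \<le> norm ((1 + ?r \<omega>) * ?W d \<omega>)"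
        using p[of \<omega>] by (simp add: abs_mult inner_add_left) (intro mult_mono, auto)
    qed
  qed simp
  from near[of 0] d(1) show i0: "integrable M (\<lambda>\<omega>. p \<omega> * exp (u \<bullet> Y \<omega>))" by simp
  have "integrable M (\<lambda>\<omega>. (1 + ?r \<omega>) * ?W d \<omega> +
      ((1 + ?r \<omega>) * (?r \<omega>)\<^sup>2) * ?W d \<omega>)"
    using d by auto
  then show i1: "integrable M (\<lambda>\<omega>. (p \<omega> * exp (u \<bullet> Y \<omega>)) *\<^sub>R Y \<omega>)"
  proof (rule Bochner_Integration.integrable_bound)
    show "AE \<omega> in M. norm ((p \<omega> * exp (u \<bullet> Y \<omega>)) *\<^sub>R Y \<omega>) \<le> norm ((1 + ?r \<omega>) * ?W d \<omega> +
      ((1 + ?r \<omega>) * (?r \<omega>)\<^sup>2) * ?W d \<omega>)"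
    proof (rule AE_I2)
      fix \<omega>
      let ?E = "?W d \<omega>"
      have r: "?r \<omega> \<le> 1 + (?r \<omega>)\<^sup>2" using sum_squares_bound[of "?r \<omega>" 1] by (simp add: power2_eq_square) (smt (verit) norm_ge_zero)
      have "exp (u \<bullet> Y \<omega>) \<le> ?E" using d(1) by auto
      then have "\<bar>p \<omega>\<bar> * exp (u \<bullet> Y \<omega>) * ?r \<omega> \<le> ((1 + ?r \<omega>) * ?E) * (1 + (?r \<omega>)\<^sup>2)"
        using p[of \<omega>] r by (intro mult_mono) auto
      then show "norm ((p \<omega> * exp (u \<bullet> Y \<omega>)) *\<^sub>R Y \<omega>) \<le> norm ((1 + ?r \<omega>) * ?E + ((1 + ?r \<omega>) * (?r \<omega>)\<^sup>2) * ?E)"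
        by (simp add: abs_mult algebra_simps)
    qed
  qed simp
  define C where "C = (\<integral>\<omega>. ((1 + ?r \<omega>) * (?r \<omega>)\<^sup>2) * ?W d \<omega> \<partial>M)"
  let ?F = "\<lambda>u. \<integral>\<omega>. p \<omega> * exp (u \<bullet> Y \<omega>) \<partial>M"
  let ?G = "\<integral>\<omega>. (p \<omega> * exp (u \<bullet> Y \<omega>)) *\<^sub>R Y \<omega> \<partial>M"
  have quad: "norm (?F (u + h) - ?F u - ?G \<bullet> h) \<le> C * (norm h)\<^sup>2" if h: "norm h \<le> d" for h
  proof -
    have "?F (u + h) - ?F u - ?G \<bullet> h =
      (\<integral>\<omega>. p \<omega> * exp ((u + h) \<bullet> Y \<omega>) - p \<omega> * exp (u \<bullet> Y \<omega>) - ((p \<omega> * exp (u \<bullet> Y \<omega>)) *\<^sub>R Y \<omega>) \<bullet> h \<partial>M)"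
      using near[OF h] i0 integrable_inner_left[OF i1, of h]
      by (subst integral_inner_left[OF i1, symmetric]) (simp del: inner_scaleR_left)
    also have "\<dots> = (\<integral>\<omega>. p \<omega> * exp (u \<bullet> Y \<omega>) * (exp (h \<bullet> Y \<omega>) - 1 - h \<bullet> Y \<omega>) \<partial>M)"
      by (intro Bochner_Integration.integral_cong) (auto simp: inner_add_left exp_add algebra_simps inner_commute)
    finally have eq: "?F (u + h) - ?F u - ?G \<bullet> h = \<dots>" .
    have pw: "norm (p \<omega> * exp (u \<bullet> Y \<omega>) * (exp (h \<bullet> Y \<omega>) - 1 - h \<bullet> Y \<omega>))
        \<le> (norm h)\<^sup>2 * (((1 + ?r \<omega>) * (?r \<omega>)\<^sup>2) * ?W d \<omega>)" for \<omega>
    proof -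
      have cs: "\<bar>h \<bullet> Y \<omega>\<bar> \<le> norm h * ?r \<omega>" by (rule Cauchy_Schwarz_ineq2)
      have cs': "\<bar>h \<bullet> Y \<omega>\<bar> \<le> d * ?r \<omega>"
        using cs mult_right_mono[OF h, of "?r \<omega>"] by simp
      have "\<bar>exp (h \<bullet> Y \<omega>) - 1 - h \<bullet> Y \<omega>\<bar> \<le> (h \<bullet> Y \<omega>)\<^sup>2 * exp \<bar>h \<bullet> Y \<omega>\<bar>"
        by (rule exp_second_order_bound)
      also have "(h \<bullet> Y \<omega>)\<^sup>2 * exp \<bar>h \<bullet> Y \<omega>\<bar> \<le> (norm h * ?r \<omega>)\<^sup>2 * exp (d * ?r \<omega>)"
        using cs cs' by (intro mult_mono) (auto simp: abs_le_square_iff[symmetric])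
      finally have "\<bar>p \<omega>\<bar> * exp (u \<bullet> Y \<omega>) * \<bar>exp (h \<bullet> Y \<omega>) - 1 - h \<bullet> Y \<omega>\<bar>
          \<le> ((1 + ?r \<omega>) * exp (u \<bullet> Y \<omega>)) * ((norm h * ?r \<omega>)\<^sup>2 * exp (d * ?r \<omega>))"
        using p[of \<omega>] by (intro mult_mono) auto
      then show ?thesis by (simp add: abs_mult exp_add power_mult_distrib mult_ac)
    qed
    let ?b = "\<lambda>\<omega>. ((1 + ?r \<omega>) * (?r \<omega>)\<^sup>2) * ?W d \<omega>"
    let ?f = "\<lambda>\<omega>. p \<omega> * exp (u \<bullet> Y \<omega>) * (exp (h \<bullet> Y \<omega>) - 1 - h \<bullet> Y \<omega>)"
    have "integrable M ?f"
      by (rule Bochner_Integration.integrable_bound[OF integrable_mult_right[OF d(3)]])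
        (auto simp del: real_norm_def intro!: AE_I2 order_trans[OF pw order_trans[OF abs_ge_self eq_refl[OF real_norm_def[symmetric]]]])
    then have "norm (\<integral>\<omega>. ?f \<omega> \<partial>M) \<le> (\<integral>\<omega>. (norm h)\<^sup>2 * ?b \<omega> \<partial>M)"
      by (intro order_trans[OF integral_norm_bound] Bochner_Integration.integral_mono
          integrable_norm integrable_mult_right d(3) pw)
    then show ?thesis unfolding eq C_def by (simp add: mult.commute)
  qed
  show "(?F has_derivative (\<lambda>h. ?G \<bullet> h)) (at u)"
    unfolding has_derivative_at
  proof
    show "bounded_linear (\<lambda>h. ?G \<bullet> h)" by (rule bounded_linear_inner_right)
    show "(\<lambda>h. norm (?F (u + h) - ?F u - ?G \<bullet> h) / norm h) \<midarrow>0\<rightarrow> 0"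
    proof (rule Lim_null_comparison)
      show "\<forall>\<^sub>F h in at 0. norm (norm (?F (u + h) - ?F u - ?G \<bullet> h) / norm h) \<le> C * norm h"
        unfolding eventually_at
      proof (intro exI[of _ d] conjI ballI impI)
        fix h :: 'v assume h: "h \<noteq> 0 \<and> dist h 0 < d"
        then show "norm (norm (?F (u + h) - ?F u - ?G \<bullet> h) / norm h) \<le> C * norm h"
          using quad[of h] by (simp add: field_simps power2_eq_square)
      qed (use d in auto)
      show "(\<lambda>h. C * norm h) \<midarrow>0\<rightarrow> 0" by (auto intro!: tendsto_eq_intros)
    qed
  qed
qed

lemma interior_D: "u \<in> interior D \<Longrightarrow> u \<in> D"
  using interior_subset by blast

lemma exp_Y_integrable:
  "u \<in> interior D \<Longrightarrow> integrable M (\<lambda>\<omega>. exp (u \<bullet> Y \<omega>) *\<^sub>R Y \<omega>)"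
  using tilted_integral_differentiable(2)[of u "\<lambda>_. 1"] by simp

lemma L_has_derivative:
  "u \<in> interior D \<Longrightarrow> ((\<lambda>u. L u) has_derivative (\<lambda>h. (\<integral>\<omega>. exp (u \<bullet> Y \<omega>) *\<^sub>R Y \<omega> \<partial>M) \<bullet> h)) (at u)"
  using tilted_integral_differentiable(3)[of u "\<lambda>_. 1"] by simp

lemma K_has_derivative:
  assumes u: "u \<in> interior D"
  shows "(K has_derivative (\<lambda>h. tmean u \<bullet> h)) (at u)"
proof -
  have "((\<lambda>u. ln (L u)) has_derivative (\<lambda>h. tmean u \<bullet> h)) (at u)"
    by (rule has_derivative_eq_rhs[OF has_derivative_ln[OF L_pos[OF interior_D[OF u]] L_has_derivative[OF u]]])
      (simp add: tmean_def fun_eq_iff divide_inverse)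
  then show ?thesis
    by (rule has_derivative_transform_within_open[OF _ open_interior u]) (simp add: K_eq interior_D)
qed

lemma K_continuous: "continuous_on (interior D) K"
  using K_has_derivative has_derivative_continuous
  by (blast intro: continuous_at_imp_continuous_on)

text \<open>Each coordinate of the numerator is a weighted integral with weight
  \<open>Y \<bullet> i\<close>, hence differentiable and therefore continuous.\<close>

lemma tmean_continuous: "continuous_on (interior D) tmean"
proof -
  have cont: "continuous_on (interior D) (\<lambda>u. \<integral>\<omega>. (Y \<omega> \<bullet> i) * exp (u \<bullet> Y \<omega>) \<partial>M)" if "i \<in> Basis" for i
  proof -
    have bd: "\<bar>Y \<omega> \<bullet> i\<bar> \<le> 1 + norm (Y \<omega>)" for \<omega>
      using Basis_le_norm[OF that, of "Y \<omega>"] by linarith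
    show ?thesis
      by (intro continuous_at_imp_continuous_on ballI
          has_derivative_continuous[OF tilted_integral_differentiable(3)] bd) auto
  qed
  have L: "continuous_on (interior D) (\<lambda>u. L u)"
    using L_has_derivative has_derivative_continuous by (blast intro: continuous_at_imp_continuous_on)
  have eq: "(\<integral>\<omega>. exp (u \<bullet> Y \<omega>) *\<^sub>R Y \<omega> \<partial>M) =
      (\<Sum>i\<in>Basis. (\<integral>\<omega>. (Y \<omega> \<bullet> i) * exp (u \<bullet> Y \<omega>) \<partial>M) *\<^sub>R i)" if "u \<in> interior D" for u
    by (subst euclidean_representation[symmetric], intro sum.cong refl)
      (simp add: integral_inner_left[symmetric] exp_Y_integrable[OF that] mult.commute)
  have "continuous_on (interior D) (\<lambda>u. \<integral>\<omega>. exp (u \<bullet> Y \<omega>) *\<^sub>R Y \<omega> \<partial>M)"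
    by (subst continuous_on_cong[OF refl eq]) (auto intro!: continuous_intros cont)
  then have "continuous_on (interior D) (\<lambda>u. (1 / L u) *\<^sub>R (\<integral>\<omega>. exp (u \<bullet> Y \<omega>) *\<^sub>R Y \<omega> \<partial>M))"
    using L L_pos interior_D by (intro continuous_intros) (auto simp: less_le)
  then show ?thesis unfolding tmean_def .
qed

section \<open>Tangent inequality, strictness and scaling of the cumulant generating
  function\<close>

text \<open>This is \<open>exp s \<ge> 1 + s\<close> integrated against the law of \<open>Y\<close> tilted by \<open>u\<close>,
  with \<open>s = (v - u) \<bullet> (Y - tmean u)\<close>.\<close>
lemma K_tangent_aux:
  assumes u: "u \<in> interior D" and v: "v \<in> D"
  shows "K u + tmean u \<bullet> (v - u) \<le> K v"
    and "K u + tmean u \<bullet> (v - u) = K v \<Longrightarrow> AE \<omega> in M. (v - u) \<bullet> Y \<omega> = (v - u) \<bullet> tmean u"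
proof -
  let ?m = "tmean u" and ?h = "v - u"
  let ?s = "\<lambda>\<omega>. ?h \<bullet> (Y \<omega> - ?m)"
  let ?g = "\<lambda>\<omega>. exp (u \<bullet> Y \<omega>) * (exp (?s \<omega>) - 1 - ?s \<omega>)"
  note uD = interior_D[OF u]
  have g_eq: "?g = (\<lambda>\<omega>. exp (- (?h \<bullet> ?m)) * exp (v \<bullet> Y \<omega>) - exp (u \<bullet> Y \<omega>)
      - (?h \<bullet> (exp (u \<bullet> Y \<omega>) *\<^sub>R Y \<omega>) - (?h \<bullet> ?m) * exp (u \<bullet> Y \<omega>)))"
  proof
    fix \<omega>
    have "exp (u \<bullet> Y \<omega>) * exp (?s \<omega>) = exp (- (?h \<bullet> ?m)) * exp (v \<bullet> Y \<omega>)"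
      by (simp add: exp_add[symmetric] inner_diff_left inner_diff_right)
    then show "?g \<omega> = exp (- (?h \<bullet> ?m)) * exp (v \<bullet> Y \<omega>) - exp (u \<bullet> Y \<omega>)
      - (?h \<bullet> (exp (u \<bullet> Y \<omega>) *\<^sub>R Y \<omega>) - (?h \<bullet> ?m) * exp (u \<bullet> Y \<omega>))"
      by (simp add: right_diff_distrib inner_diff_right)
  qed
  have int: "integrable M ?g"
    unfolding g_eq using uD v exp_Y_integrable[OF u]
    by (intro Bochner_Integration.integrable_diff integrable_mult_right integrable_inner_right)
      (auto simp: exp_integrable)
  have "(\<integral>\<omega>. exp (u \<bullet> Y \<omega>) *\<^sub>R Y \<omega> \<partial>M) = L u *\<^sub>R ?m"
    using L_pos[OF uD] by (simp add: tmean_def)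
  then have val: "(\<integral>\<omega>. ?g \<omega> \<partial>M) = exp (- (?h \<bullet> ?m)) * L v - L u"
    unfolding g_eq using uD v exp_Y_integrable[OF u] by (simp add: exp_integrable del: inner_scaleR_right) (simp add: mult.commute)
  have nn: "0 \<le> ?g \<omega>" for \<omega>
    using exp_ge_add_one_self[of "?s \<omega>"] by (intro mult_nonneg_nonneg) (auto simp del: exp_ge_add_one_self)
  have Kv: "exp (K v) = L v" and Ku: "exp (K u) = L u"
    using L_pos uD v by (auto simp: K_eq)
  have "0 \<le> exp (- (?h \<bullet> ?m)) * L v - L u"
    unfolding val[symmetric] by (rule Bochner_Integration.integral_nonneg) (rule nn)
  then have "exp (K u + ?m \<bullet> ?h) \<le> exp (K v)"
    unfolding exp_add Kv Ku by (simp add: exp_minus field_simps inner_commute)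
  then show "K u + ?m \<bullet> ?h \<le> K v" by simp
  assume "K u + ?m \<bullet> ?h = K v"
  then have "exp (K u) * exp (?m \<bullet> ?h) = exp (K v)" by (simp add: exp_add[symmetric])
  then have "(\<integral>\<omega>. ?g \<omega> \<partial>M) = 0"
    unfolding val Kv Ku by (simp add: exp_minus field_simps inner_commute)
  then have "AE \<omega> in M. ?g \<omega> = 0"
    using integral_nonneg_eq_0_iff_AE[OF int] nn by auto
  then show "AE \<omega> in M. ?h \<bullet> Y \<omega> = ?h \<bullet> ?m"
  proof eventually_elim
    case (elim \<omega>)
    then have "exp (?s \<omega>) = 1 + ?s \<omega>" by simp
    \<comment> \<open>Equality in \<open>ln x \<le> x - 1\<close> occurs only at
      \<open>x = 1\<close>.\<close>
    then have "ln (exp (?s \<omega>)) = exp (?s \<omega>) - 1" unfolding ln_exp by linarith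
    then have "exp (?s \<omega>) = 1" by (intro ln_eq_minus_one) auto
    then have "?s \<omega> = 0" by simp
    then show ?case by (simp add: inner_diff_right)
  qed
qed

lemmas K_tangent = K_tangent_aux(1)

lemma K_tangent_strict:
  assumes nd: "\<And>h c. h \<noteq> 0 \<Longrightarrow> \<not> (AE \<omega> in M. h \<bullet> Y \<omega> = c)"
    and "u \<in> interior D" "v \<in> D" "u \<noteq> v"
  shows "K u + tmean u \<bullet> (v - u) < K v"
  using K_tangent_aux[of u v] nd[of "v - u" "(v - u) \<bullet> tmean u"] assms by fastforce

text \<open>A closure point of a convex set, shrunk towards an interior point, becomes interior.
  Allowing \<open>closure D\<close> is essential: membership known for almost every \<open>t\<close>
  extends to every \<open>t\<close> only after taking the closure.\<close>

lemma scale_interior_D: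
  assumes "u \<in> closure D" "0 \<le> r" "r < 1"
  shows "r *\<^sub>R u \<in> interior D"
proof (cases "r = 0")
  case False
  then show ?thesis
    using mem_interior_closure_convex_shrink[OF convex_D zero_int assms(1), of "1 - r"] assms
    by (simp add: scaleR_left_diff_distrib)
qed (use zero_int in simp)

text \<open>Averaging the tangent inequalities at \<open>r *\<^sub>R u\<close> towards
  \<open>u\<close> and towards 0 cancels the linear terms. Only \<open>u \<in> D\<close> is
  required, so boundary points are covered.\<close>

lemma K_scale:
  assumes "u \<in> D" "0 \<le> r" "r < 1"
  shows "K (r *\<^sub>R u) \<le> r * K u + (1 - r) * K 0"
proof -
  let ?w = "r *\<^sub>R u"
  have w: "?w \<in> interior D" using assms closure_subset by (intro scale_interior_D) auto
  have "r * (K ?w + tmean ?w \<bullet> (u - ?w)) + (1 - r) * (K ?w + tmean ?w \<bullet> (0 - ?w)) \<le> r * K u + (1 - r) * K 0"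
    using assms zero_in_D w by (intro add_mono mult_left_mono K_tangent) auto
  moreover have "r * (K ?w + tmean ?w \<bullet> (u - ?w)) + (1 - r) * (K ?w + tmean ?w \<bullet> (0 - ?w)) = K ?w"
    by (simp add: inner_diff_right algebra_simps)
  ultimately show ?thesis by linarith
qed

end

section \<open>Integration over the unit interval\<close>

abbreviation lborel01 :: "real measure" where
  "lborel01 \<equiv> restrict_space lborel {0..1}"

lemma sets_lborel01: "sets lborel01 = sets (restrict_space borel {0..1})"
  by (rule sets_restrict_space_cong) simp

lemma space_lborel01 [simp]: "space lborel01 = {0..1}"
  by (simp add: space_restrict_space)

lemma nn_integral_lborel01:
  "(\<integral>\<^sup>+ t\<in>{0..1}. h t \<partial>lborel) = (\<integral>\<^sup>+ t. h t \<partial>lborel01)"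
  by (subst nn_integral_restrict_space) auto

lemma emeasure_lborel01: "emeasure lborel01 {0..1} = 1"
  by (subst emeasure_restrict_space) auto

interpretation lborel01: finite_measure lborel01
  by standard (simp add: emeasure_lborel01)

lemma measure_lborel01: "measure lborel01 {0..1} = 1"
  by (simp add: measure_def emeasure_lborel01)

lemma borel_measurable_unit:
  "continuous_on {0..1} g \<Longrightarrow> g \<in> borel_measurable lborel01"
  using borel_measurable_continuous_on_restrict[of "{0..1}" g]
  by (simp add: measurable_cong_sets[OF sets_lborel01 refl])

lemma integrable_unit:
  fixes g :: "real \<Rightarrow> 'b::euclidean_space"
  assumes "continuous_on {0..1} g"
  shows "integrable lborel01 g"
  using borel_integrable_atLeastAtMost'[OF assms]
  by (subst integrable_restrict_space) (auto simp: set_integrable_def)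

lemma integral_unit:
  fixes g :: "real \<Rightarrow> 'b::euclidean_space"
  assumes "continuous_on {0..1} g"
  shows "integral\<^sup>L lborel01 g = integral {0..1} g"
  using set_borel_integral_eq_integral(2)[OF borel_integrable_atLeastAtMost'[OF assms]]
  by (subst integral_restrict_space) (auto simp: set_lebesgue_integral_def)

text \<open>By continuity, a violation at one point persists on a nondegenerate interval, which has
  positive measure.\<close>

lemma AE_unit_closed:
  assumes ae: "AE t in lborel01. g t \<in> C" and g: "continuous_on {0..1} g" and C: "closed C"
    and t: "t \<in> {0..1}"
  shows "g t \<in> C"
proof (rule ccontr)
  assume nt: "g t \<notin> C"
  have "openin (top_of_set {0..1}) ({0..1} \<inter> g -` (- C))"
    using C by (intro continuous_openin_preimage_gen[OF g]) auto
  then obtain e where e: "e > 0" "ball t e \<inter> {0..1} \<subseteq> {0..1} \<inter> g -` (- C)"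
    unfolding openin_contains_ball using t nt by (metis (no_types, lifting) ComplI IntI vimageI)
  \<comment> \<open>Clipping to the unit interval keeps the interval nondegenerate even when
    \<open>t\<close> is an endpoint.\<close>
  define a b where "a = max 0 (t - e/2)" and "b = min 1 (t + e/2)"
  have ab: "a < b" "{a..b} \<subseteq> {0..1}" using t e by (auto simp: a_def b_def)
  have out: "g s \<notin> C" if "s \<in> {a..b}" for s
  proof -
    have "s \<in> ball t e" using that e(1) by (auto simp: a_def b_def dist_real_def)
    moreover have "s \<in> {0..1}" using that ab(2) by blast
    ultimately show ?thesis using e(2) by blast
  qed
  have "AE s in lborel. s \<in> {0..1} \<longrightarrow> g s \<in> C"
    using ae by (simp add: AE_restrict_space_iff)
  then have "AE s in lborel. s \<notin> {a..b}"
    by eventually_elim (use out ab in blast)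
  then have "emeasure lborel {a..b} = 0"
    using AE_iff_null_sets[of "{a..b}" lborel] by auto
  then show False using ab by simp
qed

text \<open>The mean value theorem for the primitive replaces the integral over a cell by a value of
  \<open>g\<close> inside it; uniform continuity compares this value with the one at the right
  endpoint.\<close>

lemma riemann_sum_tendsto:
  fixes g :: "real \<Rightarrow> real"
  assumes g: "continuous_on {0..1} g"
  shows "(\<lambda>n. (\<Sum>k\<in>{1..n}. g (real k / real n)) / real n) \<longlonglongrightarrow> integral {0..1} g"
proof (rule LIMSEQ_I)
  fix r :: real assume r: "r > 0"
  have "uniformly_continuous_on {0..1} g" using g by (intro compact_uniformly_continuous) auto
  then obtain d where d: "d > 0" "\<And>x y. x \<in> {0..1} \<Longrightarrow> y \<in> {0..1} \<Longrightarrow> dist x y < d \<Longrightarrow> dist (g x) (g y) < r / 2"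
    using r unfolding uniformly_continuous_on_def by (metis half_gt_zero)
  obtain N where N: "N \<ge> 1" "1 / real N < d"
    using real_arch_invD[OF d(1)] by (metis One_nat_def Suc_leI neq0_conv inverse_eq_divide)
  show "\<exists>no. \<forall>n\<ge>no. norm ((\<Sum>k\<in>{1..n}. g (real k / real n)) / real n - integral {0..1} g) < r"
  proof (intro exI[of _ N] allI impI)
    fix n assume n: "n \<ge> N"
    then have n0: "real n > 0" using N by auto
    have nd: "1 / real n < d"
      using n N n0 by (intro le_less_trans[OF _ N(2)]) (auto simp: field_simps)
    define F where "F t = integral {0..t} g" for t
    have step: "\<bar>(F (real (Suc i) / n) - F (real i / n)) - g (real (Suc i) / n) / n\<bar> \<le> r / 2 / n" if i: "i < n" for i
    proof -
      let ?a = "real i / n" and ?b = "real (Suc i) / n"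
      have ab: "?a < ?b" "{?a..?b} \<subseteq> {0..1}" using i n0 by (auto simp: field_simps)
      have "\<exists>x\<in>{?a<..<?b}. F ?b - F ?a = (?b - ?a) * g x"
      proof -
        have "\<exists>x\<in>{?a<..<?b}. F ?b - F ?a = (\<lambda>x h. g x * h) x (?b - ?a)"
        proof (rule mvt_simple[OF ab(1)])
          fix x assume "?a \<le> x" "x \<le> ?b"
          then have x: "x \<in> {0..1}" using ab by (meson atLeastAtMost_iff subsetD)
          have "(F has_real_derivative g x) (at x within {0..1})"
            unfolding F_def by (rule integral_has_real_derivative[OF g x])
          then have "(F has_real_derivative g x) (at x within {?a..?b})"
            using ab(2) by (rule has_field_derivative_subset)
          then show "(F has_derivative (\<lambda>h. g x * h)) (at x within {?a..?b})"
            by (simp only: has_field_derivative_def)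
        qed
        then show ?thesis by (simp add: mult.commute)
      qed
      then obtain x where x: "x \<in> {?a<..<?b}" "F ?b - F ?a = (?b - ?a) * g x" by blast
      have ba: "?b - ?a = 1 / n" using n0 by (simp add: field_simps)
      have "dist x ?b < d" using x(1) ba nd by (auto simp: dist_real_def)
      moreover have "x \<in> {0..1}" "?b \<in> {0..1}"
        using x(1) ab(1) subsetD[OF ab(2), of x] subsetD[OF ab(2), of ?b]
        by (simp_all only: greaterThanLessThan_iff atLeastAtMost_iff) linarith+
      ultimately have "dist (g x) (g ?b) < r / 2" by (intro d(2))
      then have "\<bar>g x - g ?b\<bar> / n \<le> r / 2 / n"
        using n0 by (intro divide_right_mono) (auto simp: dist_real_def)
      moreover have "(F ?b - F ?a) - g ?b / n = (g x - g ?b) / n"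
        unfolding x(2) ba by (simp add: diff_divide_distrib)
      ultimately show ?thesis using n0 by simp
    qed
    have "integral {0..1} g = F (real n / n) - F (real 0 / n)"
      using n0 by (simp add: F_def)
    also have "\<dots> = (\<Sum>i<n. F (real (Suc i) / n) - F (real i / n))"
      by (rule sum_lessThan_telescope[symmetric])
    finally have "(\<Sum>k\<in>{1..n}. g (real k / real n)) / real n - integral {0..1} g =
       - (\<Sum>i<n. (F (real (Suc i) / n) - F (real i / n)) - g (real (Suc i) / n) / n)"
      by (simp add: sum.atLeast1_atMost_eq sum_subtractf sum_divide_distrib)
    then have "norm ((\<Sum>k\<in>{1..n}. g (real k / real n)) / real n - integral {0..1} g) \<le> (\<Sum>i<n. r / 2 / n)"
      by (simp only: norm_minus_cancel) (rule sum_norm_le, use step in auto)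
    also have "\<dots> < r" using n0 r by simp
    finally show "norm ((\<Sum>k\<in>{1..n}. g (real k / real n)) / real n - integral {0..1} g) < r" .
  qed
qed

text \<open>\<open>A\<close> and \<open>C\<close> may be infinite, but only together; finiteness of
  the other three terms permits solving the additive identity for \<open>A - B\<close> in the
  extended reals.\<close>

lemma ennreal_cancel_parts:
  fixes A B C a b :: ennreal
  assumes eq: "A + b = C + a + B" and fin: "a < \<infinity>" "b < \<infinity>" "B < \<infinity>"
  shows "enn2ereal A - enn2ereal B = enn2ereal C + ereal (enn2real a - enn2real b)"
proof -
  obtain a' b' B' where r: "a' \<ge> 0" "a = ennreal a'" "b' \<ge> 0" "b = ennreal b'" "B' \<ge> 0" "B = ennreal B'"
    using fin by (metis ennreal_cases less_irrefl infinity_ennreal_def)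
  show ?thesis
  proof (cases A)
    case (real A')
    then have "C \<noteq> top" using eq r by (auto simp: ennreal_plus[symmetric] simp del: ennreal_plus)
    then obtain C' where C': "C' \<ge> 0" "C = ennreal C'" by (cases C) auto
    then have "A' + b' = C' + a' + B'"
      using eq r real by (auto simp: ennreal_plus[symmetric] simp del: ennreal_plus)
    then show ?thesis using r real C' by (simp add: enn2ereal_ennreal)
  next
    case top
    then have "C = top" using eq r by (cases C) (auto simp: ennreal_plus[symmetric] simp del: ennreal_plus)
    then show ?thesis using r top by (simp add: enn2ereal_ennreal)
  qed
qed

text \<open>Pointwise, the positive part of \<open>k\<close> plus the negative part of
  \<open>g\<close> equals \<open>k - g\<close> plus the positive part of \<open>g\<close> plus the
  negative part of \<open>k\<close>. An integrable minorant thus turns the difference of parts into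
  one nonnegative integral plus a real number, a form accessible to monotone convergence.\<close>

lemma ereal_parts_split:
  fixes k :: "'b \<Rightarrow> ereal" and g :: "'b \<Rightarrow> real"
  assumes [measurable]: "k \<in> borel_measurable N" and g: "integrable N g"
    and le: "\<And>t. t \<in> space N \<Longrightarrow> ereal (g t) \<le> k t"
  shows "enn2ereal (\<integral>\<^sup>+ t. e2ennreal (k t) \<partial>N) - enn2ereal (\<integral>\<^sup>+ t. e2ennreal (- k t) \<partial>N)
    = enn2ereal (\<integral>\<^sup>+ t. e2ennreal (k t - ereal (g t)) \<partial>N) + ereal (\<integral>t. g t \<partial>N)"
proof -
  note [measurable] = borel_measurable_integrable[OF g]
  have pw: "e2ennreal (k t) + ennreal (- g t) = e2ennreal (k t - ereal (g t)) + ennreal (g t) + e2ennreal (- k t)"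
    if "t \<in> space N" for t
  proof (cases "k t")
    case (real r)
    have "g t \<le> r" using le[OF that] real by simp
    then show ?thesis using real
      by (cases "r \<ge> 0"; cases "g t \<ge> 0")
        (auto simp: e2ennreal_ereal ennreal_neg ennreal_plus[symmetric] simp del: ennreal_plus)
  next
    case PInf then show ?thesis by (simp add: e2ennreal_infty)
  next
    case MInf then show ?thesis using le[OF that] by simp
  qed
  have a: "(\<integral>\<^sup>+ t. ennreal (g t) \<partial>N) < \<infinity>" and b: "(\<integral>\<^sup>+ t. ennreal (- g t) \<partial>N) < \<infinity>"
    using integrableD[OF g] by (auto simp: less_top)
  have "(\<integral>\<^sup>+ t. e2ennreal (- k t) \<partial>N) \<le> (\<integral>\<^sup>+ t. ennreal (- g t) \<partial>N)"
  proof (rule nn_integral_mono)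
    fix t assume "t \<in> space N"
    then have "- k t \<le> ereal (- g t)" using le[of t] ereal_minus_le_minus[of "k t" "ereal (g t)"] by simp
    then show "e2ennreal (- k t) \<le> ennreal (- g t)"
      using e2ennreal_mono[of "- k t" "ereal (- g t)"] by (simp add: e2ennreal_ereal)
  qed
  then have B: "(\<integral>\<^sup>+ t. e2ennreal (- k t) \<partial>N) < \<infinity>" using b by (rule le_less_trans)
  have "(\<integral>\<^sup>+ t. e2ennreal (k t) \<partial>N) + (\<integral>\<^sup>+ t. ennreal (- g t) \<partial>N) =
     (\<integral>\<^sup>+ t. e2ennreal (k t) + ennreal (- g t) \<partial>N)"
    by (rule nn_integral_add[symmetric]) auto
  also have "\<dots> = (\<integral>\<^sup>+ t. e2ennreal (k t - ereal (g t)) + ennreal (g t) + e2ennreal (- k t) \<partial>N)"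
    by (rule nn_integral_cong) (rule pw)
  also have "\<dots> = (\<integral>\<^sup>+ t. e2ennreal (k t - ereal (g t)) \<partial>N) + (\<integral>\<^sup>+ t. ennreal (g t) \<partial>N) + (\<integral>\<^sup>+ t. e2ennreal (- k t) \<partial>N)"
    by (simp add: nn_integral_add)
  finally have eq: "(\<integral>\<^sup>+ t. e2ennreal (k t) \<partial>N) + (\<integral>\<^sup>+ t. ennreal (- g t) \<partial>N) = \<dots>" .
  have gi: "(\<integral>t. g t \<partial>N) = enn2real (\<integral>\<^sup>+ t. ennreal (g t) \<partial>N) - enn2real (\<integral>\<^sup>+ t. ennreal (- g t) \<partial>N)"
    by (rule real_lebesgue_integral_def[OF g])
  show ?thesis unfolding gi by (rule ennreal_cancel_parts[OF eq a b B])
qed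

section \<open>The integrated cumulant generating function\<close>

lemma segment_scale_mem:
  fixes C :: "'b::real_vector set"
  assumes C: "convex C" and p: "a *\<^sub>R l \<in> C" and m: "(- b) *\<^sub>R l \<in> C" and z: "0 \<in> C"
    and c: "- b \<le> c" "c \<le> a" and ab: "0 \<le> a" "0 \<le> b"
  shows "c *\<^sub>R l \<in> C"
proof (cases "a + b = 0")
  case True
  then have "c = 0" using c ab by linarith
  then show ?thesis using z by simp
next
  case False
  \<comment> \<open>The barycentric coordinate of \<open>c\<close> between \<open>-b\<close> and
    \<open>a\<close>.\<close>
  define \<theta> where "\<theta> = (c + b) / (a + b)"
  have th: "0 \<le> \<theta>" "\<theta> \<le> 1" using c ab False by (auto simp: \<theta>_def field_simps)
  have "\<theta> *\<^sub>R (a *\<^sub>R l) + (1 - \<theta>) *\<^sub>R ((- b) *\<^sub>R l) \<in> C"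
    using C p m th by (intro convexD) auto
  moreover have "\<theta> * (a + b) = c + b" using False by (simp add: \<theta>_def)
  then have "\<theta> * a + (1 - \<theta>) * (- b) = c" by (simp add: algebra_simps)
  ultimately show ?thesis by (simp flip: scaleR_left.add add: scaleR_left_distrib[symmetric] del: scaleR_minus_left)
qed

locale weighted_moments = exp_moments M Y for M :: "'a measure" and Y :: "'a \<Rightarrow> 'v::euclidean_space" +
  fixes f :: "real \<Rightarrow> real"
  assumes f_cont: "continuous_on {0..1} f"
begin

text \<open>This is the interior of \<open>Df\<close> (\<open>interior_Df\<close>), phrased so that
  every argument of \<open>K\<close> along the path is at once known to be interior.\<close>

definition good :: "'v set" where
  "good = {l. \<forall>t\<in>{0..1}. f t *\<^sub>R l \<in> interior D}"

text \<open>A Bochner integral, used as the real value of \<open>Ef\<close> on \<open>good\<close>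
  (\<open>Ef_good\<close>).\<close>

definition E :: "'v \<Rightarrow> real" where
  "E l = (\<integral>t. K (f t *\<^sub>R l) \<partial>lborel01)"

definition gE :: "'v \<Rightarrow> 'v" where
  "gE l = (\<integral>t. f t *\<^sub>R tmean (f t *\<^sub>R l) \<partial>lborel01)"

lemma lapl_measurable [measurable]: "lapl M Y \<in> borel_measurable borel"
  unfolding lapl_def by measurable

lemma D_measurable [measurable]: "D \<in> sets borel"
  unfolding domL_def by measurable

lemma cgf_ext_measurable [measurable]: "cgf_ext M Y \<in> borel_measurable borel"
  unfolding cgf_ext_def cgf_def by measurable

lemma f_measurable [measurable]: "f \<in> borel_measurable lborel01"
  by (rule borel_measurable_unit[OF f_cont])

lemma cgf_ext_comp_measurable [measurable]:
  "(\<lambda>t. cgf_ext M Y (f t *\<^sub>R l)) \<in> borel_measurable lborel01"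
  by measurable

lemma Ef_unit: "Ef M Y f l = enn2ereal (\<integral>\<^sup>+ t. e2ennreal (cgf_ext M Y (f t *\<^sub>R l)) \<partial>lborel01)
   - enn2ereal (\<integral>\<^sup>+ t. e2ennreal (- cgf_ext M Y (f t *\<^sub>R l)) \<partial>lborel01)"
  by (simp add: Ef_def nn_integral_lborel01)

lemma Ef_split:
  assumes "integrable lborel01 g" "\<And>t. t \<in> {0..1} \<Longrightarrow> ereal (g t) \<le> cgf_ext M Y (f t *\<^sub>R l)"
  shows "Ef M Y f l = enn2ereal (\<integral>\<^sup>+ t. e2ennreal (cgf_ext M Y (f t *\<^sub>R l) - ereal (g t)) \<partial>lborel01)
    + ereal (\<integral>t. g t \<partial>lborel01)"
  unfolding Ef_unit by (rule ereal_parts_split) (use assms in auto)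

lemma Ef_ge:
  assumes "integrable lborel01 g" "\<And>t. t \<in> {0..1} \<Longrightarrow> ereal (g t) \<le> cgf_ext M Y (f t *\<^sub>R l)"
  shows "ereal (\<integral>t. g t \<partial>lborel01) \<le> Ef M Y f l"
  by (subst Ef_split[of g l]) (use assms in \<open>auto intro: ereal_le_add_self2\<close>)

lemma goodD: "l \<in> good \<Longrightarrow> t \<in> {0..1} \<Longrightarrow> f t *\<^sub>R l \<in> interior D"
  by (simp add: good_def)

lemma K_comp_continuous:
  assumes "l \<in> good"
  shows "continuous_on {0..1} (\<lambda>t. K (f t *\<^sub>R l))"
  by (rule continuous_on_compose2[OF K_continuous]) (use assms in \<open>auto intro!: continuous_intros f_cont goodD\<close>)

lemma tmean_comp_continuous:
  assumes "l \<in> good"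
  shows "continuous_on {0..1} (\<lambda>t. tmean (f t *\<^sub>R l))"
  by (rule continuous_on_compose2[OF tmean_continuous]) (use assms in \<open>auto intro!: continuous_intros f_cont goodD\<close>)

lemma Ef_good:
  assumes l: "l \<in> good"
  shows "Ef M Y f l = ereal (E l)"
proof -
  have K: "cgf_ext M Y (f t *\<^sub>R l) = ereal (K (f t *\<^sub>R l))" if "t \<in> {0..1}" for t
    using that l by (simp add: cgf_ext_def goodD interior_D)
  have "(\<integral>\<^sup>+ t. e2ennreal (cgf_ext M Y (f t *\<^sub>R l) - ereal (K (f t *\<^sub>R l))) \<partial>lborel01) = (\<integral>\<^sup>+ t. 0 \<partial>lborel01)"
    by (intro nn_integral_cong) (simp add: K e2ennreal_ereal flip: zero_ereal_def)
  then show ?thesis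
    using Ef_split[of "\<lambda>t. K (f t *\<^sub>R l)" l, OF integrable_unit[OF K_comp_continuous[OF l]]]
    by (simp add: K E_def zero_ennreal.rep_eq)
qed

lemma Efr_good: "l \<in> good \<Longrightarrow> Efr M Y f l = E l"
  by (simp add: Efr_def Ef_good)

lemma zero_good: "0 \<in> good"
  using zero_int by (simp add: good_def)

lemma cgf_ext_tangent:
  assumes "u \<in> interior D"
  shows "ereal (K u + tmean u \<bullet> (v - u)) \<le> cgf_ext M Y v"
  using K_tangent[OF assms] by (simp add: cgf_ext_def)

lemma gE_integrable: "l \<in> good \<Longrightarrow> integrable lborel01 (\<lambda>t. f t *\<^sub>R tmean (f t *\<^sub>R l))"
  by (intro integrable_unit continuous_intros f_cont tmean_comp_continuous)

text \<open>The tangent inequality of \<open>K\<close> at \<open>f t *\<^sub>R l\<close>, integrated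
  over \<open>t\<close>. The point \<open>l'\<close> is arbitrary and \<open>Ef\<close> may be
  infinite there, as needed against a supremum over all \<open>l'\<close>.\<close>

lemma Ef_tangent:
  assumes l: "l \<in> good"
  shows "ereal (E l + gE l \<bullet> (l' - l)) \<le> Ef M Y f l'"
proof -
  let ?g = "\<lambda>t. K (f t *\<^sub>R l) + (f t *\<^sub>R tmean (f t *\<^sub>R l)) \<bullet> (l' - l)"
  have i: "integrable lborel01 (\<lambda>t. K (f t *\<^sub>R l))"
    by (rule integrable_unit[OF K_comp_continuous[OF l]])
  have "E l + gE l \<bullet> (l' - l) = (\<integral>t. ?g t \<partial>lborel01)"
    unfolding E_def gE_def integral_inner_left[OF gE_integrable[OF l], symmetric]
    by (rule Bochner_Integration.integral_add[symmetric, OF i integrable_inner_left[OF gE_integrable[OF l]]])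
  moreover have "ereal (\<integral>t. ?g t \<partial>lborel01) \<le> Ef M Y f l'"
  proof (rule Ef_ge)
    show "integrable lborel01 ?g"
      by (intro Bochner_Integration.integrable_add i integrable_inner_left gE_integrable l)
    fix t :: real assume t: "t \<in> {0..1}"
    have "(f t *\<^sub>R tmean (f t *\<^sub>R l)) \<bullet> (l' - l) = tmean (f t *\<^sub>R l) \<bullet> (f t *\<^sub>R l' - f t *\<^sub>R l)"
      by (simp add: algebra_simps)
    then show "ereal (?g t) \<le> cgf_ext M Y (f t *\<^sub>R l')"
      using cgf_ext_tangent[OF goodD[OF l t], of "f t *\<^sub>R l'"] by simp
  qed
  ultimately show ?thesis by simp
qed

lemma E_tangent:
  assumes "l \<in> good" "l' \<in> good"
  shows "E l + gE l \<bullet> (l' - l) \<le> E l'"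
  using Ef_tangent[OF assms(1), of l'] by (simp add: Ef_good[OF assms(2)])

lemma Ef_not_MInf: "Ef M Y f l \<noteq> -\<infinity>"
  using Ef_tangent[OF zero_good, of l] by auto

text \<open>A finite integral puts \<open>f t *\<^sub>R l\<close> into \<open>D\<close> for almost
  every \<open>t\<close>, hence into \<open>closure D\<close> for every \<open>t\<close>; shrinking
  towards 0 then reaches the interior.\<close>

lemma Ef_finite_imp_good:
  assumes fin: "Ef M Y f l < \<infinity>" and r: "0 \<le> r" "r < 1"
  shows "r *\<^sub>R l \<in> good"
proof -
  \<comment> \<open>The tangent of \<open>K\<close> at 0 is an integrable minorant whatever
    \<open>l\<close> is.\<close>
  let ?g = "\<lambda>t. K 0 + f t * (tmean 0 \<bullet> l)"
  have g: "integrable lborel01 ?g"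
    by (intro integrable_unit continuous_intros f_cont)
  have le: "ereal (?g t) \<le> cgf_ext M Y (f t *\<^sub>R l)" for t
    using cgf_ext_tangent[OF zero_int, of "f t *\<^sub>R l"] by simp
  let ?I = "\<integral>\<^sup>+ t. e2ennreal (cgf_ext M Y (f t *\<^sub>R l) - ereal (?g t)) \<partial>lborel01"
  have "?I \<noteq> \<infinity>"
    using fin Ef_split[of ?g l, OF g le] by (auto simp: top_ennreal.rep_eq)
  moreover have "(\<lambda>t. e2ennreal (cgf_ext M Y (f t *\<^sub>R l) - ereal (?g t))) \<in> borel_measurable lborel01"
    by measurable
  ultimately have "AE t in lborel01. e2ennreal (cgf_ext M Y (f t *\<^sub>R l) - ereal (?g t)) \<noteq> \<infinity>"
    by (intro nn_integral_noteq_infinite) auto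
  then have "AE t in lborel01. f t *\<^sub>R l \<in> closure D"
  proof eventually_elim
    case (elim t)
    then have "f t *\<^sub>R l \<in> D"
      by (cases "f t *\<^sub>R l \<in> D") (auto simp: cgf_ext_def e2ennreal_infty)
    then show ?case using closure_subset by blast
  qed
  then have "f t *\<^sub>R l \<in> closure D" if "t \<in> {0..1}" for t
    by (rule AE_unit_closed[OF _ _ closed_closure that]) (intro continuous_intros f_cont)
  then have "r *\<^sub>R (f t *\<^sub>R l) \<in> interior D" if "t \<in> {0..1}" for t
    using that r by (intro scale_interior_D) auto
  then show ?thesis by (simp add: good_def mult.commute)
qed

text \<open>\<open>K_scale\<close>, solved for the value at the unscaled point, gives a minorant of
  the integrand that stays continuous in \<open>t\<close> even when \<open>l\<close> itself is a
  boundary point.\<close>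

lemma E_scale_le:
  assumes good: "r *\<^sub>R l \<in> good" and r: "0 < r" "r < 1"
  shows "ereal ((E (r *\<^sub>R l) - (1 - r) * K 0) / r) \<le> Ef M Y f l"
proof -
  let ?g = "\<lambda>t. (K (f t *\<^sub>R (r *\<^sub>R l)) - (1 - r) * K 0) / r"
  have i: "integrable lborel01 (\<lambda>t. K (f t *\<^sub>R (r *\<^sub>R l)))"
    by (rule integrable_unit[OF K_comp_continuous[OF good]])
  have "(E (r *\<^sub>R l) - (1 - r) * K 0) / r = (\<integral>t. ?g t \<partial>lborel01)"
    using Bochner_Integration.integral_diff[OF i, of "\<lambda>_. (1 - r) * K 0"]
    by (simp only: E_def integral_divide_zero) (simp add: measure_lborel01 del: scaleR_scaleR)
  moreover have "ereal (\<integral>t. ?g t \<partial>lborel01) \<le> Ef M Y f l"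
  proof (rule Ef_ge)
    show "integrable lborel01 ?g"
      by (intro integrable_unit continuous_intros K_comp_continuous good) (use r in auto)
    fix t :: real
    show "ereal (?g t) \<le> cgf_ext M Y (f t *\<^sub>R l)"
      using K_scale[of "f t *\<^sub>R l" r] r by (auto simp: cgf_ext_def field_simps)
  qed
  ultimately show ?thesis by (simp only:)
qed

text \<open>Over \<open>good\<close> the supremum involves only real-valued affine functions of
  \<open>x\<close>, so closedness of the sub-level sets and the Chernoff bound apply
  directly.\<close>

lemma If_eq_SUP_good:
  assumes K0: "K 0 = 0"
  shows "If M Y f x = (SUP l\<in>good. ereal (l \<bullet> x - E l))"
proof (rule antisym)
  let ?S = "SUP l\<in>good. ereal (l \<bullet> x - E l)"
  show "If M Y f x \<le> ?S" unfolding If_def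
  proof (rule SUP_least)
    fix l
    show "ereal (l \<bullet> x) - Ef M Y f l \<le> ?S"
    proof (cases "Ef M Y f l")
      case (real e)
      have "ereal (r * (l \<bullet> x - e)) \<le> ?S" if r: "0 < r" "r < 1" for r
      proof -
        have g: "r *\<^sub>R l \<in> good" using real r by (intro Ef_finite_imp_good) auto
        have "E (r *\<^sub>R l) \<le> r * e"
          using E_scale_le[OF g r] r real by (simp add: K0 field_simps)
        then have "ereal (r * (l \<bullet> x - e)) \<le> ereal ((r *\<^sub>R l) \<bullet> x - E (r *\<^sub>R l))"
          by (simp add: right_diff_distrib)
        also have "\<dots> \<le> ?S" using g by (rule SUP_upper)
        finally show ?thesis .
      qed
      then have "\<forall>\<^sub>F r in at_left 1. ereal (r * (l \<bullet> x - e)) \<le> ?S"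
        by (intro eventually_at_leftI[of 0]) auto
      moreover have "((\<lambda>r. ereal (r * (l \<bullet> x - e))) \<longlongrightarrow> ereal (1 * (l \<bullet> x - e))) (at_left 1)"
        by (intro tendsto_intros)
      ultimately have "ereal (1 * (l \<bullet> x - e)) \<le> ?S"
        by (intro tendsto_upperbound) auto
      then show ?thesis using real by simp
    qed (use Ef_not_MInf in auto)
  qed
  show "?S \<le> If M Y f x"
  proof (rule SUP_least)
    fix l assume "l \<in> good"
    then have "ereal (l \<bullet> x - E l) = ereal (l \<bullet> x) - Ef M Y f l" by (simp add: Ef_good)
    also have "\<dots> \<le> If M Y f x" unfolding If_def by (rule SUP_upper) simp
    finally show "ereal (l \<bullet> x - E l) \<le> If M Y f x" .
  qed
qed

section \<open>Extreme values of the weight and the interior of the domain\<close>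

lemma f_bounds:
  assumes "t \<in> {0..1}"
  shows "f t \<le> fpmax f" "- fmmax f \<le> f t"
proof -
  have bd: "bdd_above ((\<lambda>t. max (g t) 0) ` {0..1})" if "continuous_on {0..1} g" for g :: "real \<Rightarrow> real"
    by (intro bounded_imp_bdd_above compact_imp_bounded compact_continuous_image continuous_intros that) auto
  have "max (f t) 0 \<le> fpmax f" "max (- f t) 0 \<le> fmmax f"
    unfolding fpmax_def fmmax_def using f_cont
    by (intro cSUP_upper[OF assms] bd continuous_intros; assumption)+
  then show "f t \<le> fpmax f" "- fmmax f \<le> f t" by auto
qed

text \<open>The alternative 0 is needed for negative \<open>g\<close>, where the maximum of the
  positive part is not a value of \<open>g\<close>.\<close>

lemma sup_pos_part_attained:
  fixes g :: "real \<Rightarrow> real"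
  assumes "continuous_on {0..1} g"
  shows "Sup ((\<lambda>t. max (g t) 0) ` {0..1}) = 0 \<or> (\<exists>t\<in>{0..1}. g t = Sup ((\<lambda>t. max (g t) 0) ` {0..1}))"
proof -
  have "\<exists>t\<in>{0..1}. \<forall>s\<in>{0..1}. max (g s) 0 \<le> max (g t) 0"
    using assms by (intro continuous_attains_sup continuous_intros) auto
  then obtain t where t: "t \<in> {0..1}" "\<And>s. s \<in> {0..1} \<Longrightarrow> max (g s) 0 \<le> max (g t) 0" by blast
  have "Sup ((\<lambda>t. max (g t) 0) ` {0..1}) = max (g t) 0"
    using t by (intro cSup_eq_maximum) auto
  then show ?thesis using t(1) by (cases "g t \<ge> 0") (auto simp: max_def)
qed

lemma fp_nonneg: "0 \<le> fpmax f" and fm_nonneg: "0 \<le> fmmax f"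
proof -
  have bd: "bdd_above ((\<lambda>t. max (g t) 0) ` {0..1})" if "continuous_on {0..1} g" for g :: "real \<Rightarrow> real"
    by (intro bounded_imp_bdd_above compact_imp_bounded compact_continuous_image continuous_intros that) auto
  have "max (f 0) 0 \<le> fpmax f" "max (- f 0) 0 \<le> fmmax f"
    unfolding fpmax_def fmmax_def using f_cont
    by (intro cSUP_upper[of 0 "{0..1}"] bd continuous_intros; simp)+
  then show "0 \<le> fpmax f" "0 \<le> fmmax f" by auto
qed

text \<open>All values of \<open>f\<close> lie between \<open>- fmmax f\<close> and
  \<open>fpmax f\<close>, and each of these is attained or 0. By convexity only the two extreme
  multiples of \<open>l\<close> matter.\<close>

lemma good_iff: "l \<in> good \<longleftrightarrow> fpmax f *\<^sub>R l \<in> interior D \<and> (- fmmax f) *\<^sub>R l \<in> interior D"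
proof
  assume l: "l \<in> good"
  have "fpmax f *\<^sub>R l \<in> interior D"
    using sup_pos_part_attained[OF f_cont, folded fpmax_def] zero_int goodD[OF l] by force
  moreover have "(- fmmax f) *\<^sub>R l \<in> interior D"
    using sup_pos_part_attained[OF continuous_on_minus[OF f_cont], folded fmmax_def]
  proof
    assume "fmmax f = 0" then show ?thesis using zero_int by simp
  next
    assume "\<exists>t\<in>{0..1}. - f t = fmmax f"
    then show ?thesis using goodD[OF l] by (metis minus_minus)
  qed
  ultimately show "fpmax f *\<^sub>R l \<in> interior D \<and> (- fmmax f) *\<^sub>R l \<in> interior D" by simp
next
  assume "fpmax f *\<^sub>R l \<in> interior D \<and> (- fmmax f) *\<^sub>R l \<in> interior D"
  then show "l \<in> good" unfolding good_def
    using segment_scale_mem[OF convex_interior[OF convex_D], of "fpmax f" l "fmmax f"]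
      zero_int f_bounds fp_nonneg fm_nonneg by auto
qed

lemma good_eq: "good = (\<lambda>l. fpmax f *\<^sub>R l) -` interior D \<inter> (\<lambda>l. (- fmmax f) *\<^sub>R l) -` interior D"
  using good_iff by auto

lemma open_good: "open good"
  unfolding good_eq by (intro open_Int open_vimage continuous_intros) auto

text \<open>For \<open>0 \<in> C\<close> the convention at \<open>a = 0\<close> agrees with the
  right-hand side, so no case distinction on the sign of \<open>f\<close> survives.\<close>

lemma divset_iff: "0 \<in> C \<Longrightarrow> l \<in> divset C a \<longleftrightarrow> a *\<^sub>R l \<in> C"
  by (force simp: divset_def image_iff intro: bexI[of _ "a *\<^sub>R l"])

lemma Df_iff: "l \<in> Df M Y f \<longleftrightarrow> fpmax f *\<^sub>R l \<in> D \<and> (- fmmax f) *\<^sub>R l \<in> D"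
proof -
  have "0 \<in> uminus ` D" using zero_in_D by force
  moreover have "v \<in> uminus ` D \<longleftrightarrow> - v \<in> D" for v by force
  ultimately show ?thesis by (simp add: Df_def divset_iff zero_in_D)
qed

lemma interior_Df: "interior (Df M Y f) = good"
proof (rule antisym)
  show "good \<subseteq> interior (Df M Y f)"
    using good_iff interior_D by (intro interior_maximal open_good) (auto simp: Df_iff)
  show "interior (Df M Y f) \<subseteq> good"
  proof
    fix l assume "l \<in> interior (Df M Y f)"
    then obtain e where e: "e > 0" "cball l e \<subseteq> Df M Y f" by (auto simp: mem_interior_cball)
    \<comment> \<open>An outward push by less than \<open>e\<close> along the ray of
      \<open>l\<close>; scaling back by \<open>1 / s < 1\<close> then lands in the interior. The
      summand 1 covers \<open>l = 0\<close>.\<close>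
    define s where "s = 1 + e / (norm l + 1)"
    have s: "s > 1" using e by (auto simp: s_def add_nonneg_pos)
    have "dist l (s *\<^sub>R l) \<le> e"
    proof -
      have "dist l (s *\<^sub>R l) = norm (l - s *\<^sub>R l)" by (simp add: dist_norm)
      also have "l - s *\<^sub>R l = - (e / (norm l + 1)) *\<^sub>R l" by (simp add: s_def algebra_simps)
      also have "norm \<dots> = e * (norm l / (norm l + 1))" using e by (simp add: abs_mult)
      also have "\<dots> \<le> e * 1" using e by (intro mult_left_mono) (auto simp: divide_le_eq_1 add_nonneg_pos)
      finally show ?thesis by simp
    qed
    then have "s *\<^sub>R l \<in> Df M Y f" using e by auto
    then have d: "fpmax f *\<^sub>R s *\<^sub>R l \<in> closure D" "(- fmmax f) *\<^sub>R s *\<^sub>R l \<in> closure D"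
      using closure_subset Df_iff by blast+
    have "(1/s) *\<^sub>R fpmax f *\<^sub>R s *\<^sub>R l \<in> interior D" "(1/s) *\<^sub>R (- fmmax f) *\<^sub>R s *\<^sub>R l \<in> interior D"
      by (rule scale_interior_D; use d s in \<open>simp add: field_simps\<close>)+
    then show "l \<in> good" using s by (simp add: good_iff)
  qed
qed

lemma gE_continuous: "continuous_on good gE"
proof -
  have 1: "continuous_on (good \<times> {0..1}) (\<lambda>p. f (snd p))"
    by (rule continuous_on_compose2[OF f_cont]) (auto intro: continuous_intros)
  have "continuous_on (good \<times> {0..1}) (\<lambda>p. tmean (f (snd p) *\<^sub>R fst p))"
    by (rule continuous_on_compose2[OF tmean_continuous]) (auto intro!: continuous_intros 1 goodD)
  with 1 have "continuous_on (good \<times> cbox 0 1) (\<lambda>(l, t). f t *\<^sub>R tmean (f t *\<^sub>R l))"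
    by (auto simp: case_prod_unfold cbox_interval intro: continuous_intros)
  then have "continuous_on good (\<lambda>l. integral (cbox 0 1) (\<lambda>t. f t *\<^sub>R tmean (f t *\<^sub>R l)))"
    by (rule integral_continuous_on_param)
  then show ?thesis
    by (rule continuous_on_eq) (simp add: gE_def integral_unit continuous_intros f_cont tmean_comp_continuous)
qed

text \<open>The tangent inequalities at \<open>l\<close> and at \<open>l + h\<close> squeeze the
  remainder between 0 and \<open>(gE (l + h) - gE l) \<bullet> h\<close>, and \<open>gE\<close> is
  continuous.\<close>

lemma E_has_derivative:
  assumes l: "l \<in> good"
  shows "(E has_derivative (\<lambda>h. gE l \<bullet> h)) (at l)"
  unfolding has_derivative_at
proof
  show "bounded_linear (\<lambda>h. gE l \<bullet> h)" by (rule bounded_linear_inner_right)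
  have near: "\<forall>\<^sub>F h in at 0. l + h \<in> good"
  proof -
    have "((\<lambda>h. l + h) \<longlongrightarrow> l + 0) (at 0)" by (intro tendsto_intros)
    then show ?thesis using l open_good by (simp add: topological_tendstoD)
  qed
  have "(gE \<longlongrightarrow> gE l) (at l)"
    using gE_continuous l open_good by (simp add: continuous_on_eq_continuous_at isCont_def)
  then have lim: "((\<lambda>h. norm (gE (l + h) - gE l)) \<longlongrightarrow> 0) (at 0)"
    by (simp add: LIM_offset_zero_iff tendsto_norm_zero_iff LIM_zero_iff)
  show "(\<lambda>h. norm (E (l + h) - E l - gE l \<bullet> h) / norm h) \<midarrow>0\<rightarrow> 0"
  proof (rule Lim_null_comparison[OF _ lim])
    show "\<forall>\<^sub>F h in at 0. norm (norm (E (l + h) - E l - gE l \<bullet> h) / norm h) \<le> norm (gE (l + h) - gE l)"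
      using near eventually_at_ball[OF zero_less_one]
    proof eventually_elim
      case (elim h)
      have a: "0 \<le> E (l + h) - E l - gE l \<bullet> h" using E_tangent[OF l elim(1)] by simp
      have "E (l + h) - E l - gE l \<bullet> h \<le> (gE (l + h) - gE l) \<bullet> h"
        using E_tangent[OF elim(1) l] by (simp add: inner_diff_left)
      also have "\<dots> \<le> norm (gE (l + h) - gE l) * norm h" by (rule norm_cauchy_schwarz)
      finally show ?case using a by (cases "h = 0") (auto simp: field_simps)
    qed
  qed
qed

end

section \<open>Large deviation bounds from exponential moments\<close>

lemma eventually_const_le_exp:
  assumes "(r::real) > 0"
  shows "\<forall>\<^sub>F n in sequentially. C \<le> exp (real n * r)"
proof -
  have "filterlim (\<lambda>n. real n * r) at_top sequentially"
    using assms by (intro filterlim_at_top_mult_tendsto_pos[OF tendsto_const]) (auto intro: filterlim_real_sequentially simp: mult.commute)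
  then have "filterlim (\<lambda>n. exp (real n * r)) at_top sequentially"
    by (rule filterlim_compose[OF exp_at_top])
  then show ?thesis by (simp add: filterlim_at_top)
qed

text \<open>Two opposite half-spaces per coordinate confine \<open>z\<close> to a box. This bounds
  both the sub-level sets of the rate function and the part of a closed set left uncovered by these
  half-spaces.\<close>

lemma norm_le_coordinate_bounds:
  fixes z :: "'v::euclidean_space" and \<Lambda> :: "'v \<Rightarrow> real"
  assumes d: "d > 0" and le: "\<And>i. i \<in> Basis \<Longrightarrow> d *\<^sub>R i \<bullet> z \<le> \<Lambda> (d *\<^sub>R i) + c"
    "\<And>i. i \<in> Basis \<Longrightarrow> (- d) *\<^sub>R i \<bullet> z \<le> \<Lambda> ((- d) *\<^sub>R i) + c"
  shows "norm z \<le> (\<Sum>i\<in>Basis. (\<bar>\<Lambda> (d *\<^sub>R i) + c\<bar> + \<bar>\<Lambda> ((- d) *\<^sub>R i) + c\<bar>) / d)"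
proof (rule order_trans[OF norm_le_l1 sum_mono])
  fix i :: 'v assume i: "i \<in> Basis"
  have "\<bar>z \<bullet> i\<bar> * d \<le> \<bar>\<Lambda> (d *\<^sub>R i) + c\<bar> + \<bar>\<Lambda> ((- d) *\<^sub>R i) + c\<bar>"
    using le[OF i] d by (simp add: inner_commute abs_mult abs_if mult.commute split: if_splits)
  then show "\<bar>z \<bullet> i\<bar> \<le> (\<bar>\<Lambda> (d *\<^sub>R i) + c\<bar> + \<bar>\<Lambda> ((- d) *\<^sub>R i) + c\<bar>) / d"
    using d by (simp add: field_simps)
qed

text \<open>The setting of the Gaertner-Ellis theorem: \<open>a n\<close> is the scaled logarithmic
  moment generating function of \<open>P n\<close> on \<open>G\<close>. The measures are only
  finite, so that restricted laws qualify.\<close>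

locale mgf_limit =
  fixes P :: "nat \<Rightarrow> 'v::euclidean_space measure" and G :: "'v set" and \<Lambda> :: "'v \<Rightarrow> real"
    and a :: "nat \<Rightarrow> 'v \<Rightarrow> real"
  assumes fin: "\<And>n. finite_measure (P n)" and sets_P [measurable_cong]: "\<And>n. sets (P n) = sets borel"
    and mgf: "\<And>n l. n \<ge> 1 \<Longrightarrow> l \<in> G \<Longrightarrow>
      (\<integral>\<^sup>+ z. ennreal (exp (real n * (l \<bullet> z))) \<partial>P n) = ennreal (exp (real n * a n l))"
    and lim: "\<And>l. l \<in> G \<Longrightarrow> (\<lambda>n. a n l) \<longlonglongrightarrow> \<Lambda> l"
begin

text \<open>Markov's inequality for the sum of the exponentials over \<open>S\<close>. Half of
  \<open>r\<close> is spent on the convergence of \<open>a n\<close>, half on the cardinality of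
  \<open>S\<close>.\<close>

lemma chernoff_cover:
  assumes S: "finite S" "S \<subseteq> G" and B: "B \<subseteq> (\<Union>l\<in>S. {z. \<Lambda> l + c < l \<bullet> z})" "B \<in> sets borel" and r: "r > 0"
  shows "\<forall>\<^sub>F n in sequentially. measure (P n) B \<le> exp (- real n * (c - r))"
proof -
  have "\<forall>\<^sub>F n in sequentially. \<forall>l\<in>S. a n l < \<Lambda> l + r / 2"
    using S lim r by (intro eventually_ball_finite ballI order_tendstoD(2)[OF lim]) auto
  moreover have "\<forall>\<^sub>F n in sequentially. real (card S) \<le> exp (real n * (r / 2))"
    using r by (intro eventually_const_le_exp) auto
  ultimately show ?thesis using eventually_ge_at_top[of 1]
  proof eventually_elim
    case (elim n)
    interpret finite_measure "P n" by (rule fin)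
    have "emeasure (P n) B = (\<integral>\<^sup>+ z. indicator B z \<partial>P n)" using B(2) by simp
    also have "\<dots> \<le> (\<integral>\<^sup>+ z. (\<Sum>l\<in>S. ennreal (exp (- real n * (\<Lambda> l + c))) * ennreal (exp (real n * (l \<bullet> z)))) \<partial>P n)"
    proof (rule nn_integral_mono)
      fix z
      show "indicator B z \<le> (\<Sum>l\<in>S. ennreal (exp (- real n * (\<Lambda> l + c))) * ennreal (exp (real n * (l \<bullet> z))))"
      proof (cases "z \<in> B")
        case True
        then obtain l where l: "l \<in> S" "\<Lambda> l + c < l \<bullet> z" using B by auto
        have "0 \<le> real n * (l \<bullet> z - (\<Lambda> l + c))" using l by (intro mult_nonneg_nonneg) auto
        then have "1 \<le> exp (- real n * (\<Lambda> l + c)) * exp (real n * (l \<bullet> z))"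
          unfolding exp_add[symmetric] by (simp add: algebra_simps)
        then have "1 \<le> ennreal (exp (- real n * (\<Lambda> l + c))) * ennreal (exp (real n * (l \<bullet> z)))"
          by (simp add: ennreal_mult[symmetric] del: ennreal_1 flip: ennreal_1)
        also have "\<dots> \<le> (\<Sum>l\<in>S. ennreal (exp (- real n * (\<Lambda> l + c))) * ennreal (exp (real n * (l \<bullet> z))))"
          using S l by (intro member_le_sum) auto
        finally show ?thesis using True by simp
      qed simp
    qed
    also have "\<dots> = (\<Sum>l\<in>S. ennreal (exp (- real n * (\<Lambda> l + c))) * ennreal (exp (real n * a n l)))"
      using S elim mgf by (simp add: nn_integral_sum nn_integral_cmult subset_iff)
    also have "\<dots> \<le> (\<Sum>l\<in>S. ennreal (exp (- real n * (c - r / 2))))"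
    proof (rule sum_mono)
      fix l assume "l \<in> S"
      then have "real n * (a n l - (\<Lambda> l + r / 2)) \<le> 0" using elim(1) by (intro mult_nonneg_nonpos) (auto simp: less_imp_le)
      then show "ennreal (exp (- real n * (\<Lambda> l + c))) * ennreal (exp (real n * a n l)) \<le> ennreal (exp (- real n * (c - r / 2)))"
        by (simp add: ennreal_mult[symmetric] exp_add[symmetric] algebra_simps)
    qed
    also have "\<dots> = ennreal (real (card S) * exp (- real n * (c - r / 2)))"
      by (simp add: ennreal_mult ennreal_of_nat_eq_real_of_nat)
    finally have "measure (P n) B \<le> real (card S) * exp (- real n * (c - r / 2))"
      by (simp add: emeasure_eq_measure)
    also have "\<dots> \<le> exp (real n * (r / 2)) * exp (- real n * (c - r / 2))"
      using elim by (intro mult_right_mono) auto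
    also have "\<dots> = exp (- real n * (c - r))"
      by (simp add: exp_add[symmetric] algebra_simps)
    finally show ?case .
  qed
qed

text \<open>The half-spaces for small multiples of the basis vectors miss only a bounded set, so a
  compact remainder is left to cover. This takes the place of a separate exponential tightness
  argument.\<close>

lemma finite_halfspace_cover:
  assumes F: "closed F" and G0: "0 \<in> interior G" and c: "\<And>x. x \<in> F \<Longrightarrow> \<exists>l\<in>G. c < l \<bullet> x - \<Lambda> l"
  obtains S where "finite S" "S \<subseteq> G" "F \<subseteq> (\<Union>l\<in>S. {z. \<Lambda> l + c < l \<bullet> z})"
proof -
  let ?H = "\<lambda>l. {z. \<Lambda> l + c < l \<bullet> z}"
  obtain d where d: "d > 0" "cball 0 d \<subseteq> G" using G0 by (auto simp: mem_interior_cball)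
  define S0 where "S0 = (\<lambda>i. d *\<^sub>R i) ` (Basis::'v set) \<union> (\<lambda>i. (- d) *\<^sub>R i) ` Basis"
  have S0: "finite S0" "S0 \<subseteq> G" using d by (auto simp: S0_def intro!: subsetD[OF d(2)])
  have op: "open (?H l)" for l
    by (intro open_Collect_less continuous_intros)
  define C where "C = (\<Sum>i\<in>(Basis::'v set). (\<bar>\<Lambda> (d *\<^sub>R i) + c\<bar> + \<bar>\<Lambda> ((- d) *\<^sub>R i) + c\<bar>) / d)"
  have "norm z \<le> C" if "z \<notin> (\<Union>l\<in>S0. ?H l)" for z
    unfolding C_def
  proof (rule norm_le_coordinate_bounds[OF d(1)])
    fix i :: 'v assume "i \<in> Basis"
    then have "d *\<^sub>R i \<in> S0" "(- d) *\<^sub>R i \<in> S0" by (auto simp: S0_def)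
    then show "d *\<^sub>R i \<bullet> z \<le> \<Lambda> (d *\<^sub>R i) + c" "(- d) *\<^sub>R i \<bullet> z \<le> \<Lambda> ((- d) *\<^sub>R i) + c"
      using that by (auto simp: not_less simp del: inner_scaleR_left)
  qed
  then have "bounded (F - (\<Union>l\<in>S0. ?H l))" unfolding bounded_iff by (intro exI[of _ C] ballI) blast
  moreover have "closed (F - (\<Union>l\<in>S0. ?H l))" using F op by (intro closed_Diff) auto
  ultimately have cpt: "compact (F - (\<Union>l\<in>S0. ?H l))" by (simp add: compact_eq_bounded_closed)
  have sub: "F - (\<Union>l\<in>S0. ?H l) \<subseteq> (\<Union>l\<in>G. ?H l)" using c by (force simp: algebra_simps)
  obtain S1 where S1: "S1 \<subseteq> G" "finite S1" "F - (\<Union>l\<in>S0. ?H l) \<subseteq> (\<Union>l\<in>S1. ?H l)"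
    by (rule compactE_image[OF cpt op sub])
  show thesis by (rule that[of "S0 \<union> S1"]) (use S0 S1 in auto)
qed

lemma ldp_upper:
  assumes G0: "0 \<in> interior G" and B: "B \<in> sets borel"
  shows "limsup (\<lambda>n. lnp n (measure (P n) B)) \<le> - (INF x\<in>closure B. SUP l\<in>G. ereal (l \<bullet> x - \<Lambda> l))"
proof -
  let ?J = "\<lambda>x. SUP l\<in>G. ereal (l \<bullet> x - \<Lambda> l)"
  let ?l = "limsup (\<lambda>n. lnp n (measure (P n) B))" and ?I = "INF x\<in>closure B. ?J x"
  have "?I \<le> - ?l"
  proof (rule dense_le)
    fix e assume e: "e < ?I"
    then obtain e' where e': "e < e'" "e' < ?I" using dense by blast
    show "e \<le> - ?l"
    proof (cases e)
      case (real c)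
      then obtain c' where c': "c < c'" "ereal c' < ?I"
        using e' by (cases e') (auto dest!: ereal_dense2)
      have "\<exists>l\<in>G. c' < l \<bullet> x - \<Lambda> l" if "x \<in> closure B" for x
        using less_INF_D[OF c'(2) that] by (auto simp: less_SUP_iff)
      from finite_halfspace_cover[OF closed_closure G0 this] obtain S
        where S: "finite S" "S \<subseteq> G" "closure B \<subseteq> (\<Union>l\<in>S. {z. \<Lambda> l + c' < l \<bullet> z})" by blast
      \<comment> \<open>The gap \<open>c' - c\<close> is the loss permitted in the Chernoff bound,
        which leaves exactly the rate \<open>c\<close>.\<close>
      have "\<forall>\<^sub>F n in sequentially. measure (P n) B \<le> exp (- real n * (c' - (c' - c)))"
        using S B c' closure_subset by (intro chernoff_cover) fastforce+
      then have "\<forall>\<^sub>F n in sequentially. lnp n (measure (P n) B) \<le> ereal (- c)"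
        using eventually_ge_at_top[of 1]
      proof eventually_elim
        case (elim n)
        then show ?case
        proof (cases "measure (P n) B = 0")
          case False
          then have "measure (P n) B > 0" using measure_nonneg[of "P n" B] by linarith
          then have "ln (measure (P n) B) \<le> - real n * c" using elim(1) ln_le_cancel_iff[of "measure (P n) B" "exp (- real n * c)"] by simp
          then show ?thesis using elim(2) False by (simp add: lnp_def field_simps)
        qed (simp add: lnp_def)
      qed
      then have "?l \<le> ereal (- c)"
        by (rule Limsup_bounded)
      then show ?thesis unfolding real by (metis ereal_minus_le_minus ereal_uminus_uminus uminus_ereal.simps(1))
    next
      case PInf
      then show ?thesis using e by simp
    qed simp
  qed
  then have "- (- ?l) \<le> - ?I"
    by (subst ereal_minus_le_minus)
  then show ?thesis by (simp only: ereal_uminus_uminus)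
qed

text \<open>The complement of the ball is covered by finitely many half-spaces. On each of them, differentiability
  of \<open>\<Lambda>\<close> at \<open>\<mu>\<close> makes the contribution to the exponential moment at \<open>\<mu>\<close> exponentially negligible.\<close>
lemma tilted_ball_lower:
  assumes G: "G = UNIV" and der: "(\<Lambda> has_derivative (\<lambda>h. y \<bullet> h)) (at \<mu>)" and r: "r > 0" and \<eta>: "\<eta> > 0"
  shows "\<forall>\<^sub>F n in sequentially. exp (- real n * (\<mu> \<bullet> y - \<Lambda> \<mu> + r)) \<le> measure (P n) (ball y \<eta>)"
proof -
  \<comment> \<open>On the smaller ball \<open>\<mu> \<bullet> z\<close> varies by at most
    \<open>r / 4\<close>.\<close>
  define e1 where "e1 = min \<eta> (r / (4 * (norm \<mu> + 1)))"
  have e1: "e1 > 0" "e1 \<le> \<eta>" using r \<eta> by (auto simp: e1_def add_nonneg_pos)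
  have mu_e1: "norm \<mu> * e1 \<le> r / 4"
  proof -
    have "norm \<mu> * e1 \<le> (norm \<mu> + 1) * (r / (4 * (norm \<mu> + 1)))"
      using r \<eta> by (intro mult_mono) (auto simp: e1_def)
    also have "\<dots> = r / 4" by (simp add: field_simps add_nonneg_eq_0_iff)
    finally show ?thesis .
  qed
  \<comment> \<open>Outside that ball some signed coordinate of \<open>z - y\<close> is at least
    \<open>e2\<close>.\<close>
  define e2 where "e2 = e1 / real DIM('v)"
  have e2: "e2 > 0" using e1 by (simp add: e2_def)
  define H where "H = (Basis :: 'v set) \<union> uminus ` Basis"
  have H: "finite H" "\<And>e. e \<in> H \<Longrightarrow> norm e = 1" by (auto simp: H_def)
  have cover: "\<exists>e\<in>H. e2 \<le> e \<bullet> (z - y)" if "z \<notin> ball y e1" for z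
  proof (rule ccontr)
    assume "\<not> ?thesis"
    then have "\<And>e. e \<in> H \<Longrightarrow> e \<bullet> (z - y) < e2" by (auto simp: not_le)
    then have "\<bar>(z - y) \<bullet> i\<bar> < e2" if "i \<in> Basis" for i
    proof -
      have "i \<in> H" "- i \<in> H" using that by (auto simp: H_def)
      then have "i \<bullet> (z - y) < e2" "(- i) \<bullet> (z - y) < e2" using \<open>\<And>e. e \<in> H \<Longrightarrow> e \<bullet> (z - y) < e2\<close> by blast+
      then show ?thesis by (simp add: abs_less_iff inner_commute[of i])
    qed
    then have "(\<Sum>i\<in>Basis. \<bar>(z - y) \<bullet> i\<bar>) < (\<Sum>i\<in>(Basis::'v set). e2)"
      by (intro sum_strict_mono) auto
    then have "norm (z - y) < e1" using norm_le_l1[of "z - y"] by (simp add: e2_def)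
    then show False using that by (simp add: dist_norm norm_minus_commute)
  qed
  have "\<exists>d>0. \<forall>x. norm (x - \<mu>) < d \<longrightarrow> norm (\<Lambda> x - \<Lambda> \<mu> - y \<bullet> (x - \<mu>)) \<le> e2 / 2 * norm (x - \<mu>)"
    using der e2 unfolding has_derivative_at_alt by (meson half_gt_zero)
  then obtain d where d: "d > 0" "\<And>x. norm (x - \<mu>) < d \<Longrightarrow> norm (\<Lambda> x - \<Lambda> \<mu> - y \<bullet> (x - \<mu>)) \<le> e2 / 2 * norm (x - \<mu>)"
    by blast
  define s where "s = d / 2"
  have s: "s > 0" "s < d" using d by (auto simp: s_def)
  have \<Lambda>s: "\<Lambda> (\<mu> + s *\<^sub>R e) \<le> \<Lambda> \<mu> + s * (e \<bullet> y) + s * e2 / 2" if "e \<in> H" for e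
  proof -
    have "\<bar>\<Lambda> (\<mu> + s *\<^sub>R e) - \<Lambda> \<mu> - s * (e \<bullet> y)\<bar> \<le> e2 / 2 * s"
      using d(2)[of "\<mu> + s *\<^sub>R e"] s H(2)[OF that] by (simp add: inner_commute)
    then show ?thesis by (simp only: abs_le_iff mult.commute[of s e2]) argo
  qed
  \<comment> \<open>Tilting by \<open>s\<close> in direction \<open>e\<close> gains
    \<open>s * e2\<close> on the half-space and loses at most \<open>s * e2 / 2\<close> through
    differentiability, leaving \<open>q\<close>. Convergence of \<open>a n\<close> costs another
    \<open>q / 2\<close>, so each half-space contributes at rate
    \<open>\<Lambda> \<mu> - 2 * \<kappa>\<close>, against a total of rate at least
    \<open>\<Lambda> \<mu> - \<kappa>\<close>.\<close>
  define q where "q = s * e2 / 2"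
  have q: "q > 0" using s e2 by (simp add: q_def)
  define \<kappa> where "\<kappa> = min (q / 4) (r / 4)"
  have \<kappa>: "\<kappa> > 0" "2 * \<kappa> \<le> q / 2" "\<kappa> \<le> r / 4" using q r by (auto simp: \<kappa>_def)
  have "\<forall>\<^sub>F n in sequentially. \<forall>e\<in>H. a n (\<mu> + s *\<^sub>R e) < \<Lambda> (\<mu> + s *\<^sub>R e) + q / 2"
    using H q G by (intro eventually_ball_finite ballI order_tendstoD(2)[OF lim]) auto
  moreover have "\<forall>\<^sub>F n in sequentially. \<Lambda> \<mu> - \<kappa> < a n \<mu>"
    using \<kappa> G by (intro order_tendstoD(1)[OF lim]) auto
  moreover have "\<forall>\<^sub>F n in sequentially. 2 * real (card H) \<le> exp (real n * \<kappa>)"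
    using \<kappa> by (intro eventually_const_le_exp) auto
  moreover have "\<forall>\<^sub>F n in sequentially. 2 \<le> exp (real n * (r / 4))"
    using r by (intro eventually_const_le_exp) auto
  ultimately show ?thesis using eventually_ge_at_top[of 1]
  proof eventually_elim
    case (elim n)
    interpret finite_measure "P n" by (rule fin)
    let ?B = "exp (real n * (\<mu> \<bullet> y + r / 4))" and ?m = "measure (P n) (ball y e1)"
    let ?c = "\<lambda>e. exp (- real n * (s * (e \<bullet> y + e2)))"
    have "ennreal (exp (real n * a n \<mu>)) = (\<integral>\<^sup>+ z. ennreal (exp (real n * (\<mu> \<bullet> z))) \<partial>P n)"
      using mgf elim G by simp
    also have "\<dots> \<le> (\<integral>\<^sup>+ z. ennreal ?B * indicator (ball y e1) z +
        (\<Sum>e\<in>H. ennreal (?c e) * ennreal (exp (real n * ((\<mu> + s *\<^sub>R e) \<bullet> z)))) \<partial>P n)"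
    proof (rule nn_integral_mono)
      fix z
      show "ennreal (exp (real n * (\<mu> \<bullet> z))) \<le> ennreal ?B * indicator (ball y e1) z +
        (\<Sum>e\<in>H. ennreal (?c e) * ennreal (exp (real n * ((\<mu> + s *\<^sub>R e) \<bullet> z))))"
      proof (cases "z \<in> ball y e1")
        case True
        have "\<mu> \<bullet> (z - y) \<le> norm \<mu> * norm (z - y)" by (rule norm_cauchy_schwarz)
        also have "\<dots> \<le> norm \<mu> * e1" using True by (intro mult_left_mono) (auto simp: dist_norm norm_minus_commute)
        finally have "\<mu> \<bullet> z \<le> \<mu> \<bullet> y + r / 4" using mu_e1 by (simp add: inner_diff_right)
        then have "ennreal (exp (real n * (\<mu> \<bullet> z))) \<le> ennreal ?B"
          by (intro ennreal_leI) (simp add: mult_left_mono)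
        then show ?thesis using True by (simp add: add_increasing2)
      next
        case False
        then obtain e where e: "e \<in> H" "e2 \<le> e \<bullet> (z - y)" using cover by blast
        have "0 \<le> real n * (s * (e \<bullet> z - (e \<bullet> y + e2)))"
          using s e by (intro mult_nonneg_nonneg) (auto simp: inner_diff_right)
        then have "exp (real n * (\<mu> \<bullet> z)) \<le> ?c e * exp (real n * ((\<mu> + s *\<^sub>R e) \<bullet> z))"
          unfolding exp_add[symmetric] by (simp add: inner_add_left algebra_simps)
        then have "ennreal (exp (real n * (\<mu> \<bullet> z))) \<le> ennreal (?c e) * ennreal (exp (real n * ((\<mu> + s *\<^sub>R e) \<bullet> z)))"
          by (simp add: ennreal_mult[symmetric])
        also have "\<dots> \<le> (\<Sum>e\<in>H. ennreal (?c e) * ennreal (exp (real n * ((\<mu> + s *\<^sub>R e) \<bullet> z))))"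
          using H e by (intro member_le_sum) auto
        finally show ?thesis using False by simp
      qed
    qed
    also have "\<dots> = ennreal ?B * emeasure (P n) (ball y e1) +
        (\<Sum>e\<in>H. ennreal (?c e) * ennreal (exp (real n * a n (\<mu> + s *\<^sub>R e))))"
    proof -
      have "(\<integral>\<^sup>+ z. (\<Sum>e\<in>H. ennreal (?c e) * ennreal (exp (real n * ((\<mu> + s *\<^sub>R e) \<bullet> z)))) \<partial>P n)
          = (\<Sum>e\<in>H. ennreal (?c e) * ennreal (exp (real n * a n (\<mu> + s *\<^sub>R e))))"
        using elim(5) mgf G by (simp add: nn_integral_sum nn_integral_cmult)
      moreover have [measurable]: "ball y e1 \<in> sets (P n)" by (simp add: sets_P)
      moreover have "(\<lambda>z. ennreal ?B * indicator (ball y e1) z) \<in> borel_measurable (P n)"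
        by measurable
      ultimately show ?thesis
        by (subst nn_integral_add) (simp_all add: nn_integral_cmult_indicator)
    qed
    also have "\<dots> \<le> ennreal ?B * emeasure (P n) (ball y e1) + (\<Sum>e\<in>H. ennreal (exp (real n * (\<Lambda> \<mu> - 2 * \<kappa>))))"
    proof (intro add_left_mono sum_mono)
      fix e assume e: "e \<in> H"
      have "a n (\<mu> + s *\<^sub>R e) - s * (e \<bullet> y + e2) \<le> \<Lambda> \<mu> - 2 * \<kappa>"
        using elim(1) e \<Lambda>s[OF e] \<kappa>(2) by (auto simp: q_def algebra_simps)
      then have "real n * (a n (\<mu> + s *\<^sub>R e) - s * (e \<bullet> y + e2)) \<le> real n * (\<Lambda> \<mu> - 2 * \<kappa>)"
        by (intro mult_left_mono) auto
      then show "ennreal (?c e) * ennreal (exp (real n * a n (\<mu> + s *\<^sub>R e))) \<le> ennreal (exp (real n * (\<Lambda> \<mu> - 2 * \<kappa>)))"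
        by (simp add: ennreal_mult[symmetric] exp_add[symmetric] algebra_simps)
    qed
    also have "\<dots> = ennreal (?B * ?m + real (card H) * exp (real n * (\<Lambda> \<mu> - 2 * \<kappa>)))"
      by (simp add: emeasure_eq_measure ennreal_mult ennreal_of_nat_eq_real_of_nat)
    finally have A: "exp (real n * a n \<mu>) \<le> ?B * ?m + real (card H) * exp (real n * (\<Lambda> \<mu> - 2 * \<kappa>))"
      by (subst (asm) ennreal_le_iff) auto
    have "exp (real n * (\<Lambda> \<mu> - \<kappa>)) \<le> exp (real n * a n \<mu>)"
      using elim(2) by (simp add: mult_left_mono)
    moreover have "real (card H) * exp (real n * (\<Lambda> \<mu> - 2 * \<kappa>)) \<le> exp (real n * \<kappa>) / 2 * exp (real n * (\<Lambda> \<mu> - 2 * \<kappa>))"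
      using elim(3) by (intro mult_right_mono) auto
    moreover have "exp (real n * \<kappa>) / 2 * exp (real n * (\<Lambda> \<mu> - 2 * \<kappa>)) = exp (real n * (\<Lambda> \<mu> - \<kappa>)) / 2"
      by (simp add: exp_add[symmetric] algebra_simps)
    ultimately have B: "exp (real n * (\<Lambda> \<mu> - \<kappa>)) / 2 \<le> ?B * ?m" using A by linarith
    have "2 * exp (real n * (\<Lambda> \<mu> - r / 2)) \<le> exp (real n * (r / 4)) * exp (real n * (\<Lambda> \<mu> - r / 2))"
      using elim(4) by (intro mult_right_mono) auto
    also have "\<dots> = exp (real n * (\<Lambda> \<mu> - r / 4))" by (simp add: exp_add[symmetric] algebra_simps)
    also have "\<dots> \<le> exp (real n * (\<Lambda> \<mu> - \<kappa>))" using \<kappa>(3) by (simp add: mult_left_mono)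
    finally have "exp (real n * (\<Lambda> \<mu> - r / 2)) \<le> ?B * ?m" using B by linarith
    then have "exp (- real n * (\<mu> \<bullet> y + r / 4)) * exp (real n * (\<Lambda> \<mu> - r / 2)) \<le> exp (- real n * (\<mu> \<bullet> y + r / 4)) * (?B * ?m)"
      by (intro mult_left_mono) auto
    also have "\<dots> = ?m" by (simp add: mult.assoc[symmetric] exp_add[symmetric])
    finally have "exp (- real n * (\<mu> \<bullet> y + r / 4)) * exp (real n * (\<Lambda> \<mu> - r / 2)) \<le> ?m" .
    moreover have "exp (- real n * (\<mu> \<bullet> y - \<Lambda> \<mu> + r)) \<le> exp (- real n * (\<mu> \<bullet> y + r / 4)) * exp (real n * (\<Lambda> \<mu> - r / 2))"
      unfolding exp_add[symmetric] using r by (simp add: algebra_simps)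
    moreover have "?m \<le> measure (P n) (ball y \<eta>)"
      using e1 by (intro finite_measure_mono) auto
    ultimately show ?case by linarith
  qed
qed

end

section \<open>The large deviation principle for weighted means\<close>

text \<open>The maximiser \<open>m j\<close> of \<open>l \<bullet> x - e j l - \<delta> / 2 * (l \<bullet> l)\<close> satisfies \<open>g j (m j) = x - \<delta> *\<^sub>R m j\<close>.
  At a cluster point \<open>l\<close> of the maximisers, the value \<open>F l\<close> is finite and \<open>\<delta> / 2 * (l \<bullet> l) \<le> J\<close>, so that
  \<open>\<delta> * norm l\<close> is small with \<open>\<delta>\<close>; neither steepness nor strict convexity is needed.\<close>
lemma approximate_dual_point:
  fixes e :: "nat \<Rightarrow> 'v::euclidean_space \<Rightarrow> real" and F :: "'v \<Rightarrow> ereal" and g :: "nat \<Rightarrow> 'v \<Rightarrow> 'v"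
  assumes der: "\<And>j l. (e j has_derivative (\<lambda>h. g j l \<bullet> h)) (at l)"
    and mono: "\<And>i j l. i \<le> j \<Longrightarrow> e i l \<le> e j l"
    and zero: "\<And>j. e j 0 \<le> 0"
    and sub: "\<And>l. e 0 0 + g 0 0 \<bullet> l \<le> e 0 l"
    and sup: "\<And>l c. ereal c < F l \<Longrightarrow> \<exists>j. c < e j l"
    and J: "\<And>l. ereal (l \<bullet> x) - F l \<le> ereal J"
    and eps: "\<epsilon> > 0"
  shows "\<exists>j l. dist x (g j l) < \<epsilon> \<and> l \<bullet> g j l - e j l \<le> J + \<epsilon>"
proof -
  \<comment> \<open>Small enough that \<open>\<delta> / 2 * (l \<bullet> l) \<le> J\<close> forces
    \<open>\<delta> * norm l < \<epsilon>\<close>; the summand 1 covers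
    \<open>J = 0\<close>.\<close>
  define \<delta> where "\<delta> = \<epsilon>\<^sup>2 / (4 * (\<bar>J\<bar> + 1))"
  have \<delta>: "\<delta> > 0" using eps by (auto simp: \<delta>_def add_nonneg_pos)
  have \<delta>J: "\<delta> * (2 * J) < \<epsilon>\<^sup>2"
  proof -
    have "\<delta> * (2 * J) \<le> \<delta> * (2 * (\<bar>J\<bar> + 1))" using \<delta> by (intro mult_left_mono) auto
    also have "\<dots> = \<epsilon>\<^sup>2 / 2" by (simp add: \<delta>_def field_simps add_nonneg_eq_0_iff)
    also have "\<dots> < \<epsilon>\<^sup>2" using eps by simp
    finally show ?thesis .
  qed
  define \<Phi> where "\<Phi> j l = l \<bullet> x - e j l - \<delta> / 2 * (l \<bullet> l)" for j l
  \<comment> \<open>Beyond this radius the quadratic penalty beats the affine minorant from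
    \<open>sub\<close>, uniformly in \<open>j\<close>. The added 1 makes \<open>norm l > 1\<close>
    there, so that the constant term can be multiplied by \<open>norm l\<close>.\<close>
  define C where "C = 2 / \<delta> * (norm x + norm (g 0 0) + \<bar>e 0 0\<bar>) + 1"
  have C1: "C \<ge> 1" using \<delta> by (simp add: C_def)
  have cont: "continuous_on S (e j)" for S j
    using der has_derivative_continuous by (blast intro: continuous_at_imp_continuous_on)
  have outside: "\<Phi> j l < 0" if "norm l > C" for j l
  proof -
    have n1: "norm l > 1" using that C1 by linarith
    have "e 0 0 + g 0 0 \<bullet> l \<le> e j l" using sub[of l] mono[of 0 j l] by simp
    moreover have "l \<bullet> x \<le> norm l * norm x" "- (g 0 0 \<bullet> l) \<le> norm (g 0 0) * norm l"
      using norm_cauchy_schwarz[of l x] norm_cauchy_schwarz[of "- g 0 0" l] by simp_all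
    moreover have "- e 0 0 \<le> \<bar>e 0 0\<bar> * norm l"
      using mult_left_mono[of 1 "norm l" "\<bar>e 0 0\<bar>"] n1 by simp
    ultimately have "\<Phi> j l \<le> norm l * (norm x + norm (g 0 0) + \<bar>e 0 0\<bar>) - \<delta> / 2 * (norm l * norm l)"
      unfolding \<Phi>_def by (simp add: algebra_simps flip: power2_norm_eq_inner power2_eq_square)
    also have "\<dots> = norm l * (norm x + norm (g 0 0) + \<bar>e 0 0\<bar> - \<delta> / 2 * norm l)"
      by (simp add: algebra_simps)
    also have "\<dots> < 0"
    proof (rule mult_pos_neg)
      have "norm x + norm (g 0 0) + \<bar>e 0 0\<bar> = \<delta> / 2 * (C - 1)" using \<delta> by (simp add: C_def)
      also have "\<dots> < \<delta> / 2 * norm l" using that \<delta> by (intro mult_strict_left_mono) auto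
      finally show "norm x + norm (g 0 0) + \<bar>e 0 0\<bar> - \<delta> / 2 * norm l < 0" by simp
    qed (use n1 in auto)
    finally show ?thesis .
  qed
  have "\<exists>l\<in>cball 0 C. \<forall>l'. \<Phi> j l' \<le> \<Phi> j l" for j
  proof -
    have "continuous_on (cball 0 C) (\<Phi> j)" unfolding \<Phi>_def by (intro continuous_intros cont)
    then obtain l where l: "l \<in> cball 0 C" "\<And>l'. l' \<in> cball 0 C \<Longrightarrow> \<Phi> j l' \<le> \<Phi> j l"
      using continuous_attains_sup[of "cball 0 C" "\<Phi> j"] C1 by auto
    have "\<Phi> j l' \<le> \<Phi> j l" for l'
    proof (cases "norm l' > C")
      case True
      have "0 \<le> \<Phi> j 0" using zero by (simp add: \<Phi>_def)
      also have "\<dots> \<le> \<Phi> j l" using C1 by (intro l(2)) auto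
      finally show ?thesis using outside[OF True, of j] by simp
    qed (use l(2) in auto)
    then show ?thesis using l(1) by blast
  qed
  then obtain m where m: "\<And>j. m j \<in> cball 0 C" "\<And>j l'. \<Phi> j l' \<le> \<Phi> j (m j)" by metis
  have pos: "0 \<le> \<Phi> j (m j)" for j using m(2)[of j 0] zero[of j] by (simp add: \<Phi>_def)
  have grad: "g j (m j) = x - \<delta> *\<^sub>R m j" for j
  proof -
    have "(\<Phi> j has_derivative (\<lambda>h. h \<bullet> x - g j (m j) \<bullet> h - \<delta> / 2 * (m j \<bullet> h + h \<bullet> m j))) (at (m j))"
      unfolding \<Phi>_def by (auto intro!: derivative_eq_intros der)
    from differential_zero_maxmin[OF _ open_UNIV this] m(2)
    have "h \<bullet> x - g j (m j) \<bullet> h - \<delta> / 2 * (m j \<bullet> h + h \<bullet> m j) = 0" for h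
      by (auto dest: fun_cong)
    \<comment> \<open>The derivative is tested against its own gradient vector.\<close>
    from this[of "x - g j (m j) - \<delta> *\<^sub>R m j"]
    have "(x - g j (m j) - \<delta> *\<^sub>R m j) \<bullet> (x - g j (m j) - \<delta> *\<^sub>R m j) = 0"
      by (simp add: inner_diff_left inner_diff_right inner_commute algebra_simps)
    then have "x - g j (m j) - \<delta> *\<^sub>R m j = 0" by (rule inner_eq_zero_iff[THEN iffD1])
    then show ?thesis by (simp add: algebra_simps)
  qed
  obtain l r where r: "strict_mono r" "(m \<circ> r) \<longlonglongrightarrow> l"
    using compact_cball[of 0 C] m(1) unfolding compact_def by metis
  \<comment> \<open>A fixed \<open>e i\<close> is continuous at \<open>l\<close> and lies below
    \<open>e (r k)\<close> once \<open>r k \<ge> i\<close>; this gives a lower bound although both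
    the function and the point move with \<open>k\<close>.\<close>
  have ev: "\<forall>\<^sub>F k in sequentially. c < e (r k) (m (r k))" if c: "ereal c < F l" for c
  proof -
    obtain i where i: "c < e i l" using sup[OF c] by blast
    have "((\<lambda>k. e i ((m \<circ> r) k)) \<longlongrightarrow> e i l) sequentially"
      using r(2) cont[of UNIV i] by (intro isCont_tendsto_compose[of l "e i" "m \<circ> r"]) (auto simp: continuous_on_eq_continuous_at)
    then have "\<forall>\<^sub>F k in sequentially. c < e i (m (r k))"
      using i by (auto dest: order_tendstoD(1))
    then show ?thesis using eventually_ge_at_top[of i]
    proof eventually_elim
      case (elim k)
      have "i \<le> r k" using elim(2) seq_suble[OF r(1), of k] by simp
      then show ?case using elim(1) mono[of i "r k" "m (r k)"] by linarith
    qed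
  qed
  have mr: "(\<lambda>k. m (r k)) \<longlonglongrightarrow> l" using r(2) by (simp add: comp_def)
  have bound: "c \<le> l \<bullet> x - \<delta> / 2 * (l \<bullet> l)" if c: "ereal c < F l" for c
  proof -
    have "((\<lambda>k. m (r k) \<bullet> x - \<delta> / 2 * (m (r k) \<bullet> m (r k))) \<longlongrightarrow> l \<bullet> x - \<delta> / 2 * (l \<bullet> l)) sequentially"
      by (intro tendsto_intros mr)
    moreover have "\<forall>\<^sub>F k in sequentially. c \<le> m (r k) \<bullet> x - \<delta> / 2 * (m (r k) \<bullet> m (r k))"
      using ev[OF c]
    proof eventually_elim
      case (elim k)
      then show ?case using pos[of "r k"] by (simp add: \<Phi>_def)
    qed
    ultimately show ?thesis by (intro tendsto_lowerbound) auto
  qed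
  have "F l \<le> ereal (l \<bullet> x - \<delta> / 2 * (l \<bullet> l))"
  proof (rule dense_le)
    fix c assume "c < F l"
    then show "c \<le> ereal (l \<bullet> x - \<delta> / 2 * (l \<bullet> l))" using bound by (cases c) auto
  qed
  \<comment> \<open>The bound just shown excludes plus infinity, and \<open>J\<close> excludes minus
    infinity.\<close>
  then obtain v where v: "F l = ereal v" using J[of l] by (cases "F l") auto
  have vJ: "l \<bullet> x - v \<le> J" using J[of l] v by simp
  have lJ: "\<delta> / 2 * (l \<bullet> l) \<le> J"
    using \<open>F l \<le> _\<close> v vJ by simp
  have "(\<delta> * norm l)\<^sup>2 = \<delta> * (2 * (\<delta> / 2 * (l \<bullet> l)))"
    by (simp add: power_mult_distrib power2_norm_eq_inner) (simp add: power2_eq_square)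
  also have "\<dots> \<le> \<delta> * (2 * J)" using lJ \<delta> by (intro mult_left_mono) auto
  also have "\<dots> < \<epsilon>\<^sup>2" by (rule \<delta>J)
  finally have "\<delta> * norm l < \<epsilon>" using eps by (rule power2_less_imp_less[OF _ less_imp_le])
  moreover have "((\<lambda>k. \<delta> * norm (m (r k))) \<longlongrightarrow> \<delta> * norm l) sequentially"
    by (intro tendsto_intros mr)
  ultimately have "\<forall>\<^sub>F k in sequentially. \<delta> * norm (m (r k)) < \<epsilon>"
    by (auto dest: order_tendstoD(2))
  moreover have "\<forall>\<^sub>F k in sequentially. v - \<epsilon> / 2 < e (r k) (m (r k))"
    using eps by (intro ev) (simp add: v)
  moreover have "\<forall>\<^sub>F k in sequentially. m (r k) \<bullet> x < l \<bullet> x + \<epsilon> / 2"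
    by (rule order_tendstoD(2)[OF tendsto_inner[OF mr tendsto_const]]) (use eps in simp)
  ultimately have "\<forall>\<^sub>F k in sequentially. \<delta> * norm (m (r k)) < \<epsilon> \<and> v - \<epsilon> / 2 < e (r k) (m (r k))
      \<and> m (r k) \<bullet> x < l \<bullet> x + \<epsilon> / 2"
    by eventually_elim simp
  then obtain k where k: "\<delta> * norm (m (r k)) < \<epsilon>" "v - \<epsilon> / 2 < e (r k) (m (r k))" "m (r k) \<bullet> x < l \<bullet> x + \<epsilon> / 2"
    by (auto simp: eventually_sequentially)
  show ?thesis
  proof (intro exI conjI)
    show "dist x (g (r k) (m (r k))) < \<epsilon>" using k(1) \<delta> by (simp add: grad dist_norm)
    have "m (r k) \<bullet> g (r k) (m (r k)) \<le> m (r k) \<bullet> x"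
      using \<delta> by (simp add: grad inner_diff_right)
    then show "m (r k) \<bullet> g (r k) (m (r k)) - e (r k) (m (r k)) \<le> J + \<epsilon>"
      using k vJ by linarith
  qed
qed

section \<open>Independent vectors and their restriction to balls\<close>

locale iid_weighted = prob_space M for M :: "'a measure" +
  fixes X :: "nat \<Rightarrow> 'a \<Rightarrow> 'v::euclidean_space" and f :: "real \<Rightarrow> real"
  assumes X_meas: "\<And>i. i \<ge> 1 \<Longrightarrow> X i \<in> borel_measurable M"
    and indep: "indep_vars (\<lambda>_. borel) X {1..}"
    and ident: "\<And>i. i \<ge> 1 \<Longrightarrow> distr M borel (X i) = distr M borel (X 1)"
    and zero_int: "0 \<in> interior (domL M (X 1))"
    and f_cont: "continuous_on {0..1} f"
begin

abbreviation "Y \<equiv> X (Suc 0)"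

lemma X1_meas [measurable]: "Y \<in> borel_measurable M"
  using X_meas[of 1] by simp

sublocale base: weighted_moments M "Y" f
  using zero_int by unfold_locales (auto simp: emeasure_space_1 f_cont)

text \<open>Left unnormalised, so that the transform of \<open>Y\<close> under it is the expectation
  of \<open>exp (u \<bullet> Y)\<close> on the event \<open>Y \<in> A\<close>, which increases with
  \<open>A\<close>.\<close>

definition trunc :: "'v set \<Rightarrow> 'a measure" where
  "trunc A = density M (\<lambda>\<omega>. indicator A (Y \<omega>))"

text \<open>The law of the weighted mean restricted to the event that the first \<open>n\<close> vectors all lie in \<open>A\<close>
  (not normalised).\<close>
definition tdist :: "'v set \<Rightarrow> nat \<Rightarrow> 'v measure" where
  "tdist A n = distr (density M (\<lambda>\<omega>. \<Prod>k\<in>{1..n}. indicator A (X k \<omega>))) borel (wmean X f n)"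

lemma wmean_meas [measurable]: "wmean X f n \<in> borel_measurable M"
  unfolding wmean_def by (intro borel_measurable_scaleR borel_measurable_sum borel_measurable_const X_meas) auto

lemma lapl_trunc:
  assumes [measurable]: "A \<in> sets borel"
  shows "lapl (trunc A) Y u = (\<integral>\<^sup>+ \<omega>. indicator A (Y \<omega>) * ennreal (exp (u \<bullet> Y \<omega>)) \<partial>M)"
  unfolding lapl_def trunc_def by (subst nn_integral_density) auto

lemma ident_nn_integral:
  assumes "i \<ge> 1" and [measurable]: "h \<in> borel_measurable borel"
  shows "(\<integral>\<^sup>+ \<omega>. h (X i \<omega>) \<partial>M) = (\<integral>\<^sup>+ \<omega>. h (Y \<omega>) \<partial>M)"
proof -
  have "(\<integral>\<^sup>+ \<omega>. h (X i \<omega>) \<partial>M) = nn_integral (distr M borel (X i)) h"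
    using X_meas[OF assms(1)] by (subst nn_integral_distr) auto
  also have "\<dots> = nn_integral (distr M borel (X 1)) h" using ident[OF assms(1)] by simp
  also have "\<dots> = (\<integral>\<^sup>+ \<omega>. h (Y \<omega>) \<partial>M)"
    by (subst nn_integral_distr) auto
  finally show ?thesis .
qed

lemma prod_indicator_meas:
  assumes [measurable]: "A \<in> sets borel"
  shows "(\<lambda>\<omega>. \<Prod>k\<in>{1..n}. indicator A (X k \<omega>) :: ennreal) \<in> borel_measurable M"
proof (rule borel_measurable_prod_ennreal)
  fix k assume "k \<in> {1..n}"
  then have [measurable]: "X k \<in> borel_measurable M" using X_meas by auto
  show "(\<lambda>\<omega>. indicator A (X k \<omega>) :: ennreal) \<in> borel_measurable M" by measurable
qed

text \<open>The indicator of the restricting event factorises over \<open>k\<close>, so independence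
  still yields a product.\<close>

lemma tdist_mgf:
  assumes A [measurable]: "A \<in> sets borel" and n: "n \<ge> 1"
  shows "(\<integral>\<^sup>+ z. ennreal (exp (real n * (l \<bullet> z))) \<partial>tdist A n) =
    (\<Prod>k\<in>{1..n}. lapl (trunc A) Y (f (real k / real n) *\<^sub>R l))"
proof -
  note prod_indicator_meas[OF A, measurable]
  let ?h = "\<lambda>k x. indicator A x * ennreal (exp ((f (real k / real n) *\<^sub>R l) \<bullet> x))"
  have h: "?h k \<in> borel_measurable borel" for k by measurable
  have "(\<integral>\<^sup>+ z. ennreal (exp (real n * (l \<bullet> z))) \<partial>tdist A n) =
     (\<integral>\<^sup>+ \<omega>. (\<Prod>k\<in>{1..n}. indicator A (X k \<omega>)) * ennreal (exp (real n * (l \<bullet> wmean X f n \<omega>))) \<partial>M)"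
    unfolding tdist_def
    by (subst nn_integral_distr, simp, simp, rule nn_integral_density) measurable
  also have "\<dots> = (\<integral>\<^sup>+ \<omega>. (\<Prod>k\<in>{1..n}. ?h k (X k \<omega>)) \<partial>M)"
  proof (rule nn_integral_cong)
    fix \<omega>
    have "real n * (l \<bullet> wmean X f n \<omega>) = (\<Sum>k\<in>{1..n}. (f (real k / real n) *\<^sub>R l) \<bullet> X k \<omega>)"
      using n by (simp add: wmean_def inner_sum_right)
    then show "(\<Prod>k\<in>{1..n}. indicator A (X k \<omega>)) * ennreal (exp (real n * (l \<bullet> wmean X f n \<omega>))) = (\<Prod>k\<in>{1..n}. ?h k (X k \<omega>))"
      by (simp only: exp_sum[OF finite_atLeastAtMost] prod.distrib) (simp add: prod_ennreal)
  qed
  also have "\<dots> = (\<Prod>k\<in>{1..n}. \<integral>\<^sup>+ \<omega>. ?h k (X k \<omega>) \<partial>M)"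
  proof -
    have "indep_vars (\<lambda>_. borel) X {1..n}" by (rule indep_vars_subset[OF indep]) auto
    then have "indep_vars (\<lambda>_. borel) (\<lambda>k \<omega>. ?h k (X k \<omega>)) {1..n}"
      by (rule indep_vars_compose2[where M' = "\<lambda>_. borel" and N = "\<lambda>_. borel" and X = X and Y = ?h and I = "{1..n}"])
        (rule h)
    then show ?thesis
      by (intro indep_vars_nn_integral[where X = "\<lambda>k \<omega>. ?h k (X k \<omega>)" and I = "{1..n}"] finite_atLeastAtMost zero_le)
  qed
  also have "\<dots> = (\<Prod>k\<in>{1..n}. lapl (trunc A) Y (f (real k / real n) *\<^sub>R l))"
  proof (rule prod.cong[OF refl])
    fix k assume "k \<in> {1..n}"
    then have "k \<ge> 1" by simp
    then show "(\<integral>\<^sup>+ \<omega>. ?h k (X k \<omega>) \<partial>M) = lapl (trunc A) Y (f (real k / real n) *\<^sub>R l)"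
      unfolding lapl_trunc[OF A] by (rule ident_nn_integral[where h = "?h k", OF _ h])
  qed
  finally show ?thesis .
qed

text \<open>Used twice: with \<open>A = UNIV\<close> for the upper bound and with balls for the
  lower bound. The exponents are Riemann sums of a function continuous in \<open>t\<close>.\<close>

lemma tdist_mgf_limit:
  assumes A: "A \<in> sets borel" and wm: "weighted_moments (trunc A) Y f"
  shows "mgf_limit (tdist A) (weighted_moments.good (trunc A) Y f) (weighted_moments.E (trunc A) Y f)
    (\<lambda>n l. (\<Sum>k\<in>{1..n}. cgf (trunc A) Y (f (real k / real n) *\<^sub>R l)) / real n)"
proof -
  interpret t: weighted_moments "trunc A" "Y" f by (rule wm)
  show ?thesis
  proof (rule mgf_limit.intro)
    fix n
    have "emeasure (tdist A n) (space (tdist A n)) = (\<integral>\<^sup>+ \<omega>. (\<Prod>k\<in>{1..n}. indicator A (X k \<omega>)) \<partial>M)"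
      using prod_indicator_meas[OF A] unfolding tdist_def
      by (subst emeasure_distr) (auto simp: emeasure_density intro!: nn_integral_cong)
    also have "\<dots> \<le> (\<integral>\<^sup>+ \<omega>. 1 \<partial>M)"
      by (intro nn_integral_mono prod_le_1) (auto simp: indicator_def)
    also have "\<dots> < \<infinity>" by (simp add: emeasure_space_1)
    finally show "finite_measure (tdist A n)" by (intro finite_measureI) auto
    show "sets (tdist A n) = sets borel" by (simp add: tdist_def)
  next
    fix n :: nat and l assume n: "n \<ge> 1" and l: "l \<in> t.good"
    have "lapl (trunc A) Y (f (real k / real n) *\<^sub>R l) = ennreal (exp (t.K (f (real k / real n) *\<^sub>R l)))" if "k \<in> {1..n}" for k
    proof -
      have "f (real k / real n) *\<^sub>R l \<in> t.D"
        using that n by (intro t.interior_D t.goodD[OF l]) auto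
      then show ?thesis using t.lapl_eq t.K_eq t.L_pos by (simp del: inner_scaleR_left)
    qed
    then have "(\<integral>\<^sup>+ z. ennreal (exp (real n * (l \<bullet> z))) \<partial>tdist A n) = (\<Prod>k\<in>{1..n}. ennreal (exp (t.K (f (real k / real n) *\<^sub>R l))))"
      unfolding tdist_mgf[OF A n] by (intro prod.cong refl) auto
    also have "\<dots> = ennreal (exp (\<Sum>k\<in>{1..n}. t.K (f (real k / real n) *\<^sub>R l)))"
      by (simp add: prod_ennreal exp_sum)
    also have "\<dots> = ennreal (exp (real n * ((\<Sum>k\<in>{1..n}. t.K (f (real k / real n) *\<^sub>R l)) / real n)))"
      using n by simp
    finally show "(\<integral>\<^sup>+ z. ennreal (exp (real n * (l \<bullet> z))) \<partial>tdist A n) =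
        ennreal (exp (real n * ((\<Sum>k\<in>{1..n}. t.K (f (real k / real n) *\<^sub>R l)) / real n)))" .
  next
    fix l assume l: "l \<in> t.good"
    show "(\<lambda>n. (\<Sum>k\<in>{1..n}. t.K (f (real k / real n) *\<^sub>R l)) / real n) \<longlonglongrightarrow> t.E l"
      using riemann_sum_tendsto[OF t.K_comp_continuous[OF l]]
      by (simp add: t.E_def integral_unit[OF t.K_comp_continuous[OF l]])
  qed
qed

lemma measure_tdist_le:
  assumes A: "A \<in> sets borel" and B: "B \<in> sets borel"
  shows "measure (tdist A n) B \<le> prob {\<omega>\<in>space M. wmean X f n \<omega> \<in> B}"
proof -
  have "emeasure (tdist A n) B = (\<integral>\<^sup>+ \<omega>. (\<Prod>k\<in>{1..n}. indicator A (X k \<omega>)) * indicator (wmean X f n -` B \<inter> space M) \<omega> \<partial>M)"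
    using prod_indicator_meas[OF A] B unfolding tdist_def
    by (subst emeasure_distr) (auto simp: emeasure_density)
  also have "\<dots> \<le> (\<integral>\<^sup>+ \<omega>. 1 * indicator (wmean X f n -` B \<inter> space M) \<omega> \<partial>M)"
    by (intro nn_integral_mono mult_right_mono prod_le_1) (auto simp: indicator_def)
  also have "\<dots> = emeasure M {\<omega>\<in>space M. wmean X f n \<omega> \<in> B}"
    using measurable_sets[OF wmean_meas B] by (simp add: vimage_def Int_def conj_commute)
  finally show ?thesis
    unfolding measure_def by (rule enn2real_mono) (simp add: less_top[symmetric])
qed

lemma trunc_UNIV: "trunc UNIV = M" and measure_tdist_UNIV:
  "B \<in> sets borel \<Longrightarrow> measure (tdist UNIV n) B = prob {\<omega>\<in>space M. wmean X f n \<omega> \<in> B}"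
proof -
  have 1: "density M (\<lambda>_. 1) = M" by (rule density_1)
  show "trunc UNIV = M" by (simp add: trunc_def 1)
  assume B: "B \<in> sets borel"
  show "measure (tdist UNIV n) B = prob {\<omega>\<in>space M. wmean X f n \<omega> \<in> B}"
    using B by (simp add: tdist_def 1 measure_distr vimage_def Int_def conj_commute)
qed

lemma exists_truncation:
  obtains R0 where "emeasure M {\<omega>\<in>space M. Y \<omega> \<in> cball 0 R0} \<noteq> 0"
proof (rule ccontr)
  assume *: "\<not> thesis"
  have "AE \<omega> in M. \<omega> \<notin> {\<omega>\<in>space M. Y \<omega> \<in> cball 0 (real n)}" for n
  proof -
    have "{\<omega>\<in>space M. Y \<omega> \<in> cball 0 (real n)} \<in> null_sets M"
      using * that[of "real n"] by (intro null_setsI) (auto, measurable)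
    then show ?thesis by (rule AE_not_in)
  qed
  then have "AE \<omega> in M. \<forall>n. \<omega> \<notin> {\<omega>\<in>space M. Y \<omega> \<in> cball 0 (real n)}"
    by (simp add: AE_all_countable)
  then have "AE \<omega> in M. False"
  proof (rule AE_mp, intro AE_I2 impI)
    fix \<omega> assume \<omega>: "\<omega> \<in> space M" "\<forall>n. \<omega> \<notin> {\<omega>\<in>space M. Y \<omega> \<in> cball 0 (real n)}"
    obtain n where "norm (Y \<omega>) \<le> real n" using real_arch_simple by blast
    then show False using \<omega> by auto
  qed
  then show False by simp
qed

lemma trunc_weighted_moments:
  assumes nz: "emeasure M {\<omega>\<in>space M. Y \<omega> \<in> cball 0 R} \<noteq> 0"
  shows "weighted_moments (trunc (cball 0 R)) Y f"
    and "domL (trunc (cball 0 R)) Y = UNIV"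
proof -
  have ms: "(\<lambda>\<omega>. indicator (cball 0 R) (Y \<omega>) :: ennreal) \<in> borel_measurable M"
    by (rule measurable_compose[OF X1_meas borel_measurable_indicator]) simp
  have em: "emeasure (trunc (cball 0 R)) (space M) = emeasure M {\<omega>\<in>space M. Y \<omega> \<in> cball 0 R}"
  proof -
    have "emeasure (trunc (cball 0 R)) (space M) = (\<integral>\<^sup>+ \<omega>. indicator {\<omega>\<in>space M. Y \<omega> \<in> cball 0 R} \<omega> \<partial>M)"
      unfolding trunc_def emeasure_density[OF ms sets.top] by (rule nn_integral_cong) (simp add: indicator_def)
    moreover have "{\<omega>\<in>space M. Y \<omega> \<in> cball 0 R} \<in> sets M"
      using measurable_sets[OF X1_meas, of "cball 0 R"] by (simp add: vimage_def Int_def conj_commute)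
    ultimately show ?thesis by simp
  qed
  have "lapl (trunc (cball 0 R)) Y u < \<infinity>" for u
  proof -
    have "lapl (trunc (cball 0 R)) Y u \<le> (\<integral>\<^sup>+ \<omega>. ennreal (exp (norm u * R)) \<partial>M)"
      unfolding lapl_trunc[OF borel_closed[OF closed_cball]]
    proof (rule nn_integral_mono)
      fix \<omega>
      show "indicator (cball 0 R) (Y \<omega>) * ennreal (exp (u \<bullet> Y \<omega>)) \<le> ennreal (exp (norm u * R))"
      proof (cases "Y \<omega> \<in> cball 0 R")
        case True
        have "u \<bullet> Y \<omega> \<le> norm u * norm (Y \<omega>)" by (rule norm_cauchy_schwarz)
        also have "\<dots> \<le> norm u * R" using True by (intro mult_left_mono) auto
        finally show ?thesis using True by (simp add: ennreal_leI)
      qed simp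
    qed
    also have "\<dots> < \<infinity>" by (simp add: emeasure_space_1)
    finally show ?thesis .
  qed
  then show dom: "domL (trunc (cball 0 R)) Y = UNIV" by (auto simp: domL_def)
  have sp: "space (trunc (cball 0 R)) = space M" by (simp add: trunc_def)
  show "weighted_moments (trunc (cball 0 R)) Y f"
  proof (intro weighted_moments.intro exp_moments.intro finite_measureI exp_moments_axioms.intro weighted_moments_axioms.intro)
    show "emeasure (trunc (cball 0 R)) (space (trunc (cball 0 R))) \<noteq> \<infinity>" unfolding sp em by simp
    show "Y \<in> borel_measurable (trunc (cball 0 R))" by (simp add: trunc_def)
    show "emeasure (trunc (cball 0 R)) (space (trunc (cball 0 R))) \<noteq> 0" unfolding sp em by (rule nz)
    show "0 \<in> interior (domL (trunc (cball 0 R)) Y)" by (simp add: dom)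
    show "continuous_on {0..1} f" by (rule f_cont)
  qed
qed

lemma lapl_trunc_mono:
  "r \<le> s \<Longrightarrow> lapl (trunc (cball 0 r)) Y u \<le> lapl (trunc (cball 0 s)) Y u"
  unfolding lapl_trunc[OF borel_closed[OF closed_cball]]
  by (intro nn_integral_mono mult_right_mono) (auto simp: indicator_def)

text \<open>Monotone convergence, with an infinite limit allowed; thus the truncated functions
  detect points outside the domain as well.\<close>

lemma lapl_trunc_tendsto:
  "(\<lambda>j. lapl (trunc (cball 0 (real j + R0))) Y u) \<longlonglongrightarrow> lapl M Y u"
  unfolding lapl_trunc[OF borel_closed[OF closed_cball]] unfolding lapl_def
proof (rule nn_integral_LIMSEQ)
  let ?g = "\<lambda>j \<omega>. indicator (cball 0 (real j + R0)) (Y \<omega>) * ennreal (exp (u \<bullet> Y \<omega>))"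
  show "incseq ?g"
    by (intro incseq_SucI le_funI mult_right_mono) (auto simp: indicator_def)
  show "?g j \<in> borel_measurable M" for j
    by (rule measurable_compose[OF X1_meas, of "\<lambda>x. indicator (cball 0 (real j + R0)) x * ennreal (exp (u \<bullet> x))"])
      (intro borel_measurable_times_ennreal borel_measurable_indicator measurable_compose[OF _ measurable_ennreal]
        borel_measurable_continuous_onI continuous_intros, simp)
  fix \<omega>
  obtain n where n: "norm (Y \<omega>) - R0 \<le> real n" using real_arch_simple by blast
  have "\<forall>\<^sub>F j in sequentially. ?g j \<omega> = ennreal (exp (u \<bullet> Y \<omega>))"
    using eventually_ge_at_top[of n] by eventually_elim (use n in auto)
  then show "(\<lambda>j. ?g j \<omega>) \<longlonglongrightarrow> ennreal (exp (u \<bullet> Y \<omega>))" by (rule tendsto_eventually)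
qed

lemma ldp_lower:
  assumes B: "B \<in> sets borel"
  shows "- (INF x\<in>interior B. If M Y f x) \<le> liminf (\<lambda>n. lnp n (prob {\<omega>\<in>space M. wmean X f n \<omega> \<in> B}))"
proof -
  obtain R0 where R0: "emeasure M {\<omega>\<in>space M. Y \<omega> \<in> cball 0 R0} \<noteq> 0" by (rule exists_truncation)
  \<comment> \<open>Starting at radius \<open>R0\<close> makes every restricted measure nonzero,
    already for \<open>j = 0\<close>.\<close>
  define A where "A j = (cball 0 (real j + R0) :: 'v set)" for j :: nat
  have A_borel: "A j \<in> sets borel" for j by (simp add: A_def)
  have nz: "emeasure M {\<omega>\<in>space M. Y \<omega> \<in> A j} \<noteq> 0" for j
  proof
    assume "emeasure M {\<omega>\<in>space M. Y \<omega> \<in> A j} = 0"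
    moreover have "emeasure M {\<omega>\<in>space M. Y \<omega> \<in> cball 0 R0} \<le> emeasure M {\<omega>\<in>space M. Y \<omega> \<in> A j}"
      by (intro emeasure_mono) (auto simp: A_def)
    ultimately show False using R0 by simp
  qed
  have wm: "weighted_moments (trunc (A j)) Y f" and dom: "domL (trunc (A j)) Y = UNIV" for j
    using trunc_weighted_moments[of "real j + R0"] nz[of j] by (auto simp: A_def)
  define e where "e j = weighted_moments.E (trunc (A j)) Y f" for j
  define g where "g j = weighted_moments.gE (trunc (A j)) Y f" for j
  define k where "k j = cgf (trunc (A j)) Y" for j
  have good: "weighted_moments.good (trunc (A j)) Y f = UNIV" for j
    by (simp add: weighted_moments.good_def[OF wm] dom)
  have exp_mom: "exp_moments (trunc (A j)) Y" for j
    using wm by (rule weighted_moments.axioms)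
  have der: "(e j has_derivative (\<lambda>h. g j l \<bullet> h)) (at l)" for j l
    unfolding e_def g_def by (rule weighted_moments.E_has_derivative[OF wm]) (simp add: good)
  let ?L = "\<lambda>j. lapl (trunc (A j)) Y"
  have L0: "?L j u \<noteq> 0" "?L j u < \<infinity>" for j u
    using exp_moments.lapl_pos[OF exp_mom] dom[of j] unfolding domL_def by blast+
  have L_mono: "i \<le> j \<Longrightarrow> ?L i u \<le> ?L j u" for i j u
    unfolding A_def by (intro lapl_trunc_mono) simp
  have Lr_pos: "0 < enn2real (?L j u)" for j u
    using L0[of j u] by (simp add: enn2real_positive_iff zero_less_iff_neq_zero)
  have k_mono: "k i u \<le> k j u" if "i \<le> j" for i j u
    unfolding k_def cgf_def using that L_mono[OF that, of u] L0[of j u] Lr_pos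
    by (subst ln_le_cancel_iff) (auto intro!: enn2real_mono)
  have kcont: "continuous_on {0..1} (\<lambda>t. k j (f t *\<^sub>R l))" for j l
    unfolding k_def by (rule weighted_moments.K_comp_continuous[OF wm]) (simp add: good)
  have kint: "integrable lborel01 (\<lambda>t. k j (f t *\<^sub>R l))" for j l
    by (rule integrable_unit[OF kcont])
  have e_eq: "e j l = (\<integral>t. k j (f t *\<^sub>R l) \<partial>lborel01)" for j l
    by (simp add: e_def k_def weighted_moments.E_def[OF wm])
  have mono: "e i l \<le> e j l" if "i \<le> j" for i j l
    unfolding e_eq by (intro Bochner_Integration.integral_mono kint k_mono that)
  have zero: "e j 0 \<le> 0" for j
  proof -
    have "?L j 0 \<le> (\<integral>\<^sup>+ \<omega>. 1 \<partial>M)"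
      unfolding lapl_trunc[OF A_borel] by (intro nn_integral_mono) (auto simp: indicator_def)
    then have "enn2real (?L j 0) \<le> 1"
      using enn2real_mono[of "?L j 0" 1] by (simp add: emeasure_space_1)
    then have "k j 0 \<le> 0" unfolding k_def cgf_def using Lr_pos[of j 0] by simp
    moreover have "e j 0 = k j 0" by (simp add: e_eq measure_lborel01)
    ultimately show ?thesis by simp
  qed
  have sub: "e 0 0 + g 0 0 \<bullet> l \<le> e 0 l" for l
    using weighted_moments.E_tangent[OF wm[of 0], of 0 l] by (simp add: e_def g_def good)
  \<comment> \<open>Subtracting \<open>k 0\<close> makes the sequence nonnegative, so the limit can
    be taken in \<open>ennreal\<close>, where infinity outside \<open>D\<close> is an ordinary
    value.\<close>
  have k_lim: "(\<lambda>j. ennreal (k j u - k 0 u)) \<longlonglongrightarrow> e2ennreal (cgf_ext M Y u - ereal (k 0 u))" for u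
  proof -
    have lim: "(\<lambda>j. ?L j u) \<longlonglongrightarrow> lapl M Y u"
      unfolding A_def by (rule lapl_trunc_tendsto)
    show ?thesis
    proof (cases "u \<in> base.D")
      case True
      have "(\<lambda>j. enn2real (?L j u)) \<longlonglongrightarrow> base.L u"
        using lim base.L_pos[OF True] unfolding base.lapl_eq[OF True] by (intro tendsto_enn2real) auto
      then have "(\<lambda>j. k j u) \<longlonglongrightarrow> base.K u"
        unfolding k_def cgf_def[of "trunc _"] base.K_eq[OF True] using base.L_pos[OF True] by (intro tendsto_ln) auto
      then have "(\<lambda>j. ennreal (k j u - k 0 u)) \<longlonglongrightarrow> ennreal (base.K u - k 0 u)"
        by (intro tendsto_intros)
      then show ?thesis using True by (simp add: cgf_ext_def e2ennreal_ereal)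
    next
      case False
      then have top: "lapl M Y u = top" by (simp add: domL_def less_top[symmetric])
      have "(\<lambda>j. ennreal (enn2real (?L j u))) \<longlonglongrightarrow> top"
        using lim L0(2) by (simp add: top less_top ennreal_enn2real)
      then have "filterlim (\<lambda>j. enn2real (?L j u)) at_top sequentially"
        by (simp add: ennreal_tendsto_top_eq_at_top)
      then have "filterlim (\<lambda>j. k j u) at_top sequentially"
        unfolding k_def cgf_def by (rule filterlim_compose[OF ln_at_top])
      then have "filterlim (\<lambda>j. - k 0 u + k j u) at_top sequentially"
        by (rule filterlim_tendsto_add_at_top[OF tendsto_const])
      then have "(\<lambda>j. ennreal (- k 0 u + k j u)) \<longlonglongrightarrow> top"
        by (simp add: ennreal_tendsto_top_eq_at_top)
      then show ?thesis using False by (simp add: cgf_ext_def e2ennreal_infty)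
    qed
  qed
  have k_le: "ereal (k 0 u) \<le> cgf_ext M Y u" for u
  proof (cases "u \<in> base.D")
    case True
    have "?L 0 u \<le> lapl M Y u"
      unfolding lapl_trunc[OF A_borel] unfolding lapl_def by (intro nn_integral_mono) (auto simp: indicator_def)
    then have "enn2real (?L 0 u) \<le> enn2real (lapl M Y u)"
      using True by (intro enn2real_mono) (auto simp: domL_def)
    then have "k 0 u \<le> base.K u" unfolding k_def cgf_def using Lr_pos[of 0 u] by (subst ln_le_cancel_iff) auto
    then show ?thesis using True by (simp add: cgf_ext_def)
  qed (simp add: cgf_ext_def)
  \<comment> \<open>If all \<open>e j l\<close> were at most \<open>c\<close>, monotone convergence
    above the common minorant \<open>k 0\<close> would give
    \<open>Ef M Y f l \<le> c\<close>.\<close>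
  have sup: "\<exists>j. c < e j l" if c: "ereal c < Ef M Y f l" for c l
  proof (rule ccontr)
    assume "\<nexists>j. c < e j l"
    then have le: "e j l \<le> c" for j by (auto simp: not_less)
    let ?h = "\<lambda>j t. ennreal (k j (f t *\<^sub>R l) - k 0 (f t *\<^sub>R l))"
    have "(\<lambda>j. \<integral>\<^sup>+ t. ?h j t \<partial>lborel01) \<longlonglongrightarrow>
       (\<integral>\<^sup>+ t. e2ennreal (cgf_ext M Y (f t *\<^sub>R l) - ereal (k 0 (f t *\<^sub>R l))) \<partial>lborel01)"
    proof (rule nn_integral_LIMSEQ)
      show "incseq ?h" by (intro incseq_SucI le_funI ennreal_leI diff_right_mono k_mono) simp
      show "?h j \<in> borel_measurable lborel01" for j
        using borel_measurable_integrable[OF kint] by measurable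
      show "(\<lambda>j. ?h j t) \<longlonglongrightarrow> e2ennreal (cgf_ext M Y (f t *\<^sub>R l) - ereal (k 0 (f t *\<^sub>R l)))" for t
        by (rule k_lim)
    qed
    moreover have "(\<integral>\<^sup>+ t. ?h j t \<partial>lborel01) \<le> ennreal (c - e 0 l)" for j
    proof -
      have "(\<integral>\<^sup>+ t. ?h j t \<partial>lborel01) = ennreal (\<integral>t. k j (f t *\<^sub>R l) - k 0 (f t *\<^sub>R l) \<partial>lborel01)"
        by (intro nn_integral_eq_integral Bochner_Integration.integrable_diff kint AE_I2) (simp add: k_mono)
      also have "\<dots> = ennreal (e j l - e 0 l)" by (simp add: e_eq kint)
      also have "\<dots> \<le> ennreal (c - e 0 l)" using le[of j] by (intro ennreal_leI) simp
      finally show ?thesis .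
    qed
    ultimately have "(\<integral>\<^sup>+ t. e2ennreal (cgf_ext M Y (f t *\<^sub>R l) - ereal (k 0 (f t *\<^sub>R l))) \<partial>lborel01) \<le> ennreal (c - e 0 l)"
      by (intro LIMSEQ_le_const2) auto
    then have "enn2ereal (\<integral>\<^sup>+ t. e2ennreal (cgf_ext M Y (f t *\<^sub>R l) - ereal (k 0 (f t *\<^sub>R l))) \<partial>lborel01) \<le> ereal (c - e 0 l)"
      using le[of 0] by (simp add: less_eq_ennreal.rep_eq enn2ereal_ennreal)
    then have "Ef M Y f l \<le> ereal (c - e 0 l) + ereal (e 0 l)"
      unfolding base.Ef_split[of "\<lambda>t. k 0 (f t *\<^sub>R l)" l, OF kint k_le] e_eq by (rule add_right_mono)
    then show False using c by simp
  qed
  let ?p = "\<lambda>n. prob {\<omega>\<in>space M. wmean X f n \<omega> \<in> B}"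
  have main: "- ereal J \<le> liminf (\<lambda>n. lnp n (?p n))"
    if x: "x \<in> interior B" and J: "If M Y f x = ereal J" for x J
  proof -
    obtain r where r: "r > 0" "ball x r \<subseteq> B" using x by (auto simp: mem_interior)
    have "ereal (- J - d) \<le> liminf (\<lambda>n. lnp n (?p n))" if d: "d > 0" for d
    proof -
      \<comment> \<open>Each budget is charged twice: \<open>r\<close> by the shift to
        \<open>g j l\<close> and the ball around it, \<open>d\<close> by the dual point and by the
        ball estimate.\<close>
      define \<epsilon> where "\<epsilon> = min (r / 2) (d / 2)"
      have \<epsilon>: "\<epsilon> > 0" "2 * \<epsilon> \<le> r" "2 * \<epsilon> \<le> d" using r d by (auto simp: \<epsilon>_def)
      have Jl: "ereal (l \<bullet> x) - Ef M Y f l \<le> ereal J" for l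
        unfolding J[symmetric] If_def by (rule SUP_upper) simp
      obtain j l where jl: "dist x (g j l) < \<epsilon>" "l \<bullet> g j l - e j l \<le> J + \<epsilon>"
        using approximate_dual_point[OF der mono zero sub sup Jl \<epsilon>(1)] by blast
      interpret t: mgf_limit "tdist (A j)" UNIV "e j"
          "\<lambda>n l. (\<Sum>k\<in>{1..n}. cgf (trunc (A j)) Y (f (real k / real n) *\<^sub>R l)) / real n"
        using tdist_mgf_limit[OF A_borel wm[of j]] by (simp add: good e_def)
      have sub: "ball (g j l) \<epsilon> \<subseteq> B"
      proof
        fix z assume "z \<in> ball (g j l) \<epsilon>"
        then have "dist x z < 2 * \<epsilon>" using jl(1) dist_triangle[of x z "g j l"] by simp
        then show "z \<in> B" using \<epsilon> r by auto
      qed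
      have "\<forall>\<^sub>F n in sequentially. ereal (- J - d) \<le> lnp n (?p n)"
        using t.tilted_ball_lower[OF refl der \<epsilon>(1) \<epsilon>(1), of l] eventually_ge_at_top[of 1]
      proof eventually_elim
        case (elim n)
        have "measure (tdist (A j) n) (ball (g j l) \<epsilon>) \<le> measure (tdist (A j) n) B"
          using sub B t.sets_P by (intro finite_measure.finite_measure_mono[OF t.fin]) auto
        also have "\<dots> \<le> ?p n" by (rule measure_tdist_le[OF A_borel B])
        finally have p: "exp (- real n * (l \<bullet> g j l - e j l + \<epsilon>)) \<le> ?p n" using elim(1) by simp
        have "exp (- real n * (J + d)) \<le> exp (- real n * (l \<bullet> g j l - e j l + \<epsilon>))"
          using jl(2) \<epsilon> by (simp add: mult_left_mono)
        then have p': "exp (- real n * (J + d)) \<le> ?p n" using p by linarith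
        then have pos: "?p n > 0" using exp_gt_zero less_le_trans by blast
        then have "- real n * (J + d) \<le> ln (?p n)" using p' by (simp add: ln_ge_iff)
        then show ?case using pos elim(2) by (simp add: lnp_def field_simps)
      qed
      then show ?thesis by (rule Liminf_bounded)
    qed
    then have "\<forall>\<^sub>F d in at_right 0. ereal (- J - d) \<le> liminf (\<lambda>n. lnp n (?p n))"
      by (intro eventually_at_rightI[of 0 1]) auto
    moreover have "((\<lambda>d. ereal (- J - d)) \<longlongrightarrow> ereal (- J - 0)) (at_right 0)" by (intro tendsto_intros)
    ultimately have "ereal (- J - 0) \<le> liminf (\<lambda>n. lnp n (?p n))" by (intro tendsto_upperbound) auto
    then show ?thesis by simp
  qed
  have "- If M Y f x \<le> liminf (\<lambda>n. lnp n (?p n))" if "x \<in> interior B" for x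
  proof (cases "If M Y f x")
    case (real J) then show ?thesis using main[OF that] by simp
  next
    case MInf
    \<comment> \<open>The term \<open>l = 0\<close> is finite, so the rate function never takes the
      value minus infinity.\<close>
    have "ereal (0 \<bullet> x) - Ef M Y f 0 \<le> If M Y f x"
      unfolding If_def by (rule SUP_upper) simp
    then show ?thesis using MInf by (simp add: base.Ef_good[OF base.zero_good])
  qed simp
  then have "- liminf (\<lambda>n. lnp n (?p n)) \<le> If M Y f x" if "x \<in> interior B" for x
    using that by (simp add: ereal_uminus_le_reorder)
  then have "- liminf (\<lambda>n. lnp n (?p n)) \<le> (INF x\<in>interior B. If M Y f x)" by (rule INF_greatest)
  then show ?thesis by (simp add: ereal_uminus_le_reorder)
qed

lemma K_zero: "base.K 0 = 0"
  by (simp add: cgf_def lapl_def emeasure_space_1)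

lemma If_closed: "closed {x. If M Y f x \<le> c}"
proof -
  have "{x. If M Y f x \<le> c} = (\<Inter>l\<in>base.good. {x. ereal (l \<bullet> x - base.E l) \<le> c})"
    unfolding base.If_eq_SUP_good[OF K_zero] by (auto simp: SUP_le_iff)
  moreover have "closed {x. ereal (l \<bullet> x - base.E l) \<le> c}" for l
    by (cases c) (auto intro!: closed_Collect_le continuous_intros)
  ultimately show ?thesis by auto
qed

lemma If_compact: "compact {x. If M Y f x \<le> ereal c}"
proof -
  obtain d where d: "d > 0" "cball 0 d \<subseteq> base.good"
    using base.open_good base.zero_good by (auto simp: open_contains_cball)
  define C where "C = (\<Sum>i\<in>(Basis::'v set). (\<bar>base.E (d *\<^sub>R i) + c\<bar> + \<bar>base.E ((- d) *\<^sub>R i) + c\<bar>) / d)"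
  have "norm z \<le> C" if z: "If M Y f z \<le> ereal c" for z
    unfolding C_def
  proof (rule norm_le_coordinate_bounds[OF d(1)])
    fix i :: 'v assume i: "i \<in> Basis"
    have *: "l \<bullet> z \<le> base.E l + c" if "l \<in> base.good" for l
    proof -
      have "ereal (l \<bullet> z - base.E l) \<le> ereal c"
        using z that unfolding base.If_eq_SUP_good[OF K_zero] by (meson SUP_le_iff)
      then show ?thesis by simp
    qed
    have "d *\<^sub>R i \<in> base.good" "(- d) *\<^sub>R i \<in> base.good" using i d by (auto intro!: subsetD[OF d(2)])
    then show "d *\<^sub>R i \<bullet> z \<le> base.E (d *\<^sub>R i) + c" "(- d) *\<^sub>R i \<bullet> z \<le> base.E ((- d) *\<^sub>R i) + c"
      using * by blast+
  qed
  then have "bounded {x. If M Y f x \<le> ereal c}" unfolding bounded_iff by blast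
  then show ?thesis using If_closed by (simp add: compact_eq_bounded_closed)
qed

lemma ldp_wmean: "ldp M (wmean X f) (If M Y f)"
  unfolding ldp_def
proof (intro conjI allI ballI If_closed If_compact ldp_lower)
  fix B :: "'v set" assume B: "B \<in> sets borel"
  interpret t: mgf_limit "tdist UNIV" base.good base.E
      "\<lambda>n l. (\<Sum>k\<in>{1..n}. cgf M Y (f (real k / real n) *\<^sub>R l)) / real n"
    using tdist_mgf_limit[of UNIV] base.weighted_moments_axioms by (simp add: trunc_UNIV)
  have "0 \<in> interior base.good" using base.zero_good by (simp add: interior_open[OF base.open_good])
  from t.ldp_upper[OF this B]
  show "limsup (\<lambda>n. lnp n (prob {\<omega>\<in>space M. wmean X f n \<omega> \<in> B})) \<le> - (INF x\<in>closure B. If M Y f x)"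
    by (simp add: measure_tdist_UNIV[OF B] base.If_eq_SUP_good[OF K_zero])
qed

end

section \<open>Gradients and the integral formula\<close>

lemma grad_eqI:
  fixes F :: "'v::euclidean_space \<Rightarrow> real"
  assumes "(F has_derivative (\<lambda>h. g \<bullet> h)) (at x)"
  shows "grad F x = g"
  unfolding grad_def
proof (rule some_equality)
  show "(F has_derivative (\<lambda>h. g \<bullet> h)) (at x)" by (rule assms)
  fix g' assume "(F has_derivative (\<lambda>h. g' \<bullet> h)) (at x)"
  then have "(\<lambda>h. g' \<bullet> h) = (\<lambda>h. g \<bullet> h)" using assms by (rule has_derivative_unique)
  then have "(g' - g) \<bullet> (g' - g) = 0" by (simp add: inner_diff_left fun_eq_iff)
  then show "g' = g" by simp
qed

text \<open>If \<open>h \<bullet> Y\<close> were almost surely constant, small balls off a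
  hyperplane would have probability 0, and the support would lie in that hyperplane, of dimension
  one too small.\<close>

lemma (in prob_space) full_support_nondegenerate:
  fixes Y :: "'a \<Rightarrow> 'v::euclidean_space"
  assumes [measurable]: "Y \<in> borel_measurable M"
    and dim: "aff_dim (law_support M Y) = int DIM('v)" and h: "h \<noteq> 0"
  shows "\<not> (AE \<omega> in M. h \<bullet> Y \<omega> = c)"
proof
  assume ae: "AE \<omega> in M. h \<bullet> Y \<omega> = c"
  have "law_support M Y \<subseteq> {x. h \<bullet> x = c}"
  proof (rule subsetI, rule ccontr)
    fix x assume x: "x \<in> law_support M Y" "x \<notin> {x. h \<bullet> x = c}"
    have "open (- {x. h \<bullet> x = c})" by (intro open_Compl closed_hyperplane)
    then obtain e where e: "e > 0" "ball x e \<subseteq> - {x. h \<bullet> x = c}"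
      using x(2) by (meson ComplI open_contains_ball)
    have "AE \<omega> in M. \<omega> \<notin> {\<omega>\<in>space M. Y \<omega> \<in> ball x e}"
      using ae by eventually_elim (use e in auto)
    then have "prob {\<omega>\<in>space M. Y \<omega> \<in> ball x e} = 0"
      by (subst prob_eq_0) (auto, measurable)
    moreover have "0 < prob {\<omega>\<in>space M. Y \<omega> \<in> ball x e}"
      using x(1) e(1) unfolding law_support_def by blast
    ultimately show False by (simp only: less_irrefl)
  qed
  then have "aff_dim (law_support M Y) \<le> aff_dim {x. h \<bullet> x = c}" by (rule aff_dim_subset)
  then show False using dim h by (simp add: aff_dim_hyperplane)
qed

context exp_moments
begin

lemma grad_K: "u \<in> interior D \<Longrightarrow> grad K u = tmean u"
  by (rule grad_eqI[OF K_has_derivative])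

text \<open>Young's equality: by the tangent inequality at \<open>u\<close>, the supremum is
  attained at \<open>u\<close>.\<close>

lemma cramer_tmean:
  assumes u: "u \<in> interior D"
  shows "cramer M Y (tmean u) = ereal (u \<bullet> tmean u - K u)"
  unfolding cramer_def
proof (rule antisym)
  show "(SUP v\<in>D. ereal (v \<bullet> tmean u - K v)) \<le> ereal (u \<bullet> tmean u - K u)"
    using K_tangent[OF u] by (intro SUP_least) (simp add: inner_diff_right inner_commute algebra_simps)
  show "ereal (u \<bullet> tmean u - K u) \<le> (SUP v\<in>D. ereal (v \<bullet> tmean u - K v))"
    using interior_D[OF u] by (rule SUP_upper)
qed

end

section \<open>Young's equality for the integrated function and injectivity of its gradient\<close>

locale normalized_moments = weighted_moments M Y f
  for M :: "'a measure" and Y :: "'a \<Rightarrow> 'v::euclidean_space" and f +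
  assumes K_zero: "cgf M Y 0 = 0"
begin

lemma H_nonneg:
  assumes "u \<in> interior D"
  shows "0 \<le> u \<bullet> tmean u - K u"
  using K_tangent[OF assms zero_in_D] by (simp add: K_zero inner_commute)

lemma integral_H:
  assumes l: "l \<in> good"
  shows "integrable lborel01 (\<lambda>t. (f t *\<^sub>R l) \<bullet> tmean (f t *\<^sub>R l) - K (f t *\<^sub>R l))"
    and "(\<integral>t. (f t *\<^sub>R l) \<bullet> tmean (f t *\<^sub>R l) - K (f t *\<^sub>R l) \<partial>lborel01) = l \<bullet> gE l - E l"
proof -
  note i = integrable_inner_right[OF gE_integrable[OF l], of l]
  note iK = integrable_unit[OF K_comp_continuous[OF l]]
  have eq: "(\<lambda>t. (f t *\<^sub>R l) \<bullet> tmean (f t *\<^sub>R l) - K (f t *\<^sub>R l)) =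
      (\<lambda>t. l \<bullet> (f t *\<^sub>R tmean (f t *\<^sub>R l)) - K (f t *\<^sub>R l))" by simp
  show "integrable lborel01 (\<lambda>t. (f t *\<^sub>R l) \<bullet> tmean (f t *\<^sub>R l) - K (f t *\<^sub>R l))"
    unfolding eq by (rule Bochner_Integration.integrable_diff[OF i iK])
  show "(\<integral>t. (f t *\<^sub>R l) \<bullet> tmean (f t *\<^sub>R l) - K (f t *\<^sub>R l) \<partial>lborel01) = l \<bullet> gE l - E l"
    unfolding eq Bochner_Integration.integral_diff[OF i iK] integral_inner_right[OF gE_integrable[OF l]]
    by (simp add: E_def gE_def)
qed

lemma nn_integral_H:
  assumes l: "l \<in> good"
  shows "enn2ereal (\<integral>\<^sup>+ t. ennreal ((f t *\<^sub>R l) \<bullet> tmean (f t *\<^sub>R l) - K (f t *\<^sub>R l)) \<partial>lborel01) = ereal (l \<bullet> gE l - E l)"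
proof -
  let ?h = "\<lambda>t. (f t *\<^sub>R l) \<bullet> tmean (f t *\<^sub>R l) - K (f t *\<^sub>R l)"
  have nn: "0 \<le> ?h t" if "t \<in> space lborel01" for t
    using that by (intro H_nonneg goodD[OF l]) simp
  have "(\<integral>\<^sup>+ t. ennreal (?h t) \<partial>lborel01) = ennreal (l \<bullet> gE l - E l)"
    unfolding integral_H(2)[OF l, symmetric]
    by (intro nn_integral_eq_integral integral_H l AE_I2 nn)
  moreover have "0 \<le> l \<bullet> gE l - E l"
    unfolding integral_H(2)[OF l, symmetric] by (intro Bochner_Integration.integral_nonneg_AE AE_I2 nn)
  ultimately show ?thesis by (simp add: enn2ereal_ennreal)
qed

text \<open>\<open>Ef_tangent\<close> bounds every competitor \<open>l'\<close>, including those
  where \<open>Ef\<close> is infinite.\<close>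

lemma If_gE:
  assumes l: "l \<in> good"
  shows "If M Y f (gE l) = ereal (l \<bullet> gE l - E l)"
  unfolding If_def
proof (rule antisym)
  show "(SUP l'. ereal (l' \<bullet> gE l) - Ef M Y f l') \<le> ereal (l \<bullet> gE l - E l)"
  proof (rule SUP_least)
    fix l' show "ereal (l' \<bullet> gE l) - Ef M Y f l' \<le> ereal (l \<bullet> gE l - E l)"
      using Ef_tangent[OF l, of l']
      by (cases "Ef M Y f l'") (auto simp: inner_diff_right inner_commute algebra_simps)
  qed
  have "ereal (l \<bullet> gE l - E l) = ereal (l \<bullet> gE l) - Ef M Y f l" by (simp add: Ef_good[OF l])
  also have "\<dots> \<le> (SUP l'. ereal (l' \<bullet> gE l) - Ef M Y f l')" by (rule SUP_upper) simp
  finally show "ereal (l \<bullet> gE l - E l) \<le> (SUP l'. ereal (l' \<bullet> gE l) - Ef M Y f l')" .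
qed

lemma If_gE_integral:
  assumes l: "l \<in> good"
  shows "If M Y f (gE l) = enn2ereal (\<integral>\<^sup>+ t. e2ennreal (cramer M Y (tmean (f t *\<^sub>R l))) \<partial>lborel01)"
proof -
  have "(\<integral>\<^sup>+ t. e2ennreal (cramer M Y (tmean (f t *\<^sub>R l))) \<partial>lborel01) =
     (\<integral>\<^sup>+ t. ennreal ((f t *\<^sub>R l) \<bullet> tmean (f t *\<^sub>R l) - K (f t *\<^sub>R l)) \<partial>lborel01)"
    by (intro nn_integral_cong) (simp add: cramer_tmean goodD[OF l] e2ennreal_ereal del: inner_scaleR_left)
  then show ?thesis by (simp only: nn_integral_H[OF l] If_gE[OF l])
qed

end

locale nondegenerate_moments = normalized_moments M Y f
  for M :: "'a measure" and Y :: "'a \<Rightarrow> 'v::euclidean_space" and f +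
  assumes nondeg: "\<And>h c. h \<noteq> 0 \<Longrightarrow> \<not> (AE \<omega> in M. h \<bullet> Y \<omega> = c)"
    and f_nz: "\<exists>t\<in>{0..1}. f t \<noteq> 0"
begin

text \<open>Equality would make a nonnegative continuous function of \<open>t\<close> vanish
  identically. At a \<open>t\<close> with \<open>f t \<noteq> 0\<close> the two arguments of
  \<open>K\<close> differ, and \<open>K_tangent_strict\<close> gives a contradiction.\<close>

lemma E_tangent_strict:
  assumes l: "l \<in> good" and l': "l' \<in> good" and ne: "l \<noteq> l'"
  shows "E l + gE l \<bullet> (l' - l) < E l'"
proof (rule ccontr)
  assume "\<not> ?thesis"
  then have eq: "E l + gE l \<bullet> (l' - l) = E l'" using E_tangent[OF l l'] by simp
  let ?d = "\<lambda>t. K (f t *\<^sub>R l') - K (f t *\<^sub>R l) - (f t *\<^sub>R tmean (f t *\<^sub>R l)) \<bullet> (l' - l)"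
  have i: "integrable lborel01 (\<lambda>t. K (f t *\<^sub>R l'))" "integrable lborel01 (\<lambda>t. K (f t *\<^sub>R l))"
      "integrable lborel01 (\<lambda>t. (f t *\<^sub>R tmean (f t *\<^sub>R l)) \<bullet> (l' - l))"
    using l l' by (auto intro!: integrable_unit[OF K_comp_continuous] integrable_inner_left[OF gE_integrable] simp del: inner_scaleR_left)
  have tan: "(f t *\<^sub>R tmean (f t *\<^sub>R l)) \<bullet> (l' - l) = tmean (f t *\<^sub>R l) \<bullet> (f t *\<^sub>R l' - f t *\<^sub>R l)" for t
    by (simp add: algebra_simps)
  have "(\<integral>t. ?d t \<partial>lborel01) = E l' - E l - gE l \<bullet> (l' - l)"
    unfolding E_def gE_def integral_inner_left[OF gE_integrable[OF l], symmetric]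
    using i by (simp del: inner_scaleR_left)
  then have "(\<integral>t. ?d t \<partial>lborel01) = 0" using eq by simp
  moreover have "AE t in lborel01. 0 \<le> ?d t"
  proof (rule AE_I2)
    fix t assume "t \<in> space lborel01"
    then have t: "t \<in> {0..1}" by simp
    show "0 \<le> ?d t" unfolding tan using K_tangent[OF goodD[OF l t] interior_D[OF goodD[OF l' t]]] by simp
  qed
  moreover have "integrable lborel01 ?d" using i by (intro Bochner_Integration.integrable_diff)
  ultimately have "AE t in lborel01. ?d t = 0" using integral_nonneg_eq_0_iff_AE by blast
  then have ae: "AE t in lborel01. ?d t \<in> {0}" by simp
  have cont: "continuous_on {0..1} ?d"
    by (intro continuous_intros f_cont K_comp_continuous tmean_comp_continuous l l')
  obtain t where t: "t \<in> {0..1}" "f t \<noteq> 0" using f_nz by blast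
  have "?d t = 0" using AE_unit_closed[OF ae cont closed_singleton t(1)] by simp
  moreover have "K (f t *\<^sub>R l) + tmean (f t *\<^sub>R l) \<bullet> (f t *\<^sub>R l' - f t *\<^sub>R l) < K (f t *\<^sub>R l')"
    using t ne l l' by (intro K_tangent_strict nondeg goodD interior_D) auto
  ultimately show False unfolding tan by simp
qed

text \<open>With equal gradients, the two strict tangent inequalities add up to a
  contradiction.\<close>

lemma gE_inj: "inj_on gE good"
proof (rule inj_onI, rule ccontr)
  fix l l' assume l: "l \<in> good" "l' \<in> good" "gE l = gE l'" "l \<noteq> l'"
  then show False
    using E_tangent_strict[OF l(1,2,4)] E_tangent_strict[OF l(2,1) l(4)[symmetric]]
    by (simp add: inner_diff_right)
qed

lemma Efr_has_derivative:
  assumes "l \<in> good"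
  shows "(Efr M Y f has_derivative (\<lambda>h. gE l \<bullet> h)) (at l)"
  by (rule has_derivative_transform_within_open[OF E_has_derivative[OF assms] open_good assms])
    (simp add: Efr_good)

lemma grad_Efr: "l \<in> good \<Longrightarrow> grad (Efr M Y f) l = gE l"
  by (rule grad_eqI[OF Efr_has_derivative])

lemma inj_on_grad_Efr: "inj_on (grad (Efr M Y f)) good"
  using gE_inj by (simp add: inj_on_def grad_Efr)

lemma If_grad_image:
  assumes "x \<in> grad (Efr M Y f) ` good"
  shows "If M Y f x = enn2ereal (\<integral>\<^sup>+ t\<in>{0..1}. e2ennreal (cramer M Y
     (grad (cgf M Y) (f t *\<^sub>R inv_into good (grad (Efr M Y f)) x))) \<partial>lborel)"
proof -
  obtain l where l: "l \<in> good" "x = grad (Efr M Y f) l" using assms by blast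
  have inv: "inv_into good (grad (Efr M Y f)) x = l"
    using inv_into_f_f[OF inj_on_grad_Efr l(1)] l(2) by simp
  have "If M Y f x = enn2ereal (\<integral>\<^sup>+ t. e2ennreal (cramer M Y (tmean (f t *\<^sub>R l))) \<partial>lborel01)"
    using If_gE_integral[OF l(1)] l by (simp add: grad_Efr)
  also have "(\<integral>\<^sup>+ t. e2ennreal (cramer M Y (tmean (f t *\<^sub>R l))) \<partial>lborel01) =
      (\<integral>\<^sup>+ t. e2ennreal (cramer M Y (grad K (f t *\<^sub>R l))) \<partial>lborel01)"
    by (intro nn_integral_cong) (simp add: grad_K goodD[OF l(1)])
  finally show ?thesis unfolding inv nn_integral_lborel01 .
qed

end

section \<open>The one-dimensional formula\<close>

text \<open>\<open>Lim\<close> is determined only along a nontrivial filter; this provides it when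
  \<open>Kd1\<close> and \<open>gbar\<close> are evaluated at an endpoint, finite or
  infinite.\<close>

lemma ereal_at_left_not_bot:
  fixes \<alpha> \<beta> :: ereal
  assumes "\<alpha> < \<beta>"
  shows "at_left \<beta> \<noteq> bot"
proof
  assume "at_left \<beta> = bot"
  then have "eventually (\<lambda>_. False) (at_left \<beta>)" by simp
  then obtain c where c: "c < \<beta>" "\<forall>y>c. y < \<beta> \<longrightarrow> False"
    using assms by (auto simp: eventually_at_left)
  then show False using dense[of c \<beta>] by blast
qed

lemma ereal_at_right_not_bot:
  fixes \<alpha> \<beta> :: ereal
  assumes "\<alpha> < \<beta>"
  shows "at_right \<alpha> \<noteq> bot"
proof
  assume "at_right \<alpha> = bot"
  then have "eventually (\<lambda>_. False) (at_right \<alpha>)" by simp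
  then obtain c where c: "c > \<alpha>" "\<forall>y>\<alpha>. y < c \<longrightarrow> False"
    using assms by (auto simp: eventually_at_right)
  then show False using dense[of \<alpha> c] by blast
qed

lemma mono_tendsto_at_left:
  fixes \<psi> :: "real \<Rightarrow> real" and \<alpha> \<beta> :: ereal
  assumes ab: "\<alpha> < \<beta>"
    and mono: "\<And>s r. \<alpha> < ereal s \<Longrightarrow> s \<le> r \<Longrightarrow> ereal r < \<beta> \<Longrightarrow> \<psi> s \<le> \<psi> r"
  shows "((\<lambda>y. ereal (\<psi> (real_of_ereal y))) \<longlongrightarrow> (SUP s\<in>{s. \<alpha> < ereal s \<and> ereal s < \<beta>}. ereal (\<psi> s))) (at_left \<beta>)"
    (is "(_ \<longlongrightarrow> ?V) _")
proof (rule order_tendstoI)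
  fix a assume "a < ?V"
  then obtain s where s: "\<alpha> < ereal s" "ereal s < \<beta>" "a < ereal (\<psi> s)" by (auto simp: less_SUP_iff)
  show "\<forall>\<^sub>F y in at_left \<beta>. a < ereal (\<psi> (real_of_ereal y))"
  proof (rule eventually_at_leftI[OF _ s(2)])
    fix y assume y: "y \<in> {ereal s<..<\<beta>}"
    then obtain r where r: "y = ereal r" by (cases y) auto
    then have "ereal (\<psi> s) \<le> ereal (\<psi> r)" using y s by (auto intro!: mono)
    then show "a < ereal (\<psi> (real_of_ereal y))" using s(3) r by (auto intro: less_le_trans)
  qed
next
  fix a assume a: "?V < a"
  show "\<forall>\<^sub>F y in at_left \<beta>. ereal (\<psi> (real_of_ereal y)) < a"
  proof (rule eventually_at_leftI[OF _ ab])
    fix y assume y: "y \<in> {\<alpha><..<\<beta>}"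
    then obtain r where r: "y = ereal r" by (cases y) auto
    have "ereal (\<psi> r) \<le> ?V"
      using y r by (intro SUP_upper) auto
    then show "ereal (\<psi> (real_of_ereal y)) < a" using a r by (auto intro: le_less_trans)
  qed
qed

lemma mono_tendsto_at_right:
  fixes \<psi> :: "real \<Rightarrow> real" and \<alpha> \<beta> :: ereal
  assumes ab: "\<alpha> < \<beta>"
    and mono: "\<And>s r. \<alpha> < ereal s \<Longrightarrow> s \<le> r \<Longrightarrow> ereal r < \<beta> \<Longrightarrow> \<psi> s \<le> \<psi> r"
  shows "((\<lambda>y. ereal (\<psi> (real_of_ereal y))) \<longlongrightarrow> (INF s\<in>{s. \<alpha> < ereal s \<and> ereal s < \<beta>}. ereal (\<psi> s))) (at_right \<alpha>)"
    (is "(_ \<longlongrightarrow> ?V) _")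
proof (rule order_tendstoI)
  fix a assume "?V < a"
  then obtain s where s: "\<alpha> < ereal s" "ereal s < \<beta>" "ereal (\<psi> s) < a" by (auto simp: INF_less_iff)
  show "\<forall>\<^sub>F y in at_right \<alpha>. ereal (\<psi> (real_of_ereal y)) < a"
  proof (rule eventually_at_rightI[OF _ s(1)])
    fix y assume y: "y \<in> {\<alpha><..<ereal s}"
    then obtain r where r: "y = ereal r" by (cases y) auto
    then have "ereal (\<psi> r) \<le> ereal (\<psi> s)" using y s by (auto intro!: mono)
    then show "ereal (\<psi> (real_of_ereal y)) < a" using s(3) r by (simp add: le_less_trans[of "ereal (\<psi> r)" "ereal (\<psi> s)" a])
  qed
next
  fix a assume a: "a < ?V"
  show "\<forall>\<^sub>F y in at_right \<alpha>. a < ereal (\<psi> (real_of_ereal y))"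
  proof (rule eventually_at_rightI[OF _ ab])
    fix y assume y: "y \<in> {\<alpha><..<\<beta>}"
    then obtain r where r: "y = ereal r" by (cases y) auto
    have "?V \<le> ereal (\<psi> r)"
      using y r by (intro INF_lower) auto
    then show "a < ereal (\<psi> (real_of_ereal y))" using a r by (auto intro: less_le_trans)
  qed
qed

text \<open>Treats finite and infinite endpoints of the domain alike. Nonnegativity and monotonicity
  of the sequence later make the integrands increase.\<close>

lemma ereal_approx_from_below:
  fixes m :: ereal
  assumes "0 < m"
  obtains s :: "nat \<Rightarrow> real" where "incseq s" "\<And>k. 0 \<le> s k" "\<And>k. ereal (s k) < m" "(\<lambda>k. ereal (s k)) \<longlonglongrightarrow> m"
proof (cases m)
  case (real r)
  then have r: "r > 0" using assms by simp
  show thesis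
  proof (rule that[of "\<lambda>k. r - r / (real k + 1)"])
    show "incseq (\<lambda>k. r - r / (real k + 1))" using r by (intro incseq_SucI diff_left_mono divide_left_mono) auto
    show "0 \<le> r - r / (real k + 1)" for k using r by (simp add: field_simps)
    show "ereal (r - r / (real k + 1)) < m" for k using r real by simp
    have "filterlim (\<lambda>k. 1 + real k) at_top sequentially"
      by (rule filterlim_tendsto_add_at_top[OF tendsto_const filterlim_real_sequentially])
    then have "(\<lambda>k. r - r / (1 + real k)) \<longlonglongrightarrow> r - 0"
      by (intro tendsto_intros real_tendsto_divide_at_top[OF tendsto_const])
    then have "(\<lambda>k. r - r / (real k + 1)) \<longlonglongrightarrow> r" by (simp add: add.commute)
    then show "(\<lambda>k. ereal (r - r / (real k + 1))) \<longlonglongrightarrow> m" using real by simp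
  qed
next
  case PInf
  show thesis
  proof (rule that[of real])
    show "incseq real" by (simp add: incseq_def)
    show "(\<lambda>k. ereal (real k)) \<longlonglongrightarrow> m" unfolding PInf
      by (simp add: tendsto_PInfty eventually_sequentially) (metis less_le_trans of_nat_le_iff reals_Archimedean2)
  qed (use PInf in auto)
qed (use assms in auto)

lemma ereal_less_ediv_iff:
  assumes "0 \<le> c" "0 < a"
  shows "ereal s < ediv a c \<longleftrightarrow> ereal (c * s) < a"
proof (cases "c = 0")
  case False
  then have c: "c > 0" using assms by simp
  then show ?thesis
    by (cases a) (use assms in \<open>auto simp: ediv_def field_simps\<close>)
qed (use assms in \<open>simp add: ediv_def zero_ereal_def[symmetric]\<close>)

locale one_dim = nondegenerate_moments M Y f
  for M :: "'a measure" and Y :: "'a \<Rightarrow> 'v::euclidean_space" and f +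
  fixes b :: 'v
  assumes dim1: "DIM('v) = 1" and b: "b \<in> Basis"
begin

abbreviation "Esup \<equiv> supEd M Y f b"
abbreviation "Einf \<equiv> infEd M Y f b"
abbreviation "Mp \<equiv> Mplus M Y f b"
abbreviation "Mm \<equiv> Mminus M Y f b"
abbreviation "\<alpha> \<equiv> - Iinf M Y (- b)"
abbreviation "\<beta> \<equiv> Iinf M Y b"

lemma b_inner_b [simp]: "b \<bullet> b = 1" using b by simp

lemma Basis_eq: "(Basis :: 'v set) = {b}"
  using dim1 b by (metis card_1_singletonE singletonD)

lemma line_rep: "(v \<bullet> b) *\<^sub>R b = v"
  using euclidean_representation[of v] by (simp add: Basis_eq)

lemma dist_line: "dist (s *\<^sub>R b) v = \<bar>s - v \<bullet> b\<bar>"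
proof -
  have "s *\<^sub>R b - v = (s - v \<bullet> b) *\<^sub>R b" using line_rep[of v] by (simp add: scaleR_left_diff_distrib)
  then show ?thesis using b by (simp add: dist_norm)
qed

lemma interior_line: "interior {s. s *\<^sub>R b \<in> S} = {s. s *\<^sub>R b \<in> interior S}"
proof (rule antisym)
  have "open ((\<lambda>s. s *\<^sub>R b) -` interior S)" by (intro open_vimage continuous_intros) auto
  then show "{s. s *\<^sub>R b \<in> interior S} \<subseteq> interior {s. s *\<^sub>R b \<in> S}"
    using interior_subset[of S] by (intro interior_maximal) (auto simp: vimage_def)
  show "interior {s. s *\<^sub>R b \<in> S} \<subseteq> {s. s *\<^sub>R b \<in> interior S}"
  proof
    fix s assume "s \<in> interior {s. s *\<^sub>R b \<in> S}"
    then obtain e where e: "e > 0" "ball s e \<subseteq> {s. s *\<^sub>R b \<in> S}" by (auto simp: mem_interior)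
    have "ball (s *\<^sub>R b) e \<subseteq> S"
    proof
      fix v assume "v \<in> ball (s *\<^sub>R b) e"
      then have "v \<bullet> b \<in> ball s e" by (simp add: dist_line dist_real_def)
      then show "v \<in> S" using e line_rep[of v] by auto
    qed
    then show "s \<in> {s. s *\<^sub>R b \<in> interior S}" using e(1) by (auto simp: mem_interior)
  qed
qed

text \<open>In the coordinate along \<open>b\<close>, \<open>I1\<close> and \<open>J1\<close> are
  the interiors of the domains of \<open>K\<close> and \<open>E_f\<close>, and \<open>\<mu>\<close>
  and \<open>G1\<close> are the derivatives of \<open>K\<close> and \<open>E_f\<close> on
  them.\<close>

definition I1 :: "real set" where "I1 = {s. s *\<^sub>R b \<in> interior D}"
definition J1 :: "real set" where "J1 = {s. s *\<^sub>R b \<in> good}"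
definition \<mu> :: "real \<Rightarrow> real" where "\<mu> s = tmean (s *\<^sub>R b) \<bullet> b"
definition G1 :: "real \<Rightarrow> real" where "G1 s = gE (s *\<^sub>R b) \<bullet> b"

lemma interior_dom1: "interior (dom1 M Y b) = I1"
  unfolding dom1_def I1_def by (rule interior_line)

lemma interior_Df1: "interior (Df1 M Y f b) = J1"
  unfolding Df1_def J1_def by (simp add: interior_line interior_Df)

lemma open_I1: "open I1" unfolding interior_dom1[symmetric] by simp
lemma open_J1: "open J1" unfolding interior_Df1[symmetric] by simp

lemma zero_I1: "0 \<in> I1" using zero_int by (simp add: I1_def)
lemma zero_J1: "0 \<in> J1" using zero_good by (simp add: J1_def)

text \<open>\<open>D\<close> is an interval along \<open>b\<close>, and \<open>\<alpha>\<close> and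
  \<open>\<beta>\<close> are its infimum and supremum by definition of \<open>Iinf\<close>.\<close>

lemma I1_iff: "s \<in> I1 \<longleftrightarrow> \<alpha> < ereal s \<and> ereal s < \<beta>"
proof
  assume "s \<in> I1"
  then obtain e where e: "e > 0" "cball s e \<subseteq> I1" using open_I1 by (auto simp: open_contains_cball)
  have "s + e \<in> I1" "s - e \<in> I1" using e by (auto intro!: subsetD[OF e(2)] simp: dist_real_def)
  then have d: "(s + e) *\<^sub>R b \<in> D" "(s - e) *\<^sub>R b \<in> D" by (auto simp: I1_def interior_D)
  have "ereal ((s + e) *\<^sub>R b \<bullet> b) \<le> \<beta>" unfolding Iinf_def by (rule SUP_upper[OF d(1)])
  then have 1: "ereal s < \<beta>" using e(1) by (auto intro: less_le_trans[rotated])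
  have "ereal ((s - e) *\<^sub>R b \<bullet> (- b)) \<le> Iinf M Y (- b)" unfolding Iinf_def by (rule SUP_upper[OF d(2)])
  then have "ereal (- s) < Iinf M Y (- b)" using e(1) by (auto intro: less_le_trans[rotated])
  then have "\<alpha> < - ereal (- s)" by (simp only: ereal_minus_less_minus)
  then show "\<alpha> < ereal s \<and> ereal s < \<beta>" using 1 by simp
next
  assume s: "\<alpha> < ereal s \<and> ereal s < \<beta>"
  then obtain u where u: "u \<in> D" "s < u \<bullet> b" unfolding Iinf_def by (auto simp: less_SUP_iff)
  have "- ereal s < - (\<alpha>)" using s by (simp only: ereal_minus_less_minus)
  then have "ereal (- s) < Iinf M Y (- b)" by simp
  then obtain w where w: "w \<in> D" "w \<bullet> b < s" unfolding Iinf_def by (auto simp: less_SUP_iff)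
  have "convex ((\<lambda>s. s *\<^sub>R b) -` D)"
    by (intro convex_linear_vimage convex_D) (auto intro!: linearI simp: algebra_simps)
  then have "is_interval {s. s *\<^sub>R b \<in> D}" by (simp add: is_interval_convex_1 vimage_def)
  then have "{w \<bullet> b<..<u \<bullet> b} \<subseteq> {s. s *\<^sub>R b \<in> D}"
  proof (intro subsetI)
    fix x assume x: "x \<in> {w \<bullet> b<..<u \<bullet> b}"
    show "x \<in> {s. s *\<^sub>R b \<in> D}"
      by (rule mem_is_interval_1_I[OF \<open>is_interval _\<close>, of "w \<bullet> b" "u \<bullet> b"]) (use u w x line_rep in auto)
  qed
  then have "{w \<bullet> b<..<u \<bullet> b} \<subseteq> interior {s. s *\<^sub>R b \<in> D}" by (intro interior_maximal) auto
  then show "s \<in> I1" using u w by (auto simp: I1_def interior_line)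
qed

lemma Iinf_pos: "0 < \<beta>" "0 < Iinf M Y (- b)"
  using zero_I1 I1_iff[of 0] by (auto simp: ereal_uminus_less_reorder simp flip: zero_ereal_def)

text \<open>This is the meaning of the constants in the formula: \<open>- Mm\<close> and
  \<open>Mp\<close> are the ends of the interior of the domain of \<open>E_f\<close>.\<close>

lemma J1_iff: "s \<in> J1 \<longleftrightarrow> - Mm < ereal s \<and> ereal s < Mp"
proof -
  have neg: "- a < ereal s \<longleftrightarrow> ereal (- s) < a" for a s
    by (cases a) auto
  have "s \<in> J1 \<longleftrightarrow> fpmax f * s \<in> I1 \<and> - fmmax f * s \<in> I1"
    by (simp add: J1_def I1_def good_iff)
  also have "\<dots> \<longleftrightarrow> - Mm < ereal s \<and> ereal s < Mp"
    unfolding I1_iff neg Mminus_def Mplus_def min_less_iff_conj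
    using fp_nonneg fm_nonneg Iinf_pos by (auto simp: ereal_less_ediv_iff)
  finally show ?thesis .
qed

lemma Mplus_pos: "0 < Mp" and Mminus_pos: "0 < Mm"
  using zero_J1 J1_iff[of 0] by (auto simp: ereal_uminus_less_reorder simp flip: zero_ereal_def)

lemma tmean_line: "tmean (s *\<^sub>R b) = \<mu> s *\<^sub>R b"
  by (simp add: \<mu>_def line_rep)

lemma gE_line: "gE (s *\<^sub>R b) = G1 s *\<^sub>R b"
  by (simp add: G1_def line_rep)

lemma K_tangent1: "s \<in> I1 \<Longrightarrow> r *\<^sub>R b \<in> D \<Longrightarrow> K (s *\<^sub>R b) + \<mu> s * (r - s) \<le> K (r *\<^sub>R b)"
  using K_tangent[of "s *\<^sub>R b" "r *\<^sub>R b"] by (simp add: I1_def tmean_line algebra_simps)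

lemma E_tangent1: "s \<in> J1 \<Longrightarrow> r \<in> J1 \<Longrightarrow> E (s *\<^sub>R b) + G1 s * (r - s) \<le> E (r *\<^sub>R b)"
  using E_tangent[of "s *\<^sub>R b" "r *\<^sub>R b"] by (simp add: J1_def gE_line algebra_simps)

lemma b_nonzero: "b \<noteq> 0" using b nonzero_Basis by blast

lemma E_tangent1_strict: "s \<in> J1 \<Longrightarrow> r \<in> J1 \<Longrightarrow> s \<noteq> r \<Longrightarrow> E (s *\<^sub>R b) + G1 s * (r - s) < E (r *\<^sub>R b)"
  using E_tangent_strict[of "s *\<^sub>R b" "r *\<^sub>R b"] b_nonzero
  by (simp add: J1_def gE_line algebra_simps)

lemma I1_D: "s \<in> I1 \<Longrightarrow> s *\<^sub>R b \<in> D" by (simp add: I1_def interior_D)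

lemma \<mu>_mono: "s \<in> I1 \<Longrightarrow> r \<in> I1 \<Longrightarrow> s \<le> r \<Longrightarrow> \<mu> s \<le> \<mu> r"
proof (cases "s = r")
  case False
  assume sr: "s \<in> I1" "r \<in> I1" "s \<le> r"
  have "\<mu> s * (r - s) \<le> \<mu> r * (r - s)"
    using K_tangent1[OF sr(1) I1_D[OF sr(2)]] K_tangent1[OF sr(2) I1_D[OF sr(1)]] by (simp add: algebra_simps)
  then show ?thesis using False sr(3) by simp
qed simp

lemma G1_strict_mono: "s \<in> J1 \<Longrightarrow> r \<in> J1 \<Longrightarrow> s < r \<Longrightarrow> G1 s < G1 r"
proof -
  assume sr: "s \<in> J1" "r \<in> J1" "s < r"
  have "G1 s * (r - s) < G1 r * (r - s)"
    using E_tangent1_strict[OF sr(1,2)] E_tangent1_strict[OF sr(2,1)] sr(3) by (simp add: algebra_simps)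
  then show ?thesis using sr(3) by simp
qed

lemma G1_mono: "s \<in> J1 \<Longrightarrow> r \<in> J1 \<Longrightarrow> s \<le> r \<Longrightarrow> G1 s \<le> G1 r"
  using G1_strict_mono by (cases "s = r") (auto simp: less_le)

lemma \<mu>_continuous: "continuous_on I1 \<mu>"
  unfolding \<mu>_def
  by (intro continuous_intros continuous_on_compose2[OF tmean_continuous]) (auto simp: I1_def)

lemma G1_continuous: "continuous_on J1 G1"
  unfolding G1_def
  by (intro continuous_intros continuous_on_compose2[OF gE_continuous]) (auto simp: J1_def)

lemma deriv_k1: "s \<in> I1 \<Longrightarrow> deriv (k1 M Y b) s = \<mu> s"
proof (rule DERIV_imp_deriv)
  assume "s \<in> I1"
  then have s: "s *\<^sub>R b \<in> interior D" by (simp add: I1_def)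
  have "((\<lambda>s. s *\<^sub>R b) has_derivative (\<lambda>h. h *\<^sub>R b)) (at s)" by (auto intro!: derivative_eq_intros)
  from has_derivative_compose[OF this K_has_derivative[OF s]]
  show "(k1 M Y b has_real_derivative \<mu> s) (at s)"
    unfolding has_field_derivative_def k1_def by (simp add: \<mu>_def mult.commute[of _ "tmean _ \<bullet> b"])
qed

lemma deriv_E1r: "s \<in> J1 \<Longrightarrow> deriv (E1r M Y f b) s = G1 s"
proof (rule DERIV_imp_deriv)
  assume "s \<in> J1"
  then have s: "s *\<^sub>R b \<in> good" by (simp add: J1_def)
  have "((\<lambda>s. s *\<^sub>R b) has_derivative (\<lambda>h. h *\<^sub>R b)) (at s)" by (auto intro!: derivative_eq_intros)
  from has_derivative_compose[OF this Efr_has_derivative[OF s]]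
  show "(E1r M Y f b has_real_derivative G1 s) (at s)"
    unfolding has_field_derivative_def E1r_def by (simp add: G1_def mult.commute[of _ "gE _ \<bullet> b"])
qed

lemma supEd_eq: "Esup = (SUP s\<in>J1. ereal (G1 s))"
  unfolding supEd_def interior_Df1 by (intro SUP_cong refl) (simp add: deriv_E1r)

lemma infEd_eq: "Einf = (INF s\<in>J1. ereal (G1 s))"
  unfolding infEd_def interior_Df1 by (intro INF_cong refl) (simp add: deriv_E1r)

text \<open>The bounds are not attained because \<open>G1\<close> is strictly increasing on an open
  set.\<close>

lemma G1_range: "s \<in> J1 \<Longrightarrow> Einf < ereal (G1 s) \<and> ereal (G1 s) < Esup"
proof -
  assume s: "s \<in> J1"
  then obtain e where e: "e > 0" "cball s e \<subseteq> J1" using open_J1 by (auto simp: open_contains_cball)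
  have J: "s + e \<in> J1" "s - e \<in> J1" using e by (auto intro!: subsetD[OF e(2)] simp: dist_real_def)
  have "ereal (G1 s) < ereal (G1 (s + e))" using G1_strict_mono[OF s J(1)] e by simp
  also have "\<dots> \<le> Esup" unfolding supEd_eq by (rule SUP_upper[OF J(1)])
  finally have 1: "ereal (G1 s) < Esup" .
  have "Einf \<le> ereal (G1 (s - e))" unfolding infEd_eq by (rule INF_lower[OF J(2)])
  also have "\<dots> < ereal (G1 s)" using G1_strict_mono[OF J(2) s] e by simp
  finally show ?thesis using 1 by simp
qed

lemma G1_surj:
  assumes x: "Einf < ereal x" "ereal x < Esup"
  obtains s where "s \<in> J1" "G1 s = x"
proof -
  obtain p q where p: "p \<in> J1" "G1 p < x" and q: "q \<in> J1" "x < G1 q"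
    using x unfolding supEd_eq infEd_eq by (auto simp: less_SUP_iff INF_less_iff)
  have pq: "p \<le> q" using G1_mono[OF q(1) p(1)] p q by (cases "p \<le> q") auto
  have sub: "{p..q} \<subseteq> J1"
  proof
    fix s assume s: "s \<in> {p..q}"
    have "- Mm < ereal p" "ereal q < Mp" using p q J1_iff by auto
    then show "s \<in> J1" using s unfolding J1_iff
      using less_le_trans[of _ "ereal p" "ereal s"] le_less_trans[of "ereal s" "ereal q"] by simp
  qed
  have "\<exists>s\<ge>p. s \<le> q \<and> G1 s = x"
    using p q pq by (intro IVT' continuous_on_subset[OF G1_continuous sub]) auto
  then show thesis using that sub by auto
qed

lemma ginv_G1: "s \<in> J1 \<Longrightarrow> ginv M Y f b (G1 s) = s"
proof -
  assume s: "s \<in> J1"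
  have "inj_on (deriv (E1r M Y f b)) J1"
    using G1_strict_mono by (intro linorder_inj_onI) (force simp: deriv_E1r)+
  then show ?thesis
    using inv_into_f_f[of "deriv (E1r M Y f b)" J1 s] s by (simp add: ginv_def interior_Df1 deriv_E1r)
qed

lemma inf_less_sup: "Einf < Esup"
  using G1_range[OF zero_J1] by auto

lemma range_ginv: "ginv M Y f b ` {y. Einf < ereal y \<and> ereal y < Esup} = J1"
proof (intro equalityI subsetI)
  fix s assume s: "s \<in> J1"
  show "s \<in> ginv M Y f b ` {y. Einf < ereal y \<and> ereal y < Esup}"
    by (rule image_eqI[of _ _ "G1 s"]) (use s G1_range ginv_G1 in auto)
next
  fix s assume "s \<in> ginv M Y f b ` {y. Einf < ereal y \<and> ereal y < Esup}"
  then obtain y where y: "Einf < ereal y" "ereal y < Esup" "s = ginv M Y f b y" by auto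
  obtain r where "r \<in> J1" "G1 r = y" by (rule G1_surj[OF y(1,2)])
  then show "s \<in> J1" using y ginv_G1 by auto
qed

lemma ginv_mono:
  assumes "Einf < ereal y" "y \<le> z" "ereal z < Esup"
  shows "ginv M Y f b y \<le> ginv M Y f b z"
proof -
  have y: "ereal y < Esup" and z: "Einf < ereal z"
    using assms by (auto intro: le_less_trans[of _ "ereal z"] less_le_trans[of _ "ereal y"])
  obtain r where r: "r \<in> J1" "G1 r = y" by (rule G1_surj[OF assms(1) y])
  obtain q where q: "q \<in> J1" "G1 q = z" by (rule G1_surj[OF z assms(3)])
  have "r \<le> q" using G1_strict_mono[OF q(1) r(1)] r q assms(2) by (cases "r \<le> q") auto
  then show ?thesis using r q ginv_G1 by auto
qed

lemma SUP_J1: "(SUP s\<in>J1. ereal s) = Mp"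
proof (rule antisym)
  show "(SUP s\<in>J1. ereal s) \<le> Mp" by (rule SUP_least) (simp add: J1_iff less_imp_le)
  obtain s :: "nat \<Rightarrow> real" where s: "\<And>k. 0 \<le> s k" "\<And>k. ereal (s k) < Mp" "(\<lambda>k. ereal (s k)) \<longlonglongrightarrow> Mp"
    using ereal_approx_from_below[OF Mplus_pos] by metis
  have "s k \<in> J1" for k
  proof -
    have "- Mm < 0" using Mminus_pos by (simp add: ereal_uminus_less_reorder)
    also have "0 \<le> ereal (s k)" using s(1) by simp
    finally show ?thesis using s(2) by (simp add: J1_iff)
  qed
  then show "Mp \<le> (SUP s\<in>J1. ereal s)"
    by (intro LIMSEQ_le_const2[OF s(3)]) (auto intro: SUP_upper)
qed

lemma INF_J1: "(INF s\<in>J1. ereal s) = - Mm"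
proof (rule antisym)
  show "- Mm \<le> (INF s\<in>J1. ereal s)" by (rule INF_greatest) (simp add: J1_iff less_imp_le)
  obtain s :: "nat \<Rightarrow> real" where s: "\<And>k. 0 \<le> s k" "\<And>k. ereal (s k) < Mm" "(\<lambda>k. ereal (s k)) \<longlonglongrightarrow> Mm"
    using ereal_approx_from_below[OF Mminus_pos] by metis
  have "- s k \<in> J1" for k
  proof -
    have "ereal (- s k) \<le> 0" using s(1) by simp
    also have "0 < Mp" by (rule Mplus_pos)
    finally have "ereal (- s k) < Mp" .
    moreover have "- Mm < - ereal (s k)" using s(2) by (simp only: ereal_minus_less_minus)
    ultimately show ?thesis by (simp add: J1_iff)
  qed
  then have "(INF s\<in>J1. ereal s) \<le> - ereal (s k)" for k by (metis INF_lower uminus_ereal.simps(1))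
  moreover have "(\<lambda>k. - ereal (s k)) \<longlonglongrightarrow> - Mm" using s(3) by (rule tendsto_uminus_ereal)
  ultimately show "(INF s\<in>J1. ereal s) \<le> - Mm" by (intro LIMSEQ_le_const) auto
qed

text \<open>The inverse of \<open>G1\<close> maps its open range onto \<open>J1\<close>
  monotonically, so its limit at the upper end is the right end of \<open>J1\<close>.\<close>

lemma gbar_upper:
  assumes "Esup \<le> ereal x"
  shows "gbar M Y f b x = Mp"
proof -
  have "((\<lambda>y. ereal (ginv M Y f b (real_of_ereal y))) \<longlongrightarrow>
     (SUP y\<in>{y. Einf < ereal y \<and> ereal y < Esup}. ereal (ginv M Y f b y))) (at_left (Esup))"
    by (rule mono_tendsto_at_left[OF inf_less_sup]) (rule ginv_mono)
  also have "(SUP y\<in>{y. Einf < ereal y \<and> ereal y < Esup}. ereal (ginv M Y f b y)) = (SUP s\<in>J1. ereal s)"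
    unfolding range_ginv[symmetric] by (simp add: image_image)
  finally have "((\<lambda>y. ereal (ginv M Y f b (real_of_ereal y))) \<longlongrightarrow> Mp) (at_left (Esup))"
    unfolding SUP_J1 .
  from tendsto_Lim[OF ereal_at_left_not_bot[OF inf_less_sup] this]
  show ?thesis using assms by (simp add: gbar_def)
qed

lemma gbar_lower:
  assumes x: "ereal x \<le> Einf"
  shows "gbar M Y f b x = - Mm"
proof -
  have "((\<lambda>y. ereal (ginv M Y f b (real_of_ereal y))) \<longlongrightarrow>
     (INF y\<in>{y. Einf < ereal y \<and> ereal y < Esup}. ereal (ginv M Y f b y))) (at_right (Einf))"
    by (rule mono_tendsto_at_right[OF inf_less_sup]) (rule ginv_mono)
  also have "(INF y\<in>{y. Einf < ereal y \<and> ereal y < Esup}. ereal (ginv M Y f b y)) = (INF s\<in>J1. ereal s)"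
    unfolding range_ginv[symmetric] by (simp add: image_image)
  finally have "((\<lambda>y. ereal (ginv M Y f b (real_of_ereal y))) \<longlongrightarrow> - Mm) (at_right (Einf))"
    unfolding INF_J1 .
  from tendsto_Lim[OF ereal_at_right_not_bot[OF inf_less_sup] this]
  show ?thesis using x not_le[THEN iffD2, OF le_less_trans[OF x inf_less_sup]] by (simp add: gbar_def Let_def)
qed

lemma gbar_middle: "s \<in> J1 \<Longrightarrow> gbar M Y f b (G1 s) = ereal s"
proof -
  assume s: "s \<in> J1"
  then have "\<not> Esup \<le> ereal (G1 s)" "\<not> ereal (G1 s) \<le> Einf"
    using G1_range[of s] by (simp_all add: not_le)
  then show ?thesis using s by (simp add: gbar_def Let_def ginv_G1)
qed

text \<open>By Young's equality this is the rate \<open>I\<close> at the slope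
  \<open>\<mu> w\<close>, for \<open>w\<close> in \<open>I1\<close>.\<close>

definition H1 :: "real \<Rightarrow> real" where "H1 w = w * \<mu> w - K (w *\<^sub>R b)"

lemma Kd1_interior: "u \<in> I1 \<Longrightarrow> Kd1 M Y b (ereal u) = ereal (\<mu> u)"
  by (simp add: Kd1_def interior_dom1 deriv_k1)

lemma Iinf_less: "\<alpha> < \<beta>"
  using zero_I1 I1_iff[of 0] less_trans by blast

lemma deriv_k1_mono:
  assumes "\<alpha> < ereal s" "s \<le> r" "ereal r < \<beta>"
  shows "deriv (k1 M Y b) s \<le> deriv (k1 M Y b) r"
proof -
  have "s \<in> I1" "r \<in> I1"
    using assms less_le_trans[of _ "ereal s" "ereal r"] le_less_trans[of "ereal s" "ereal r"] by (auto simp: I1_iff)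
  then show ?thesis using \<mu>_mono assms(2) by (simp add: deriv_k1)
qed

text \<open>At an endpoint the one-sided limit behind \<open>Lim\<close> exists by monotonicity of
  the derivative, and the sequence stays strictly inside; elsewhere continuity of
  \<open>\<mu>\<close> suffices.\<close>

lemma Kd1_tendsto:
  assumes w: "\<And>k. w k \<in> I1" and z: "(\<lambda>k. ereal (w k)) \<longlonglongrightarrow> z"
  shows "(\<lambda>k. ereal (\<mu> (w k))) \<longlonglongrightarrow> Kd1 M Y b z"
proof -
  let ?\<psi> = "\<lambda>y. ereal (deriv (k1 M Y b) (real_of_ereal y))"
  have wab: "\<alpha> < ereal (w k)" "ereal (w k) < \<beta>" for k using w[of k] by (simp_all add: I1_iff)
  have eq: "ereal (\<mu> (w k)) = ?\<psi> (ereal (w k))" for k using w[of k] by (simp add: deriv_k1)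
  have z_le: "z \<le> \<beta>" "\<alpha> \<le> z"
    by (intro LIMSEQ_le_const2[OF z] LIMSEQ_le_const[OF z] exI allI impI less_imp_le wab)+
  consider "z = \<beta>" | "z = \<alpha>" | "\<alpha> < z" "z < \<beta>" using z_le by fastforce
  then show ?thesis
  proof cases
    case 1
    have "\<beta> \<notin> ereal ` I1" by (auto simp: I1_iff)
    then have "Kd1 M Y b z = Lim (at_left \<beta>) ?\<psi>" by (simp add: Kd1_def 1 interior_dom1)
    moreover have lim: "(?\<psi> \<longlongrightarrow> (SUP s\<in>{s. \<alpha> < ereal s \<and> ereal s < \<beta>}. ereal (deriv (k1 M Y b) s))) (at_left \<beta>)"
      by (rule mono_tendsto_at_left[OF Iinf_less deriv_k1_mono])
    ultimately have "(?\<psi> \<longlongrightarrow> Kd1 M Y b z) (at_left \<beta>)"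
      using tendsto_Lim[OF ereal_at_left_not_bot[OF Iinf_less] lim] by simp
    moreover have "filterlim (\<lambda>k. ereal (w k)) (at_left \<beta>) sequentially"
      unfolding filterlim_at using z wab by (auto simp: 1 less_imp_neq intro!: always_eventually)
    ultimately show ?thesis unfolding eq by (rule filterlim_compose)
  next
    case 2
    have "\<alpha> \<notin> ereal ` I1" by (auto simp: I1_iff)
    then have "Kd1 M Y b z = Lim (at_right \<alpha>) ?\<psi>"
      using Iinf_less by (simp add: Kd1_def 2 interior_dom1 less_imp_neq)
    moreover have lim: "(?\<psi> \<longlongrightarrow> (INF s\<in>{s. \<alpha> < ereal s \<and> ereal s < \<beta>}. ereal (deriv (k1 M Y b) s))) (at_right \<alpha>)"
      by (rule mono_tendsto_at_right[OF Iinf_less deriv_k1_mono])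
    ultimately have "(?\<psi> \<longlongrightarrow> Kd1 M Y b z) (at_right \<alpha>)"
      using tendsto_Lim[OF ereal_at_right_not_bot[OF Iinf_less] lim] by simp
    moreover have "filterlim (\<lambda>k. ereal (w k)) (at_right \<alpha>) sequentially"
      unfolding filterlim_at using z wab by (auto simp: 2 less_imp_neq[symmetric] intro!: always_eventually)
    ultimately show ?thesis unfolding eq by (rule filterlim_compose)
  next
    case 3
    then obtain u where u: "z = ereal u" by (cases z) auto
    then have uI: "u \<in> I1" using 3 by (simp add: I1_iff)
    have "isCont \<mu> u" using \<mu>_continuous open_I1 uI by (simp add: continuous_on_eq_continuous_at)
    moreover have "w \<longlonglongrightarrow> u" using z u by simp
    ultimately have "(\<lambda>k. \<mu> (w k)) \<longlonglongrightarrow> \<mu> u" by (rule isCont_tendsto_compose)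
    then show ?thesis by (simp add: u Kd1_interior[OF uI])
  qed
qed

lemma H1_ge: "w \<in> I1 \<Longrightarrow> q *\<^sub>R b \<in> D \<Longrightarrow> q * \<mu> w - K (q *\<^sub>R b) \<le> H1 w"
  using K_tangent1[of w q] by (simp add: H1_def algebra_simps)

text \<open>An infinite limit \<open>v\<close> of the slopes forces the left-hand side to diverge, by \<open>H1_ge\<close> with
  \<open>q\<close> of the sign of \<open>v\<close>, which matches the value of \<open>Ie\<close> there.\<close>
lemma H1_tendsto:
  assumes w: "\<And>k. w k \<in> I1" and lim: "(\<lambda>k. ereal (\<mu> (w k))) \<longlonglongrightarrow> v"
    and inc: "incseq (\<lambda>k. H1 (w k))" and sgn: "\<And>r k. v = ereal r \<Longrightarrow> 0 \<le> w k * (r - \<mu> (w k))"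
  shows "(\<lambda>k. ennreal (H1 (w k))) \<longlonglongrightarrow> e2ennreal (Ie M Y b v)"
proof -
  let ?S = "SUP k. ereal (H1 (w k))"
  have up: "ereal (H1 (w k)) \<le> ?S" for k by (rule SUP_upper) simp
  \<comment> \<open>Points of both signs in the domain, one for each sign of an infinite limit
    slope.\<close>
  obtain e where e: "e > 0" "cball 0 e \<subseteq> I1" using open_I1 zero_I1 by (auto simp: open_contains_cball)
  have eD: "e *\<^sub>R b \<in> D" "(- e) *\<^sub>R b \<in> D" by (intro I1_D subsetD[OF e(2)]; use e(1) in simp)+
  have "?S = Ie M Y b v"
  proof (cases v)
    case (real r)
    have lim': "(\<lambda>k. \<mu> (w k)) \<longlonglongrightarrow> r" using lim real by simp
    show ?thesis unfolding real Ie_def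
    proof (simp, rule antisym)
      show "?S \<le> cramer M Y (r *\<^sub>R b)"
      proof (rule SUP_least)
        fix k
        \<comment> \<open>By the sign condition, replacing the slope \<open>\<mu> (w k)\<close> by
          its limit \<open>r\<close> does not decrease the linear term.\<close>
        have "H1 (w k) \<le> w k * r - K (w k *\<^sub>R b)" using sgn[OF real, of k] by (simp add: H1_def algebra_simps)
        then have "ereal (H1 (w k)) \<le> ereal ((w k *\<^sub>R b) \<bullet> (r *\<^sub>R b) - K (w k *\<^sub>R b))" by (simp add: mult.commute)
        also have "\<dots> \<le> cramer M Y (r *\<^sub>R b)" unfolding cramer_def by (rule SUP_upper[OF I1_D[OF w]])
        finally show "ereal (H1 (w k)) \<le> cramer M Y (r *\<^sub>R b)" .
      qed
      show "cramer M Y (r *\<^sub>R b) \<le> ?S" unfolding cramer_def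
      proof (rule SUP_least)
        fix u assume u: "u \<in> D"
        define q where "q = u \<bullet> b"
        have uq: "u = q *\<^sub>R b" by (simp add: q_def line_rep)
        have L: "(\<lambda>k. ereal (q * \<mu> (w k) - K u)) \<longlonglongrightarrow> ereal (q * r - K u)"
          by (intro tendsto_intros lim')
        have "ereal (q * \<mu> (w k) - K u) \<le> ?S" for k
          using H1_ge[OF w, of q k] u up[of k] unfolding uq by (meson ereal_less_eq(3) order_trans)
        then have "ereal (q * r - K u) \<le> ?S" by (intro LIMSEQ_le_const2[OF L]) blast
        then show "ereal (u \<bullet> (r *\<^sub>R b) - K u) \<le> ?S" by (simp add: q_def mult.commute)
      qed
    qed
  next
    case PInf
    have "?S = \<infinity>"
    proof (rule ccontr)
      assume "?S \<noteq> \<infinity>"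
      then obtain c where c: "?S \<le> ereal c" by (cases "?S") auto
      have "ereal (\<mu> (w k)) \<le> ereal ((c + K (e *\<^sub>R b)) / e)" for k
      proof -
        have "H1 (w k) \<le> c" using order_trans[OF up c] by simp
        then have "e * \<mu> (w k) \<le> c + K (e *\<^sub>R b)" using H1_ge[OF w eD(1), of k] by linarith
        then show ?thesis using e(1) by (simp add: field_simps)
      qed
      then have "v \<le> ereal ((c + K (e *\<^sub>R b)) / e)" by (intro LIMSEQ_le_const2[OF lim]) auto
      then show False using PInf by simp
    qed
    then show ?thesis by (simp add: PInf Ie_def)
  next
    case MInf
    have "?S = \<infinity>"
    proof (rule ccontr)
      assume "?S \<noteq> \<infinity>"
      then obtain c where c: "?S \<le> ereal c" by (cases "?S") auto
      have "ereal (- ((c + K ((- e) *\<^sub>R b)) / e)) \<le> ereal (\<mu> (w k))" for k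
      proof -
        have "H1 (w k) \<le> c" using order_trans[OF up c] by simp
        then have "(- e) * \<mu> (w k) \<le> c + K ((- e) *\<^sub>R b)" using H1_ge[OF w eD(2), of k] by linarith
        then show ?thesis using e(1) by (simp add: field_simps)
      qed
      then have "ereal (- ((c + K ((- e) *\<^sub>R b)) / e)) \<le> v" by (intro LIMSEQ_le_const[OF lim]) auto
      then show False using MInf by simp
    qed
    then show ?thesis by (simp add: MInf Ie_def)
  qed
  moreover have "(\<lambda>k. ereal (H1 (w k))) \<longlonglongrightarrow> ?S"
    using inc by (intro LIMSEQ_SUP) (simp add: incseq_def)
  ultimately have "(\<lambda>k. e2ennreal (ereal (H1 (w k)))) \<longlonglongrightarrow> e2ennreal (Ie M Y b v)"
    by (intro tendsto_e2ennrealI) simp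
  then show ?thesis by (simp add: e2ennreal_ereal)
qed

text \<open>Keeping \<open>w\<close> as competitor for the slope at \<open>r\<close> bounds
  \<open>H1 r\<close> below by \<open>w * \<mu> r - K (w *\<^sub>R b)\<close>, and
  \<open>\<mu>\<close> is increasing.\<close>

lemma H1_mono_nonneg:
  assumes "w \<in> I1" "r \<in> I1" "0 \<le> w" "w \<le> r"
  shows "H1 w \<le> H1 r"
proof -
  have "w * \<mu> w \<le> w * \<mu> r" using assms by (intro mult_left_mono \<mu>_mono) auto
  then show ?thesis using H1_ge[OF assms(2) I1_D[OF assms(1)]] by (simp add: H1_def)
qed

lemma H1_mono_nonpos:
  assumes "w \<in> I1" "r \<in> I1" "w \<le> 0" "r \<le> w"
  shows "H1 w \<le> H1 r"
proof -
  have "w * \<mu> w \<le> w * \<mu> r" using assms by (intro mult_left_mono_neg \<mu>_mono) auto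
  then show ?thesis using H1_ge[OF assms(2) I1_D[OF assms(1)]] by (simp add: H1_def)
qed

text \<open>The integral term of the formula, as a function of the value of \<open>gbar\<close>. For
  infinite \<open>m\<close> and \<open>f t = 0\<close> the convention that the product is 0 gives
  the correct argument.\<close>

definition tail :: "ereal \<Rightarrow> ereal" where
  "tail m = enn2ereal (\<integral>\<^sup>+ t\<in>{0..1}. e2ennreal (Ie M Y b (Kd1 M Y b (m * ereal (f t)))) \<partial>lborel)"

lemma J1_scale: "s \<in> J1 \<Longrightarrow> t \<in> {0..1} \<Longrightarrow> s * f t \<in> I1"
  using goodD[of "s *\<^sub>R b" t] by (simp add: J1_def I1_def mult.commute)

text \<open>For each \<open>t\<close> the points \<open>s k * f t\<close> move monotonically away
  from 0, to the side given by the sign of \<open>f t\<close>, so \<open>H1\<close> increases along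
  them and monotone convergence applies in \<open>t\<close>.\<close>

lemma tail_limit:
  assumes s: "incseq s" "\<And>k. 0 \<le> s k" "\<And>k. s k \<in> J1" and lim: "(\<lambda>k. ereal (s k)) \<longlonglongrightarrow> m"
  shows "(\<lambda>k. ereal (s k * G1 (s k) - E (s k *\<^sub>R b))) \<longlonglongrightarrow> tail m"
proof -
  let ?c = "\<lambda>t. e2ennreal (Ie M Y b (Kd1 M Y b (m * ereal (f t))))"
  \<comment> \<open>The indicator makes the sequence increasing at every real \<open>t\<close>,
    although \<open>s k * f t\<close> is known to lie in \<open>I1\<close> only for \<open>t\<close>
    in the unit interval.\<close>
  let ?h = "\<lambda>k t. ennreal (H1 (s k * f t)) * indicator {0..1} t"
  have mono: "H1 (s i * f t) \<le> H1 (s j * f t)" if "i \<le> j" "t \<in> {0..1}" for i j t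
  proof (cases "0 \<le> f t")
    case True
    then show ?thesis using that s incseqD[OF s(1) that(1)]
      by (intro H1_mono_nonneg J1_scale mult_right_mono) auto
  next
    case False
    then show ?thesis using that s incseqD[OF s(1) that(1)]
      by (intro H1_mono_nonpos J1_scale mult_right_mono_neg) (auto simp: mult_nonneg_nonpos)
  qed
  have h_eq: "(f t *\<^sub>R (s k *\<^sub>R b)) \<bullet> tmean (f t *\<^sub>R (s k *\<^sub>R b)) - K (f t *\<^sub>R (s k *\<^sub>R b)) = H1 (s k * f t)" for k t
    using tmean_line[of "f t * s k"] by (simp add: H1_def mult.commute[of "f t"])
  have good: "s k *\<^sub>R b \<in> good" for k using s(3)[of k] by (simp add: J1_def)
  have "(\<lambda>k. \<integral>\<^sup>+ t. ?h k t \<partial>lborel01) \<longlonglongrightarrow>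
     (\<integral>\<^sup>+ t. ?c t * indicator {0..1} t \<partial>lborel01)"
  proof (rule nn_integral_LIMSEQ)
    show "incseq ?h"
      by (intro monoI le_funI) (auto simp: indicator_def intro!: ennreal_leI mono)
    show "?h k \<in> borel_measurable lborel01" for k
    proof -
      have "(\<lambda>t. ennreal (H1 (s k * f t))) \<in> borel_measurable lborel01"
        using borel_measurable_integrable[OF integral_H(1)[OF good[of k]]] unfolding h_eq by simp
      moreover have "indicator {0..1} \<in> borel_measurable lborel01"
        using sets.top[of lborel01] by (intro borel_measurable_indicator) simp
      ultimately show ?thesis by (rule borel_measurable_times_ennreal)
    qed
    fix t
    show "(\<lambda>k. ?h k t) \<longlonglongrightarrow> ?c t * indicator {0..1} t"
    proof (cases "t \<in> {0..1}")
      case t: True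
      let ?w = "\<lambda>k. s k * f t"
      have w: "?w k \<in> I1" for k by (rule J1_scale[OF s(3) t])
      have "(\<lambda>k. ereal (f t) * ereal (s k)) \<longlonglongrightarrow> ereal (f t) * m"
        by (rule tendsto_cmult_ereal[OF _ lim]) simp
      then have "(\<lambda>k. ereal (?w k)) \<longlonglongrightarrow> m * ereal (f t)"
        by (simp add: mult.commute)
      from Kd1_tendsto[OF w this] have \<mu>lim: "(\<lambda>k. ereal (\<mu> (?w k))) \<longlonglongrightarrow> Kd1 M Y b (m * ereal (f t))" .
      have "(\<lambda>k. ennreal (H1 (?w k))) \<longlonglongrightarrow> ?c t"
      proof (rule H1_tendsto[OF w \<mu>lim])
        show "incseq (\<lambda>k. H1 (?w k))" using mono t by (intro monoI) auto
        fix r k assume "Kd1 M Y b (m * ereal (f t)) = ereal r"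
        then have r: "(\<lambda>k. \<mu> (?w k)) \<longlonglongrightarrow> r" using \<mu>lim by simp
        show "0 \<le> ?w k * (r - \<mu> (?w k))"
        proof (cases "0 \<le> f t")
          case True
          have "incseq (\<lambda>k. \<mu> (?w k))"
            using True incseqD[OF s(1)] by (intro monoI \<mu>_mono w mult_right_mono) auto
          then have "\<mu> (?w k) \<le> r" using r by (rule incseq_le)
          then show ?thesis using True s(2)[of k] by simp
        next
          case False
          have "decseq (\<lambda>k. \<mu> (?w k))"
            using False incseqD[OF s(1)] by (intro antimonoI \<mu>_mono w mult_right_mono_neg) auto
          then have "r \<le> \<mu> (?w k)" using r by (rule decseq_ge)
          then show ?thesis using False s(2)[of k] by (simp add: mult_nonneg_nonpos mult_nonpos_nonpos)
        qed
      qed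
      then show ?thesis using t by simp
    qed simp
  qed
  also have "(\<integral>\<^sup>+ t. ?c t * indicator {0..1} t \<partial>lborel01)
      = (\<integral>\<^sup>+ t\<in>{0..1}. ?c t \<partial>lborel)"
    unfolding nn_integral_lborel01 by (intro nn_integral_cong) simp
  finally have "(\<lambda>k. enn2ereal (\<integral>\<^sup>+ t. ?h k t \<partial>lborel01)) \<longlonglongrightarrow> tail m"
    unfolding tail_def by (rule tendsto_enn2erealI)
  moreover have "enn2ereal (\<integral>\<^sup>+ t. ?h k t \<partial>lborel01) = ereal (s k * G1 (s k) - E (s k *\<^sub>R b))" for k
  proof -
    have "(\<integral>\<^sup>+ t. ?h k t \<partial>lborel01) = (\<integral>\<^sup>+ t. ennreal (H1 (s k * f t)) \<partial>lborel01)"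
      by (intro nn_integral_cong) simp
    then show ?thesis using nn_integral_H[OF good[of k]] unfolding h_eq by (simp add: gE_line)
  qed
  ultimately show ?thesis by simp
qed

lemma support_line_mono:
  assumes x: "Esup \<le> ereal x" and r: "r \<in> J1" "s \<in> J1" "r \<le> s"
  shows "r * x - E (r *\<^sub>R b) \<le> s * x - E (s *\<^sub>R b)"
proof -
  have "ereal (G1 s) \<le> Esup" unfolding supEd_eq by (rule SUP_upper[OF r(2)])
  then have "G1 s \<le> x" using x order_trans by fastforce
  then have "G1 s * (s - r) \<le> x * (s - r)" using r(3) by (intro mult_right_mono) auto
  then show ?thesis using E_tangent1[OF r(2,1)] by (simp add: algebra_simps)
qed

lemma If_above:
  assumes x: "Esup \<le> ereal x"
  shows "If M Y f (x *\<^sub>R b) = Mp * (ereal x - Esup) + tail (Mp)"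
proof -
  let ?m = "Mp"
  \<comment> \<open>Finite because it lies between the slope at 0 and \<open>x\<close>.\<close>
  obtain S where S: "Esup = ereal S"
    using x G1_range[OF zero_J1] by (cases "Esup") auto
  have Sx: "S \<le> x" using x S by simp
  obtain s :: "nat \<Rightarrow> real" where s: "incseq s" "\<And>k. 0 \<le> s k" "\<And>k. ereal (s k) < ?m" and lim: "(\<lambda>k. ereal (s k)) \<longlonglongrightarrow> ?m"
    using ereal_approx_from_below[OF Mplus_pos] by metis
  have sJ: "s k \<in> J1" for k
  proof -
    have "- Mm < 0" using Mminus_pos by (simp add: ereal_uminus_less_reorder)
    also have "0 \<le> ereal (s k)" using s(2) by simp
    finally show ?thesis using s(3) by (simp add: J1_iff)
  qed
  have cofinal: "\<exists>k. r \<le> s k" if "r \<in> J1" for r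
  proof -
    have "ereal r < ?m" using that by (simp add: J1_iff)
    then have "\<forall>\<^sub>F k in sequentially. ereal r < ereal (s k)" by (rule order_tendstoD(1)[OF lim])
    then show ?thesis by (auto simp: eventually_sequentially intro: less_imp_le)
  qed
  have h_inc: "incseq (\<lambda>k. ereal (s k * y - E (s k *\<^sub>R b)))" if "S \<le> y" for y
    using support_line_mono[OF _ sJ sJ incseqD[OF s(1)]] that S by (intro monoI) auto
  have G_lim: "(\<lambda>k. G1 (s k)) \<longlonglongrightarrow> S"
  proof -
    have "(\<lambda>k. ereal (G1 (s k))) \<longlonglongrightarrow> (SUP k. ereal (G1 (s k)))"
      using G1_mono[OF sJ sJ incseqD[OF s(1)]] by (intro LIMSEQ_SUP monoI) auto
    also have "(SUP k. ereal (G1 (s k))) = Esup"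
      unfolding supEd_eq
    proof (rule antisym)
      show "(SUP k. ereal (G1 (s k))) \<le> (SUP s\<in>J1. ereal (G1 s))"
        by (intro SUP_least SUP_upper sJ)
      show "(SUP s\<in>J1. ereal (G1 s)) \<le> (SUP k. ereal (G1 (s k)))"
      proof (rule SUP_least)
        fix r assume r: "r \<in> J1"
        then obtain k where "r \<le> s k" using cofinal by blast
        then have "ereal (G1 r) \<le> ereal (G1 (s k))" using G1_mono[OF r sJ] by simp
        also have "\<dots> \<le> (SUP k. ereal (G1 (s k)))" by (rule SUP_upper) simp
        finally show "ereal (G1 r) \<le> (SUP k. ereal (G1 (s k)))" .
      qed
    qed
    finally show ?thesis by (simp add: S)
  qed
  have If_lim: "(\<lambda>k. ereal (s k * x - E (s k *\<^sub>R b))) \<longlonglongrightarrow> If M Y f (x *\<^sub>R b)"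
  proof -
    let ?I = "SUP l\<in>good. ereal (l \<bullet> (x *\<^sub>R b) - E l)" and ?H = "SUP k. ereal (s k * x - E (s k *\<^sub>R b))"
    have "If M Y f (x *\<^sub>R b) = ?H"
      unfolding If_eq_SUP_good[OF K_zero]
    proof (rule antisym)
      show "?H \<le> ?I"
      proof (rule SUP_least)
        fix k
        have "s k *\<^sub>R b \<in> good" using sJ by (simp add: J1_def)
        then have "ereal ((s k *\<^sub>R b) \<bullet> (x *\<^sub>R b) - E (s k *\<^sub>R b)) \<le> ?I"
          by (rule SUP_upper)
        then show "ereal (s k * x - E (s k *\<^sub>R b)) \<le> ?I" by (simp add: mult.commute)
      qed
      show "?I \<le> ?H"
      proof (rule SUP_least)
        fix l assume l: "l \<in> good"
        define r where "r = l \<bullet> b"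
        have lr: "l = r *\<^sub>R b" by (simp add: r_def line_rep)
        then have r: "r \<in> J1" using l by (simp add: J1_def)
        then obtain k where "r \<le> s k" using cofinal by blast
        then have "ereal (r * x - E (r *\<^sub>R b)) \<le> ereal (s k * x - E (s k *\<^sub>R b))"
          using support_line_mono[OF x r sJ] by simp
        also have "\<dots> \<le> ?H" by (rule SUP_upper) simp
        finally show "ereal (l \<bullet> (x *\<^sub>R b) - E l) \<le> ?H" by (simp add: lr mult.commute)
      qed
    qed
    then show ?thesis using LIMSEQ_SUP[OF h_inc[OF Sx]] by simp
  qed
  let ?a = "\<lambda>k. s k * S - E (s k *\<^sub>R b)"
  \<comment> \<open>The limit slope \<open>S\<close> may replace \<open>G1 (s k)\<close> although
    \<open>s k\<close> can be unbounded. One inequality is \<open>G1 (s k) \<le> S\<close>; for the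
    other, \<open>j\<close> is fixed in the tangent inequality at \<open>s k\<close> while
    \<open>k\<close> tends to infinity.\<close>
  have a_lim: "(\<lambda>k. ereal (?a k)) \<longlonglongrightarrow> tail ?m"
  proof -
    note T = tail_limit[OF s(1,2) sJ lim]
    have SUP: "(\<lambda>k. ereal (?a k)) \<longlonglongrightarrow> (SUP k. ereal (?a k))"
      by (rule LIMSEQ_SUP[OF h_inc]) simp
    have "(SUP k. ereal (?a k)) \<le> tail ?m"
    proof (rule SUP_least)
      fix j
      have L: "(\<lambda>k. ereal (s j * G1 (s k) - E (s j *\<^sub>R b))) \<longlonglongrightarrow> ereal (?a j)"
        by (intro tendsto_intros G_lim)
      have "ereal (s j * G1 (s k) - E (s j *\<^sub>R b)) \<le> ereal (s k * G1 (s k) - E (s k *\<^sub>R b))" for k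
        using E_tangent1[OF sJ sJ, of k j] by (simp add: algebra_simps)
      then show "ereal (?a j) \<le> tail ?m" by (intro LIMSEQ_le[OF L T]) blast
    qed
    moreover have "tail ?m \<le> (SUP k. ereal (?a k))"
    proof (rule LIMSEQ_le_const2[OF T], intro exI allI impI)
      fix k
      have "ereal (G1 (s k)) \<le> ereal S" using SUP_upper[OF sJ[of k], of "\<lambda>s. ereal (G1 s)"] by (simp add: supEd_eq[symmetric] S)
      then have "ereal (s k * G1 (s k) - E (s k *\<^sub>R b)) \<le> ereal (?a k)"
        using s(2)[of k] by (simp add: mult_left_mono)
      also have "\<dots> \<le> (SUP k. ereal (?a k))" by (rule SUP_upper) simp
      finally show "ereal (s k * G1 (s k) - E (s k *\<^sub>R b)) \<le> (SUP k. ereal (?a k))" .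
    qed
    ultimately show ?thesis using SUP by (simp add: antisym)
  qed
  have m_lim: "(\<lambda>k. ereal (s k * (x - S))) \<longlonglongrightarrow> ?m * ereal (x - S)"
  proof -
    have "(\<lambda>k. ereal (x - S) * ereal (s k)) \<longlonglongrightarrow> ereal (x - S) * ?m"
      by (rule tendsto_cmult_ereal[OF _ lim]) simp
    then show ?thesis by (simp add: mult.commute)
  qed
  \<comment> \<open>Both summands may be infinite; nonnegativity makes addition continuous
    here.\<close>
  have "0 \<le> ?m * ereal (x - S)" using Mplus_pos Sx by (simp add: less_imp_le)
  moreover have "0 \<le> tail ?m" by (simp add: tail_def)
  ultimately have "(\<lambda>k. ereal (s k * (x - S)) + ereal (?a k)) \<longlonglongrightarrow> ?m * ereal (x - S) + tail ?m"
    using m_lim a_lim by (intro tendsto_add_ereal_nonneg) auto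
  then have "(\<lambda>k. ereal (s k * x - E (s k *\<^sub>R b))) \<longlonglongrightarrow> ?m * ereal (x - S) + tail ?m"
    by (simp add: algebra_simps)
  then show ?thesis using LIMSEQ_unique[OF If_lim] S by simp
qed

lemma tail_interior:
  assumes s: "s \<in> J1"
  shows "tail (ereal s) = If M Y f (G1 s *\<^sub>R b)"
proof -
  have "tail (ereal s) = enn2ereal (\<integral>\<^sup>+ t. e2ennreal (cramer M Y (tmean (f t *\<^sub>R (s *\<^sub>R b)))) \<partial>lborel01)"
    unfolding tail_def nn_integral_lborel01
    using tmean_line[of "f _ * s"] J1_scale[OF s]
    by (intro arg_cong[of _ _ enn2ereal] nn_integral_cong) (simp add: Kd1_interior Ie_def mult.commute[of s])
  also have "\<dots> = If M Y f (gE (s *\<^sub>R b))"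
    using s by (intro If_gE_integral[symmetric]) (simp add: J1_def)
  finally show ?thesis by (simp add: gE_line)
qed

end

section \<open>Reflection of the weight and the lower end of the range\<close>

lemma Ef_uminus: "Ef M Y (\<lambda>t. - f t) l = Ef M Y f (- l)"
  by (simp add: Ef_def)

lemma If_uminus: "If M Y (\<lambda>t. - f t) x = If M Y f (- x)"
proof -
  let ?g = "\<lambda>l. ereal (l \<bullet> (- x)) - Ef M Y f l"
  have "If M Y (\<lambda>t. - f t) x = Sup (range (?g \<circ> uminus))"
    by (simp add: If_def Ef_uminus comp_def)
  also have "range (?g \<circ> uminus) = range ?g"
    by (simp only: image_comp[symmetric] surj_uminus)
  finally show ?thesis by (simp add: If_def)
qed

lemma fpmax_uminus: "fpmax (\<lambda>t. - f t) = fmmax f" and fmmax_uminus: "fmmax (\<lambda>t. - f t) = fpmax f"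
  by (simp_all add: fpmax_def fmmax_def)

lemma Mplus_uminus: "Mplus M Y (\<lambda>t. - f t) b = Mminus M Y f b"
  by (simp add: Mplus_def Mminus_def fpmax_uminus fmmax_uminus)

context one_dim
begin

lemma one_dim_uminus: "one_dim M Y (\<lambda>t. - f t) b"
  using f_nz by unfold_locales (simp_all add: continuous_on_minus[OF f_cont] K_zero nondeg dim1 b)

text \<open>Under reflection the domain and the slopes change sign, so \<open>Esup\<close> becomes
  \<open>- Einf\<close>, \<open>Mp\<close> becomes \<open>Mm\<close>, and in the integral the sign
  passes from the weight to the endpoint.\<close>

lemma If_below:
  assumes x: "ereal x \<le> Einf"
  shows "If M Y f (x *\<^sub>R b) = Mm * (Einf - ereal x) + tail (- Mm)"
proof -
  interpret neg: one_dim M Y "\<lambda>t. - f t" b by (rule one_dim_uminus)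
  have good: "l \<in> neg.good \<longleftrightarrow> - l \<in> good" for l by (simp add: neg.good_def good_def)
  have J: "s \<in> neg.J1 \<longleftrightarrow> - s \<in> J1" for s by (simp add: neg.J1_def J1_def good)
  have gE: "neg.gE l = - gE (- l)" for l by (simp add: neg.gE_def gE_def)
  have G: "neg.G1 s = - G1 (- s)" for s by (simp add: neg.G1_def G1_def gE)
  have "neg.J1 = uminus ` J1" using J by (force simp: image_iff)
  then have "supEd M Y (\<lambda>t. - f t) b = (SUP s\<in>J1. - ereal (G1 s))"
    unfolding neg.supEd_eq by (simp add: image_image G)
  also have "\<dots> = - Einf" unfolding infEd_eq by (rule ereal_SUP_uminus_eq)
  finally have sup: "supEd M Y (\<lambda>t. - f t) b = - Einf" .
  have "supEd M Y (\<lambda>t. - f t) b \<le> - ereal x" unfolding sup using x by (simp only: ereal_minus_le_minus)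
  then have "supEd M Y (\<lambda>t. - f t) b \<le> ereal (- x)" by simp
  from neg.If_above[OF this]
  have "If M Y f (x *\<^sub>R b) = Mm * (ereal (- x) - - Einf) + neg.tail (Mm)"
    by (simp add: If_uminus Mplus_uminus sup)
  moreover have "ereal (- x) - - Einf = Einf - ereal x"
    by (cases "Einf") auto
  moreover have "neg.tail (Mm) = tail (- Mm)"
    by (simp add: neg.tail_def tail_def flip: uminus_ereal.simps(1))
  ultimately show ?thesis by simp
qed

text \<open>At most one linear term is nonzero; in the other one a possibly infinite coefficient is
  multiplied by 0, which gives 0.\<close>

lemma If_one_dim:
  "If M Y f (x *\<^sub>R b) = Mp * max 0 (ereal x - Esup)
     + Mm * max 0 (- (ereal x - Einf)) + tail (gbar M Y f b x)"
proof -
  consider "Esup \<le> ereal x" | "ereal x \<le> Einf" | "Einf < ereal x" "ereal x < Esup"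
    by fastforce
  then show ?thesis
  proof cases
    case 1
    have "Einf < ereal x" using inf_less_sup 1 by (rule less_le_trans)
    then have "max 0 (- (ereal x - Einf)) = 0"
      by (cases "Einf") (auto simp: max_def)
    moreover have "max 0 (ereal x - Esup) = ereal x - Esup"
      using 1 by (cases "Esup") (auto simp: max_def)
    ultimately show ?thesis using If_above[OF 1] gbar_upper[OF 1] by simp
  next
    case 2
    have "ereal x < Esup" using 2 inf_less_sup by (rule le_less_trans)
    then have "max 0 (ereal x - Esup) = 0"
      by (cases "Esup") (auto simp: max_def)
    moreover have "max 0 (- (ereal x - Einf)) = Einf - ereal x"
      using 2 by (cases "Einf") (auto simp: max_def)
    ultimately show ?thesis using If_below[OF 2] gbar_lower[OF 2] by simp
  next
    case 3
    then obtain s where s: "s \<in> J1" "G1 s = x" by (rule G1_surj)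
    have "max 0 (ereal x - Esup) = 0" "max 0 (- (ereal x - Einf)) = 0"
      using 3 by (cases "Esup"; auto simp: max_def)(cases "Einf"; use 3 in \<open>auto simp: max_def\<close>)
    then show ?thesis using tail_interior[OF s(1)] gbar_middle[OF s(1)] s(2) by simp
  qed
qed

end

text \<open>The differentiability clause ensures that \<open>grad\<close>, which is defined by
  choice, is the true gradient on the interior of the domain. Passing through
  \<open>e2ennreal\<close> loses nothing, since \<open>I\<close> is nonnegative: 0 lies in the
  domain and \<open>K\<close> vanishes there.\<close>

theorem theorem6p1:
  fixes M :: "'a measure" and X :: "nat \<Rightarrow> 'a \<Rightarrow> 'v::euclidean_space" and f :: "real \<Rightarrow> real"
  assumes "prob_space M"
    and "\<And>i. i \<ge> 1 \<Longrightarrow> X i \<in> borel_measurable M"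
    and "prob_space.indep_vars M (\<lambda>_. borel) X {1..}"
    and "\<And>i. i \<ge> 1 \<Longrightarrow> distr M borel (X i) = distr M borel (X 1)"
    and "0 \<in> interior (domL M (X 1))"
    and "\<exists>C. C-lipschitz_on {0..1} f"
    and "\<exists>t\<in>{0..1}. f t \<noteq> 0"
  shows "ldp M (wmean X f) (If M (X 1) f)
     \<and> (aff_dim (law_support M (X 1)) = int DIM('v) \<longrightarrow>
          (\<forall>l\<in>interior (Df M (X 1) f). Efr M (X 1) f differentiable (at l))
        \<and> inj_on (grad (Efr M (X 1) f)) (interior (Df M (X 1) f))
        \<and> (\<forall>x\<in>grad (Efr M (X 1) f) ` interior (Df M (X 1) f).
             If M (X 1) f x =
               enn2ereal (\<integral>\<^sup>+ t\<in>{0..1}. e2ennreal (cramer M (X 1)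
                  (grad (cgf M (X 1))
                     (f t *\<^sub>R inv_into (interior (Df M (X 1) f)) (grad (Efr M (X 1) f)) x))) \<partial>lborel))
        \<and> (DIM('v) = 1 \<longrightarrow> (\<forall>b\<in>Basis. \<forall>x::real.
             If M (X 1) f (x *\<^sub>R b) =
               Mplus M (X 1) f b * max 0 (ereal x - supEd M (X 1) f b)
             + Mminus M (X 1) f b * max 0 (- (ereal x - infEd M (X 1) f b))
             + enn2ereal (\<integral>\<^sup>+ t\<in>{0..1}. e2ennreal (Ie M (X 1) b
                  (Kd1 M (X 1) b (gbar M (X 1) f b x * ereal (f t)))) \<partial>lborel))))"
proof -
  interpret prob_space M by (rule assms(1))
  have f_cont: "continuous_on {0..1} f"
    using assms(6) lipschitz_on_continuous_on by blast
  interpret iid: iid_weighted M X f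
    by (rule iid_weighted.intro[OF assms(1)], rule iid_weighted_axioms.intro) (fact assms f_cont)+
  have ldp: "ldp M (wmean X f) (If M (X 1) f)" using iid.ldp_wmean by simp
  show ?thesis
  proof (intro conjI impI ldp)
    assume dim: "aff_dim (law_support M (X 1)) = int DIM('v)"
    have nd: "\<not> (AE \<omega> in M. h \<bullet> X 1 \<omega> = c)" if "h \<noteq> 0" for h c
      using assms(2)[of 1] dim that by (intro full_support_nondegenerate) auto
    interpret nondegenerate_moments M "X 1" f
      using iid.base.weighted_moments_axioms iid.K_zero nd assms(7)
      by (intro nondegenerate_moments.intro normalized_moments.intro
          nondegenerate_moments_axioms.intro normalized_moments_axioms.intro) auto
    show "\<forall>l\<in>interior (Df M (X 1) f). Efr M (X 1) f differentiable (at l)"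
      unfolding interior_Df differentiable_def using Efr_has_derivative by blast
    show "inj_on (grad (Efr M (X 1) f)) (interior (Df M (X 1) f))"
      unfolding interior_Df by (rule inj_on_grad_Efr)
    show "\<forall>x\<in>grad (Efr M (X 1) f) ` interior (Df M (X 1) f).
             If M (X 1) f x =
               enn2ereal (\<integral>\<^sup>+ t\<in>{0..1}. e2ennreal (cramer M (X 1)
                  (grad (cgf M (X 1))
                     (f t *\<^sub>R inv_into (interior (Df M (X 1) f)) (grad (Efr M (X 1) f)) x))) \<partial>lborel)"
      unfolding interior_Df using If_grad_image by blast
    assume d1: "DIM('v) = 1"
    show "\<forall>b\<in>Basis. \<forall>x::real.
             If M (X 1) f (x *\<^sub>R b) =
               Mplus M (X 1) f b * max 0 (ereal x - supEd M (X 1) f b)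
             + Mminus M (X 1) f b * max 0 (- (ereal x - infEd M (X 1) f b))
             + enn2ereal (\<integral>\<^sup>+ t\<in>{0..1}. e2ennreal (Ie M (X 1) b
                  (Kd1 M (X 1) b (gbar M (X 1) f b x * ereal (f t)))) \<partial>lborel)"
    proof (intro ballI allI)
      fix b :: 'v and x :: real assume b: "b \<in> Basis"
      interpret one_dim M "X 1" f b by unfold_locales (use d1 b in auto)
      show "If M (X 1) f (x *\<^sub>R b) =
               Mplus M (X 1) f b * max 0 (ereal x - supEd M (X 1) f b)
             + Mminus M (X 1) f b * max 0 (- (ereal x - infEd M (X 1) f b))
             + enn2ereal (\<integral>\<^sup>+ t\<in>{0..1}. e2ennreal (Ie M (X 1) b
                  (Kd1 M (X 1) b (gbar M (X 1) f b x * ereal (f t)))) \<partial>lborel)"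
        using If_one_dim unfolding tail_def .
    qed
  qed
qed

end
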